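(* Fix integers $r\ge 2$ and $m,n\ge 1$, and an appropriate function $\mu$. Let $T_{\mathrm{uncol}}=\mathrm{Th}(M_0)$ be the theory of Hrushovski's uncollapsed ab initio structure $M_0$ (the generic structure of $(\mathcal C_0,\le)$) and $T_{\mathrm{col}}=\mathrm{Th}(D_\mu)$ the theory of Hrushovski's collapsed ab initio structure $D_\mu$ (the generic structure of $(\mathcal C_\mu,\le)$). Then both $T_{\mathrm{uncol}}$ and $T_{\mathrm{col}}$ satisfy linear Zarankiewicz and strong Erdős–Hajnal, that is, in each of these theories, for every partitioned formula $\varphi(x_1,x_2)$ with $x_1,x_2$ finite tuples of variables, $\varphi$ satisfies linear Zarankiewicz and the relation defined by $\varphi$ satisfies sEH.
   Context: Ab initio structures. $\mathcal C$ is the class of finite $r$-uniform hypergraphs, viewed as structures with a single $r$-ary relation $R$, irreflexive (holding only of tuples of distinct elements) and invariant under permutation of coordinates. For $B\in\mathcal C$ let $R(B)$ be the set of hyperedges of $B$ and $\delta(B)=n|B|-m|R(B)|$ (the predimension). For $A\subseteq B$ (finite), $A\le B$ ($A$ is self-sufficient in $B$) means $\delta(A)\le\delta(B')$ for all $A\subseteq B'\subseteq B$; a finite $A$ is self-sufficient in an infinite structure $N$ if $A\le B$ for every finite $B$ with $A\subseteq B\subseteq N$. $\mathcal C_0$ is the class of $B\in\mathcal C$ with $\delta(A)\ge0$ for all $A\subseteq B$. For an amalgamation class $(\mathcal K,\le)$ of finite structures, its generic structure is the countable structure $N$ (unique up to isomorphism) such that $N$ is the union of a $\le$-increasing chain of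 finite self-sufficient substructures in $\mathcal K$, and whenever $A\le N$ is finite and $A\le B\in\mathcal K$, there is an embedding $g:B\to N$ over $A$ with $g(B)\le N$. $M_0$ is the generic structure of $(\mathcal C_0,\le)$; it is $\omega$-saturated, $\omega$-stable. Collapse. For $A\subsetneq B$ in $\mathcal C_0$, $B$ is simply algebraic over $A$ if $\delta(B)=\delta(A)$ and $\delta(B')>\delta(A)$ for all $A\subsetneq B'\subsetneq B$; it is minimally simply algebraic if moreover there is no $A'\subsetneq A$ such that $A'\cup(B\setminus A)$ is simply algebraic over $A'$. Let $\mu$ be a function from isomorphism types of minimally simply algebraic extensions $(A,B)$ in $\mathcal C_0$ to the non-negative integers. $\mathcal C_\mu$ is the class of $H\in\mathcal C_0$ such that for every minimally simply algebraic $(A,B)$ and every copy of $A$ in $H$, there are at most $\mu(A,B)$ copies of $B$ over that copy of $A$ in $H$ that are pairwise disjoint over it. The function $\mu$ is appropriate if it is as in Hrushovski's construction: $(\mathcal C_\mu,\le)$ is an amalgamation class and its generic structure $D_\mu$ is $\omega$-saturated and strongly minimal (the usual sufficient condition in the construction is $\mu(A,B)\ge\delta(A)$). Linear Zarankiewicz. For a complete theory $T$ and $M\models T$, a partitioned formula $\varphi(x_1,x_2)$ satisfies linear Zarankiewicz if for every $t\in\mathbb N$ there is $c=c(\varphi,t)\in\mathbb R$ such that for any $n\in\mathbb N$ and finite $A_i\subseteq M^{x_i}$ with $|A_i|=n$ ($i=1,2$) such that the bipartite graph $\varphi(A_1,A_2)=\{(a_1,a_2)\in A_1\times A_2: M\models\varphi(a_1,a_2)\}$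 (with parts $A_1,A_2$) is $K_{t,t}$-free, we have $|\varphi(A_1,A_2)|\le cn$. (This $n$ is unrelated to the coefficient in $\delta$. The property does not depend on the choice of $M\models T$.) sEH. A relation $E\subseteq X\times Y$ satisfies sEH if there is a real $\beta>0$ such that for any probability measures $\lambda$ on $X$ and $\nu$ on $Y$ concentrated on finite subsets there are $X_0\subseteq X$, $Y_0\subseteq Y$ with $\lambda(X_0),\nu(Y_0)>\beta$ and either $X_0\times Y_0\subseteq E$ or $(X_0\times Y_0)\cap E=\emptyset$. For a formula, this is applied to the relation it defines on $M^{x_1}\times M^{x_2}$. *)

theory Defs
  imports "HOL-Probability.Probability_Mass_Function" "HOL-Library.Multiset"
begin

section \<open>Structures and first-order logic with one relation symbol\<close>

text \<open>Tuples of elements are lists. The universe may be empty, since the empty hypergraph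
  belongs to the classes considered below.\<close>

record 'a struct =
  univ :: "'a set"
  rel :: "'a list set"

definition r_struct :: "nat \<Rightarrow> 'a struct \<Rightarrow> bool" where
  "r_struct r M \<longleftrightarrow> (\<forall>xs \<in> rel M. length xs = r \<and> set xs \<subseteq> univ M)"

definition substr :: "'a struct \<Rightarrow> 'a set \<Rightarrow> 'a struct" where
  "substr M A = \<lparr>univ = A, rel = {xs \<in> rel M. set xs \<subseteq> A}\<rparr>"

definition embedding :: "('a \<Rightarrow> 'b) \<Rightarrow> 'a struct \<Rightarrow> 'b struct \<Rightarrow> bool" where
  "embedding f A B \<longleftrightarrow> inj_on f (univ A) \<and> f ` univ A \<subseteq> univ B \<and>
     (\<forall>xs. set xs \<subseteq> univ A \<longrightarrow> (map f xs \<in> rel B \<longleftrightarrow> xs \<in> rel A))"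

definition isomorphism :: "('a \<Rightarrow> 'b) \<Rightarrow> 'a struct \<Rightarrow> 'b struct \<Rightarrow> bool" where
  "isomorphism f A B \<longleftrightarrow> embedding f A B \<and> f ` univ A = univ B"

datatype form =
    Eq nat nat
  | Rel "nat list"
  | Neg form
  | Conj form form
  | Ex nat form

text \<open>A formula of the language with an \<open>r\<close>-ary relation symbol.\<close>

primrec r_form :: "nat \<Rightarrow> form \<Rightarrow> bool" where
  "r_form r (Eq u v) = True"
| "r_form r (Rel vs) = (length vs = r)"
| "r_form r (Neg \<phi>) = r_form r \<phi>"
| "r_form r (Conj \<phi> \<psi>) = (r_form r \<phi> \<and> r_form r \<psi>)"
| "r_form r (Ex v \<phi>) = r_form r \<phi>"

primrec fv :: "form \<Rightarrow> nat set" where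
  "fv (Eq u v) = {u, v}"
| "fv (Rel vs) = set vs"
| "fv (Neg \<phi>) = fv \<phi>"
| "fv (Conj \<phi> \<psi>) = fv \<phi> \<union> fv \<psi>"
| "fv (Ex v \<phi>) = fv \<phi> - {v}"

primrec sat :: "'a struct \<Rightarrow> (nat \<Rightarrow> 'a) \<Rightarrow> form \<Rightarrow> bool" where
  "sat M e (Eq u v) = (e u = e v)"
| "sat M e (Rel vs) = (map e vs \<in> rel M)"
| "sat M e (Neg \<phi>) = (\<not> sat M e \<phi>)"
| "sat M e (Conj \<phi> \<psi>) = (sat M e \<phi> \<and> sat M e \<psi>)"
| "sat M e (Ex v \<phi>) = (\<exists>a \<in> univ M. sat M (e(v := a)) \<phi>)"

definition Th :: "nat \<Rightarrow> 'a struct \<Rightarrow> form set" where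
  "Th r M = {\<phi>. r_form r \<phi> \<and> fv \<phi> = {} \<and> (\<forall>e. sat M e \<phi>)}"

definition models :: "nat \<Rightarrow> 'a struct \<Rightarrow> form set \<Rightarrow> bool" where
  "models r M T \<longleftrightarrow> r_struct r M \<and> (\<forall>\<phi> \<in> T. \<forall>e. sat M e \<phi>)"

text \<open>Every set of formulas in the variable \<open>v\<close>, with parameters given by the values under \<open>e\<close>
  of the finitely many variables in \<open>F\<close>, is realized if it is finitely satisfiable.\<close>

definition omega_saturated :: "nat \<Rightarrow> 'a struct \<Rightarrow> bool" where
  "omega_saturated r M \<longleftrightarrow>
     (\<forall>e F v p. range e \<subseteq> univ M \<and> finite F \<and> (\<forall>\<phi> \<in> p. r_form r \<phi> \<and> fv \<phi> \<subseteq> insert v F) \<and>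
        (\<forall>q \<subseteq> p. finite q \<longrightarrow> (\<exists>a \<in> univ M. \<forall>\<phi> \<in> q. sat M (e(v := a)) \<phi>)) \<longrightarrow>
        (\<exists>a \<in> univ M. \<forall>\<phi> \<in> p. sat M (e(v := a)) \<phi>))"

text \<open>In every model of the theory of \<open>D\<close>, every subset definable with parameters is finite or
  cofinite. By the downward Loewenheim-Skolem theorem it is enough to consider models whose
  universe is a set of natural numbers.\<close>

definition strongly_minimal :: "nat \<Rightarrow> 'a struct \<Rightarrow> bool" where
  "strongly_minimal r D \<longleftrightarrow> infinite (univ D) \<and>
     (\<forall>N :: nat struct. models r N (Th r D) \<longrightarrow>
        (\<forall>\<phi> v e. r_form r \<phi> \<and> range e \<subseteq> univ N \<longrightarrow>
           finite {a \<in> univ N. sat N (e(v := a)) \<phi>} \<or>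
           finite {a \<in> univ N. \<not> sat N (e(v := a)) \<phi>}))"

section \<open>Ab initio structures\<close>

definition hypergraph :: "nat \<Rightarrow> 'a struct \<Rightarrow> bool" where
  "hypergraph r M \<longleftrightarrow> r_struct r M \<and> (\<forall>xs \<in> rel M. distinct xs) \<and>
     (\<forall>xs \<in> rel M. \<forall>ys. mset ys = mset xs \<longrightarrow> ys \<in> rel M)"

definition hyperedges :: "'a struct \<Rightarrow> 'a set set" where
  "hyperedges M = set ` rel M"

definition predim :: "nat \<Rightarrow> nat \<Rightarrow> 'a struct \<Rightarrow> int" where
  "predim n m B = int n * int (card (univ B)) - int m * int (card (hyperedges B))"

text \<open>\<open>A \<le> N\<close> for a finite subset \<open>A\<close> of a finite or infinite structure \<open>N\<close>.\<close>

definition self_sufficient :: "nat \<Rightarrow> nat \<Rightarrow> 'a struct \<Rightarrow> 'a set \<Rightarrow> bool" where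
  "self_sufficient n m N A \<longleftrightarrow> finite A \<and> A \<subseteq> univ N \<and>
     (\<forall>B. finite B \<and> A \<subseteq> B \<and> B \<subseteq> univ N \<longrightarrow> predim n m (substr N A) \<le> predim n m (substr N B))"

text \<open>Every finite or countable structure has a copy on a set of natural numbers. The classes of
  finite structures below are therefore represented by sets of structures of type
  \<open>nat struct\<close>, closed under isomorphism, and their generic structures also have this type.\<close>

definition class_C0 :: "nat \<Rightarrow> nat \<Rightarrow> nat \<Rightarrow> nat struct set" where
  "class_C0 r n m = {B. hypergraph r B \<and> finite (univ B) \<and>
     (\<forall>A \<subseteq> univ B. predim n m (substr B A) \<ge> 0)}"

definition amalgamation_class :: "nat \<Rightarrow> nat \<Rightarrow> nat \<Rightarrow> nat struct set \<Rightarrow> bool" where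
  "amalgamation_class r n m K \<longleftrightarrow> K \<noteq> {} \<and>
     (\<forall>B \<in> K. r_struct r B \<and> finite (univ B)) \<and>
     (\<forall>A f B. A \<in> K \<and> r_struct r B \<and> isomorphism f A B \<longrightarrow> B \<in> K) \<and>
     (\<forall>B \<in> K. \<forall>A. self_sufficient n m B A \<longrightarrow> substr B A \<in> K) \<and>
     (\<forall>B1 \<in> K. \<forall>B2 \<in> K. \<exists>C \<in> K. \<exists>g1 g2.
        embedding g1 B1 C \<and> self_sufficient n m C (g1 ` univ B1) \<and>
        embedding g2 B2 C \<and> self_sufficient n m C (g2 ` univ B2)) \<and>
     (\<forall>A \<in> K. \<forall>B1 \<in> K. \<forall>B2 \<in> K. \<forall>f1 f2.
        embedding f1 A B1 \<and> self_sufficient n m B1 (f1 ` univ A) \<and>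
        embedding f2 A B2 \<and> self_sufficient n m B2 (f2 ` univ A) \<longrightarrow>
        (\<exists>C \<in> K. \<exists>g1 g2.
           embedding g1 B1 C \<and> self_sufficient n m C (g1 ` univ B1) \<and>
           embedding g2 B2 C \<and> self_sufficient n m C (g2 ` univ B2) \<and>
           (\<forall>a \<in> univ A. g1 (f1 a) = g2 (f2 a))))"

definition generic_structure :: "nat \<Rightarrow> nat \<Rightarrow> nat \<Rightarrow> nat struct set \<Rightarrow> nat struct \<Rightarrow> bool" where
  "generic_structure r n m K N \<longleftrightarrow> r_struct r N \<and>
     (\<exists>F :: nat \<Rightarrow> nat set. (\<Union>i. F i) = univ N \<and>
        (\<forall>i. F i \<subseteq> F (Suc i) \<and> self_sufficient n m (substr N (F (Suc i))) (F i) \<and>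
             self_sufficient n m N (F i) \<and> substr N (F i) \<in> K)) \<and>
     (\<forall>A. \<forall>B \<in> K. self_sufficient n m N A \<and> self_sufficient n m B A \<and> substr B A = substr N A \<longrightarrow>
        (\<exists>g. embedding g B N \<and> (\<forall>a \<in> A. g a = a) \<and> self_sufficient n m N (g ` univ B)))"

section \<open>The collapse\<close>

text \<open>An extension \<open>A \<subseteq> B\<close> is given by the structure \<open>B\<close> and the universe of \<open>A\<close>.\<close>

definition simply_algebraic :: "nat \<Rightarrow> nat \<Rightarrow> 'a set \<Rightarrow> 'a struct \<Rightarrow> bool" where
  "simply_algebraic n m A B \<longleftrightarrow> A \<subset> univ B \<and> predim n m B = predim n m (substr B A) \<and>
     (\<forall>B'. A \<subset> B' \<and> B' \<subset> univ B \<longrightarrow> predim n m (substr B B') > predim n m (substr B A))"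

definition minimally_simply_algebraic :: "nat \<Rightarrow> nat \<Rightarrow> nat \<Rightarrow> nat set \<Rightarrow> nat struct \<Rightarrow> bool" where
  "minimally_simply_algebraic r n m A B \<longleftrightarrow> B \<in> class_C0 r n m \<and> simply_algebraic n m A B \<and>
     \<not> (\<exists>A'. A' \<subset> A \<and> simply_algebraic n m A' (substr B (A' \<union> (univ B - A))))"

text \<open>\<open>\<mu>\<close> depends only on the isomorphism type of a minimally simply algebraic extension. Its values
  on other arguments are never used.\<close>

definition iso_invariant :: "nat \<Rightarrow> nat \<Rightarrow> nat \<Rightarrow> (nat set \<Rightarrow> nat struct \<Rightarrow> nat) \<Rightarrow> bool" where
  "iso_invariant r n m \<mu> \<longleftrightarrow> (\<forall>A B A' B' f.
     minimally_simply_algebraic r n m A B \<and> minimally_simply_algebraic r n m A' B' \<and>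
     isomorphism f B B' \<and> f ` A = A' \<longrightarrow> \<mu> A B = \<mu> A' B')"

text \<open>A copy of \<open>A\<close> in \<open>H\<close> is given by an embedding \<open>f\<close>, and a copy of \<open>B\<close> over it is the image of
  an embedding of \<open>B\<close> that extends \<open>f\<close>.\<close>

definition class_Cmu ::
    "nat \<Rightarrow> nat \<Rightarrow> nat \<Rightarrow> (nat set \<Rightarrow> nat struct \<Rightarrow> nat) \<Rightarrow> nat struct set" where
  "class_Cmu r n m \<mu> = {H \<in> class_C0 r n m.
     \<forall>A B f S. minimally_simply_algebraic r n m A B \<and> embedding f (substr B A) H \<and>
       (\<forall>X \<in> S. \<exists>g. embedding g B H \<and> (\<forall>a \<in> A. g a = f a) \<and> X = g ` univ B) \<and>
       pairwise (\<lambda>X Y. X \<inter> Y = f ` A) S \<longrightarrow> card S \<le> \<mu> A B}"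

definition appropriate :: "nat \<Rightarrow> nat \<Rightarrow> nat \<Rightarrow> (nat set \<Rightarrow> nat struct \<Rightarrow> nat) \<Rightarrow> bool" where
  "appropriate r n m \<mu> \<longleftrightarrow> iso_invariant r n m \<mu> \<and> amalgamation_class r n m (class_Cmu r n m \<mu>) \<and>
     (\<forall>D. generic_structure r n m (class_Cmu r n m \<mu>) D \<longrightarrow>
        omega_saturated r D \<and> strongly_minimal r D)"

section \<open>Linear Zarankiewicz and strong Erdos-Hajnal\<close>

definition partitioned_formula :: "nat \<Rightarrow> form \<Rightarrow> nat list \<Rightarrow> nat list \<Rightarrow> bool" where
  "partitioned_formula r \<phi> x1 x2 \<longleftrightarrow>
     r_form r \<phi> \<and> distinct (x1 @ x2) \<and> fv \<phi> \<subseteq> set (x1 @ x2)"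

definition tuples :: "'a struct \<Rightarrow> nat list \<Rightarrow> 'a list set" where
  "tuples M x = {a. length a = length x \<and> set a \<subseteq> univ M}"

text \<open>The assignment below is only relevant on the variables in \<open>x1\<close> and \<open>x2\<close>.\<close>

definition defined_relation ::
    "'a struct \<Rightarrow> form \<Rightarrow> nat list \<Rightarrow> nat list \<Rightarrow> ('a list \<times> 'a list) set" where
  "defined_relation M \<phi> x1 x2 = {(a1, a2). a1 \<in> tuples M x1 \<and> a2 \<in> tuples M x2 \<and>
     sat M (\<lambda>v. the (map_of (zip (x1 @ x2) (a1 @ a2)) v)) \<phi>}"

definition K_free :: "nat \<Rightarrow> 'x set \<Rightarrow> 'y set \<Rightarrow> ('x \<times> 'y) set \<Rightarrow> bool" where
  "K_free t A1 A2 E \<longleftrightarrow>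
     \<not> (\<exists>S1 \<subseteq> A1. \<exists>S2 \<subseteq> A2. finite S1 \<and> finite S2 \<and> card S1 = t \<and> card S2 = t \<and> S1 \<times> S2 \<subseteq> E)"

definition linear_Zarankiewicz :: "'a struct \<Rightarrow> form \<Rightarrow> nat list \<Rightarrow> nat list \<Rightarrow> bool" where
  "linear_Zarankiewicz M \<phi> x1 x2 \<longleftrightarrow>
     (\<forall>t :: nat. \<exists>c :: real. \<forall>(k :: nat) A1 A2.
        A1 \<subseteq> tuples M x1 \<and> finite A1 \<and> card A1 = k \<and>
        A2 \<subseteq> tuples M x2 \<and> finite A2 \<and> card A2 = k \<and>
        K_free t A1 A2 (defined_relation M \<phi> x1 x2 \<inter> A1 \<times> A2) \<longrightarrow>
        real (card (defined_relation M \<phi> x1 x2 \<inter> A1 \<times> A2)) \<le> c * real k)"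

text \<open>A probability measure concentrated on a finite set is a \<open>pmf\<close> with finite support.\<close>

definition sEH :: "'x set \<Rightarrow> 'y set \<Rightarrow> ('x \<times> 'y) set \<Rightarrow> bool" where
  "sEH X Y E \<longleftrightarrow> (\<exists>\<beta> :: real. \<beta> > 0 \<and>
     (\<forall>(L :: 'x pmf) (N :: 'y pmf).
        finite (set_pmf L) \<and> set_pmf L \<subseteq> X \<and> finite (set_pmf N) \<and> set_pmf N \<subseteq> Y \<longrightarrow>
        (\<exists>X0 \<subseteq> X. \<exists>Y0 \<subseteq> Y. measure_pmf.prob L X0 > \<beta> \<and> measure_pmf.prob N Y0 > \<beta> \<and>
           (X0 \<times> Y0 \<subseteq> E \<or> (X0 \<times> Y0) \<inter> E = {}))))"

end

(* The quantitative core is a notion of fractional cover: a relation E is covered by weighted boxes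
   X x Y contained in E such that every point lies in boxes of total weight at most 1 on each side,
   while every pair in E has total weight at least 1/C. Unary conditions, equalities p i = q j and
   their negations are coverable, and coverable relations are closed under conjunction and
   disjunction. A cover of a K_{t,t}-free relation yields the linear bound, because each box has a
   side with fewer than t elements; covers of E and of its complement yield sEH, because one of
   the two relations has measure at least 1/2.

   In a generic structure N, Hall's theorem charges the m units of each hyperedge to its vertices,
   at most n per vertex. Thus the hyperedges are coded by finitely many unary functions. By
   back-and-forth, made effective by free amalgams in the uncollapsed case and by omega-saturation
   in the collapsed case, the truth of a formula at a tuple depends only on the
   bounded finite sets Z over the tuple all of whose proper subsets over the tuple have larger
   predimension. Such a Z is reached from the tuple by short words in the unary functions, so the
   formula is a Boolean combination of equalities between words applied to single coordinates.
   Finite patterns of a formula in a model of Th(N) already occur in N. *)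

theory Submission
  imports Defs
begin

section \<open>Fractional covers by boxes\<close>

text \<open>Weights are forced by the relation \<open>p i \<noteq> q j\<close>: no bounded number of
  boxes covers it when many values occur, while averaging over all splittings of the values covers
  it at a fixed price. Allowing load 1 at every point is what makes counts linear, since the
  weighted total of the sides of the boxes is then at most the number of points.

  The obstacle in the model theory is size. The self-sufficient hull of a tuple need not be bounded,
  but a Boolean combination may mention only finitely many words. In the uncollapsed class, strength
  is therefore tested on bounded extensions only, and copies are glued onto sets that are strong in
  this weak sense; the result stays in the class because all that can go wrong is a negative
  predimension. In the collapsed class such an amalgam may violate the bounds given by \<mu>. There
  the back-and-forth uses only isomorphic copies of self-sufficient sets, and the existence of a
  size bound is left to compactness inside the saturated structure.\<close>

definition box_cover :: "real \<Rightarrow> 'i set \<Rightarrow> 'j set \<Rightarrow> ('i \<Rightarrow> 'j \<Rightarrow> bool) \<Rightarrow> bool" where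
  "box_cover C I J E \<longleftrightarrow> (\<exists>(S :: nat set) w X Y. finite S \<and>
     (\<forall>s\<in>S. 0 \<le> w s \<and> X s \<subseteq> I \<and> Y s \<subseteq> J \<and> (\<forall>i\<in>X s. \<forall>j\<in>Y s. E i j)) \<and>
     (\<forall>i\<in>I. (\<Sum>s\<in>S. w s * indicator (X s) i) \<le> 1) \<and>
     (\<forall>j\<in>J. (\<Sum>s\<in>S. w s * indicator (Y s) j) \<le> 1) \<and>
     (\<forall>i\<in>I. \<forall>j\<in>J. E i j \<longrightarrow> 1 \<le> C * (\<Sum>s\<in>S. w s * (indicator (X s) i * indicator (Y s) j))))"

lemma box_coverI:
  fixes S :: "'k set" and w :: "'k \<Rightarrow> real"
  assumes "finite S"
    and "\<And>s. s \<in> S \<Longrightarrow> 0 \<le> w s" "\<And>s. s \<in> S \<Longrightarrow> X s \<subseteq> I" "\<And>s. s \<in> S \<Longrightarrow> Y s \<subseteq> J"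
    and "\<And>s i j. s \<in> S \<Longrightarrow> i \<in> X s \<Longrightarrow> j \<in> Y s \<Longrightarrow> E i j"
    and "\<And>i. i \<in> I \<Longrightarrow> (\<Sum>s\<in>S. w s * indicator (X s) i) \<le> 1"
    and "\<And>j. j \<in> J \<Longrightarrow> (\<Sum>s\<in>S. w s * indicator (Y s) j) \<le> 1"
    and "\<And>i j. i \<in> I \<Longrightarrow> j \<in> J \<Longrightarrow> E i j \<Longrightarrow>
           1 \<le> C * (\<Sum>s\<in>S. w s * (indicator (X s) i * indicator (Y s) j))"
  shows "box_cover C I J E"
proof -
  obtain h :: "'k \<Rightarrow> nat" where h: "inj_on h S"
    using finite_imp_inj_to_nat_seg[OF assms(1)] by blast
  let ?g = "inv_into S h"
  have g: "?g (h s) = s" if "s \<in> S" for s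
    using inv_into_f_f[OF h that] .
  have sum_eq: "(\<Sum>s\<in>h ` S. f (?g s)) = (\<Sum>s\<in>S. f s)" for f :: "'k \<Rightarrow> real"
    by (subst sum.reindex[OF h]) (auto intro!: sum.cong simp: g)
  show ?thesis
    unfolding box_cover_def
  proof (intro exI[of _ "h ` S"] exI[of _ "w \<circ> ?g"] exI[of _ "X \<circ> ?g"] exI[of _ "Y \<circ> ?g"] conjI)
    show "finite (h ` S)" using assms(1) by simp
    show "\<forall>s\<in>h ` S. 0 \<le> (w \<circ> ?g) s \<and> (X \<circ> ?g) s \<subseteq> I \<and> (Y \<circ> ?g) s \<subseteq> J \<and>
       (\<forall>i\<in>(X \<circ> ?g) s. \<forall>j\<in>(Y \<circ> ?g) s. E i j)"
      using assms(2-5) by (auto simp: g)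
    show "\<forall>i\<in>I. (\<Sum>s\<in>h ` S. (w \<circ> ?g) s * indicator ((X \<circ> ?g) s) i) \<le> 1"
      unfolding o_def sum_eq[where f="\<lambda>s. w s * indicator (X s) i" for i] using assms(6) by blast
    show "\<forall>j\<in>J. (\<Sum>s\<in>h ` S. (w \<circ> ?g) s * indicator ((Y \<circ> ?g) s) j) \<le> 1"
      unfolding o_def sum_eq[where f="\<lambda>s. w s * indicator (Y s) i" for i] using assms(7) by blast
    show "\<forall>i\<in>I. \<forall>j\<in>J. E i j \<longrightarrow>
        1 \<le> C * (\<Sum>s\<in>h ` S. (w \<circ> ?g) s * (indicator ((X \<circ> ?g) s) i * indicator ((Y \<circ> ?g) s) j))"
      unfolding o_def sum_eq[where f="\<lambda>s. w s * (indicator (X s) i * indicator (Y s) j)" for i j]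
      using assms(8) by blast
  qed
qed

lemma box_coverE:
  assumes "box_cover C I J E"
  obtains S :: "nat set" and w X Y where "finite S"
    "\<And>s. s \<in> S \<Longrightarrow> 0 \<le> w s \<and> X s \<subseteq> I \<and> Y s \<subseteq> J \<and> (\<forall>i\<in>X s. \<forall>j\<in>Y s. E i j)"
    "\<And>i. i \<in> I \<Longrightarrow> (\<Sum>s\<in>S. w s * indicator (X s) i) \<le> 1"
    "\<And>j. j \<in> J \<Longrightarrow> (\<Sum>s\<in>S. w s * indicator (Y s) j) \<le> 1"
    "\<And>i j. i \<in> I \<Longrightarrow> j \<in> J \<Longrightarrow> E i j \<Longrightarrow>
           1 \<le> C * (\<Sum>s\<in>S. w s * (indicator (X s) i * indicator (Y s) j))"
  using assms unfolding box_cover_def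
  apply (elim exE conjE)
  subgoal for S w X Y by (rule that[of S w X Y]) simp_all
  done

lemma box_cover_mono:
  assumes "box_cover C I J E" "C \<le> C'"
  shows "box_cover C' I J E"
proof -
  from assms(1) obtain S :: "nat set" and w X Y where S: "finite S"
    "\<And>s. s \<in> S \<Longrightarrow> 0 \<le> w s \<and> X s \<subseteq> I \<and> Y s \<subseteq> J \<and> (\<forall>i\<in>X s. \<forall>j\<in>Y s. E i j)"
    "\<And>i. i \<in> I \<Longrightarrow> (\<Sum>s\<in>S. w s * indicator (X s) i) \<le> 1"
    "\<And>j. j \<in> J \<Longrightarrow> (\<Sum>s\<in>S. w s * indicator (Y s) j) \<le> 1"
    "\<And>i j. i \<in> I \<Longrightarrow> j \<in> J \<Longrightarrow> E i j \<Longrightarrow>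
           1 \<le> C * (\<Sum>s\<in>S. w s * (indicator (X s) i * indicator (Y s) j))"
    by (rule box_coverE) blast
  show ?thesis
  proof (rule box_coverI[of S w X _ Y])
    fix i j assume "i \<in> I" "j \<in> J" "E i j"
    then have "1 \<le> C * (\<Sum>s\<in>S. w s * (indicator (X s) i * indicator (Y s) j))" by (rule S(5))
    also have "\<dots> \<le> C' * (\<Sum>s\<in>S. w s * (indicator (X s) i * indicator (Y s) j))"
      using S(2) assms(2) by (intro mult_right_mono sum_nonneg) auto
    finally show "1 \<le> C' * (\<Sum>s\<in>S. w s * (indicator (X s) i * indicator (Y s) j))" .
  qed (use S in auto)
qed

text \<open>The load at \<open>i\<close> is the load at \<open>\<alpha> i\<close>, so
  \<open>\<alpha>\<close> and \<open>\<beta>\<close> may identify points. This is how covers pass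
  between structures once a finite pattern has been copied.\<close>

lemma box_cover_pullback:
  assumes "box_cover C I J E" "\<alpha> ` I' \<subseteq> I" "\<beta> ` J' \<subseteq> J"
    and E: "\<And>i j. i \<in> I' \<Longrightarrow> j \<in> J' \<Longrightarrow> E' i j = E (\<alpha> i) (\<beta> j)"
  shows "box_cover C I' J' E'"
proof -
  from assms(1) obtain S :: "nat set" and w X Y where S: "finite S"
    "\<And>s. s \<in> S \<Longrightarrow> 0 \<le> w s \<and> X s \<subseteq> I \<and> Y s \<subseteq> J \<and> (\<forall>i\<in>X s. \<forall>j\<in>Y s. E i j)"
    "\<And>i. i \<in> I \<Longrightarrow> (\<Sum>s\<in>S. w s * indicator (X s) i) \<le> 1"
    "\<And>j. j \<in> J \<Longrightarrow> (\<Sum>s\<in>S. w s * indicator (Y s) j) \<le> 1"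
    "\<And>i j. i \<in> I \<Longrightarrow> j \<in> J \<Longrightarrow> E i j \<Longrightarrow>
           1 \<le> C * (\<Sum>s\<in>S. w s * (indicator (X s) i * indicator (Y s) j))"
    by (rule box_coverE) blast
  have i1: "indicator {i \<in> I'. \<alpha> i \<in> X s} i = (indicator (X s) (\<alpha> i) :: real)" if "i \<in> I'" for s i
    using that by (auto simp: indicator_def)
  have i2: "indicator {i \<in> J'. \<beta> i \<in> Y s} i = (indicator (Y s) (\<beta> i) :: real)" if "i \<in> J'" for s i
    using that by (auto simp: indicator_def)
  show ?thesis
  proof (rule box_coverI[of S w "\<lambda>s. {i \<in> I'. \<alpha> i \<in> X s}" _ "\<lambda>s. {j \<in> J'. \<beta> j \<in> Y s}"])
    show "(\<Sum>s\<in>S. w s * indicator {i \<in> I'. \<alpha> i \<in> X s} i) \<le> 1" if "i \<in> I'" for i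
      using S(3)[of "\<alpha> i"] assms(2) that by (auto simp: i1)
    show "(\<Sum>s\<in>S. w s * indicator {j \<in> J'. \<beta> j \<in> Y s} j) \<le> 1" if "j \<in> J'" for j
      using S(4)[of "\<beta> j"] assms(3) that by (auto simp: i2)
    show "1 \<le> C * (\<Sum>s\<in>S. w s * (indicator {i \<in> I'. \<alpha> i \<in> X s} i * indicator {j \<in> J'. \<beta> j \<in> Y s} j))"
      if "i \<in> I'" "j \<in> J'" "E' i j" for i j
      using S(5)[of "\<alpha> i" "\<beta> j"] assms(2,3) that E[of i j] by (auto simp: i1 i2)
    show "E' i j" if "s \<in> S" "i \<in> {i \<in> I'. \<alpha> i \<in> X s}" "j \<in> {j \<in> J'. \<beta> j \<in> Y s}" for s i j
      using that S(2)[of s] E[of i j] by auto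
  qed (use S in auto)
qed

text \<open>Intersect the boxes pairwise and multiply their weights. The weight at a pair factors,
  and each load is at most a product of two old loads.\<close>

lemma box_cover_conj:
  assumes "box_cover C1 I J E1" "box_cover C2 I J E2"
  shows "box_cover (C1 * C2) I J (\<lambda>i j. E1 i j \<and> E2 i j)"
proof -
  from assms(1) obtain S :: "nat set" and w X Y where S: "finite S"
    "\<And>s. s \<in> S \<Longrightarrow> 0 \<le> w s \<and> X s \<subseteq> I \<and> Y s \<subseteq> J \<and> (\<forall>i\<in>X s. \<forall>j\<in>Y s. E1 i j)"
    "\<And>i. i \<in> I \<Longrightarrow> (\<Sum>s\<in>S. w s * indicator (X s) i) \<le> 1"
    "\<And>j. j \<in> J \<Longrightarrow> (\<Sum>s\<in>S. w s * indicator (Y s) j) \<le> 1"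
    "\<And>i j. i \<in> I \<Longrightarrow> j \<in> J \<Longrightarrow> E1 i j \<Longrightarrow>
           1 \<le> C1 * (\<Sum>s\<in>S. w s * (indicator (X s) i * indicator (Y s) j))"
    by (rule box_coverE) blast
  from assms(2) obtain S' :: "nat set" and w' X' Y' where S': "finite S'"
    "\<And>s. s \<in> S' \<Longrightarrow> 0 \<le> w' s \<and> X' s \<subseteq> I \<and> Y' s \<subseteq> J \<and> (\<forall>i\<in>X' s. \<forall>j\<in>Y' s. E2 i j)"
    "\<And>i. i \<in> I \<Longrightarrow> (\<Sum>s\<in>S'. w' s * indicator (X' s) i) \<le> 1"
    "\<And>j. j \<in> J \<Longrightarrow> (\<Sum>s\<in>S'. w' s * indicator (Y' s) j) \<le> 1"
    "\<And>i j. i \<in> I \<Longrightarrow> j \<in> J \<Longrightarrow> E2 i j \<Longrightarrow>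
           1 \<le> C2 * (\<Sum>s\<in>S'. w' s * (indicator (X' s) i * indicator (Y' s) j))"
    by (rule box_coverE) blast
  have prod_sum: "(\<Sum>s\<in>S \<times> S'. w (fst s) * w' (snd s) * (f (fst s) * g (snd s)))
      = (\<Sum>s\<in>S. w s * f s) * (\<Sum>s\<in>S'. w' s * g s)" for f g :: "nat \<Rightarrow> real"
    by (simp add: sum_product sum.cartesian_product split_beta algebra_simps)
  have prod_sum2: "(\<Sum>s\<in>S \<times> S'. w (fst s) * w' (snd s) * ((f (fst s) * g (snd s)) * (f' (fst s) * g' (snd s))))
      = (\<Sum>s\<in>S. w s * (f s * f' s)) * (\<Sum>s\<in>S'. w' s * (g s * g' s))" for f g f' g' :: "nat \<Rightarrow> real"
    by (subst prod_sum[symmetric]) (simp add: algebra_simps)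
  have nn: "0 \<le> (\<Sum>s\<in>S. w s * indicator (X s) i)" "0 \<le> (\<Sum>s\<in>S'. w' s * indicator (X' s) i)" for i
    by (intro sum_nonneg mult_nonneg_nonneg; use S(2) S'(2) in auto)+
  have nn2: "0 \<le> (\<Sum>s\<in>S. w s * indicator (Y s) i)" "0 \<le> (\<Sum>s\<in>S'. w' s * indicator (Y' s) i)" for i
    by (intro sum_nonneg mult_nonneg_nonneg; use S(2) S'(2) in auto)+
  show ?thesis
  proof (rule box_coverI[of "S \<times> S'" "\<lambda>s. w (fst s) * w' (snd s)"
        "\<lambda>s. X (fst s) \<inter> X' (snd s)" _ "\<lambda>s. Y (fst s) \<inter> Y' (snd s)"])
    show "(\<Sum>s\<in>S \<times> S'. w (fst s) * w' (snd s) * indicator (X (fst s) \<inter> X' (snd s)) i) \<le> 1"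
      if "i \<in> I" for i
      unfolding indicator_inter_arith using S(3)[OF that] S'(3)[OF that] nn
      by (subst prod_sum) (simp add: mult_le_one)
    show "(\<Sum>s\<in>S \<times> S'. w (fst s) * w' (snd s) * indicator (Y (fst s) \<inter> Y' (snd s)) i) \<le> 1"
      if "i \<in> J" for i
      unfolding indicator_inter_arith using S(4)[OF that] S'(4)[OF that] nn2
      by (subst prod_sum) (simp add: mult_le_one)
    show "1 \<le> C1 * C2 * (\<Sum>s\<in>S \<times> S'. w (fst s) * w' (snd s) *
       (indicator (X (fst s) \<inter> X' (snd s)) i * indicator (Y (fst s) \<inter> Y' (snd s)) j))"
      if "i \<in> I" "j \<in> J" "E1 i j \<and> E2 i j" for i j
    proof -
      have "1 * 1 \<le> (C1 * (\<Sum>s\<in>S. w s * (indicator (X s) i * indicator (Y s) j))) *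
          (C2 * (\<Sum>s\<in>S'. w' s * (indicator (X' s) i * indicator (Y' s) j)))"
        using S(5)[of i j] S'(5)[of i j] that by (intro mult_mono) auto
      then show ?thesis
        unfolding indicator_inter_arith by (subst prod_sum2) (simp add: algebra_simps)
    qed
  qed (use S S' in \<open>fastforce+\<close>)
qed

text \<open>Put the two families side by side with halved weights. Halving keeps the loads at most 1
  and is the origin of the factor 2.\<close>

lemma box_cover_disj:
  assumes "box_cover C1 I J E1" "box_cover C2 I J E2" "0 \<le> C1" "0 \<le> C2"
  shows "box_cover (2 * (C1 + C2)) I J (\<lambda>i j. E1 i j \<or> E2 i j)"
proof -
  from assms(1) obtain S :: "nat set" and w X Y where S: "finite S"
    "\<And>s. s \<in> S \<Longrightarrow> 0 \<le> w s \<and> X s \<subseteq> I \<and> Y s \<subseteq> J \<and> (\<forall>i\<in>X s. \<forall>j\<in>Y s. E1 i j)"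
    "\<And>i. i \<in> I \<Longrightarrow> (\<Sum>s\<in>S. w s * indicator (X s) i) \<le> 1"
    "\<And>j. j \<in> J \<Longrightarrow> (\<Sum>s\<in>S. w s * indicator (Y s) j) \<le> 1"
    "\<And>i j. i \<in> I \<Longrightarrow> j \<in> J \<Longrightarrow> E1 i j \<Longrightarrow>
           1 \<le> C1 * (\<Sum>s\<in>S. w s * (indicator (X s) i * indicator (Y s) j))"
    by (rule box_coverE) blast
  from assms(2) obtain S' :: "nat set" and w' X' Y' where S': "finite S'"
    "\<And>s. s \<in> S' \<Longrightarrow> 0 \<le> w' s \<and> X' s \<subseteq> I \<and> Y' s \<subseteq> J \<and> (\<forall>i\<in>X' s. \<forall>j\<in>Y' s. E2 i j)"
    "\<And>i. i \<in> I \<Longrightarrow> (\<Sum>s\<in>S'. w' s * indicator (X' s) i) \<le> 1"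
    "\<And>j. j \<in> J \<Longrightarrow> (\<Sum>s\<in>S'. w' s * indicator (Y' s) j) \<le> 1"
    "\<And>i j. i \<in> I \<Longrightarrow> j \<in> J \<Longrightarrow> E2 i j \<Longrightarrow>
           1 \<le> C2 * (\<Sum>s\<in>S'. w' s * (indicator (X' s) i * indicator (Y' s) j))"
    by (rule box_coverE) blast
  let ?w = "case_sum (\<lambda>s. w s / 2) (\<lambda>s. w' s / 2)"
  have sum2: "(\<Sum>s\<in>S <+> S'. ?w s * f s) = (\<Sum>s\<in>S. w s * f (Inl s)) / 2 + (\<Sum>s\<in>S'. w' s * f (Inr s)) / 2"
    for f
    using S(1) S'(1) by (simp add: sum.Plus sum_divide_distrib)
  have nn: "0 \<le> (\<Sum>s\<in>S. w s * (indicator (X s) i * indicator (Y s) j))"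
     "0 \<le> (\<Sum>s\<in>S'. w' s * (indicator (X' s) i * indicator (Y' s) j))" for i j
    by (intro sum_nonneg mult_nonneg_nonneg; use S(2) S'(2) in auto)+
  show ?thesis
  proof (rule box_coverI[of "S <+> S'" ?w "case_sum X X'" _ "case_sum Y Y'"])
    show "(\<Sum>s\<in>S <+> S'. ?w s * indicator (case_sum X X' s) i) \<le> 1"
      if "i \<in> I" for i
      using S(3)[OF that] S'(3)[OF that] unfolding sum2 by simp
    show "(\<Sum>s\<in>S <+> S'. ?w s * indicator (case_sum Y Y' s) i) \<le> 1"
      if "i \<in> J" for i
      using S(4)[OF that] S'(4)[OF that] unfolding sum2 by simp
    show "1 \<le> 2 * (C1 + C2) * (\<Sum>s\<in>S <+> S'. ?w s *
       (indicator (case_sum X X' s) i * indicator (case_sum Y Y' s) j))"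
      if "i \<in> I" "j \<in> J" "E1 i j \<or> E2 i j" for i j
    proof -
      define a where "a = (\<Sum>s\<in>S. w s * (indicator (X s) i * indicator (Y s) j))"
      define b where "b = (\<Sum>s\<in>S'. w' s * (indicator (X' s) i * indicator (Y' s) j))"
      have ab: "0 \<le> a" "0 \<le> b" using nn unfolding a_def b_def by auto
      have "1 \<le> C1 * a \<or> 1 \<le> C2 * b"
        using S(5)[of i j] S'(5)[of i j] that unfolding a_def b_def by auto
      moreover have "0 \<le> C1 * a" "0 \<le> C1 * b" "0 \<le> C2 * a" "0 \<le> C2 * b"
        using assms(3,4) ab by auto
      ultimately have "1 \<le> 2 * (C1 + C2) * (a / 2 + b / 2)"
        by (simp add: algebra_simps) linarith
      then show ?thesis unfolding sum2 a_def b_def by simp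
    qed
  qed (use S(1) S'(1) in \<open>auto split: sum.splits dest!: S(2) S'(2)\<close>)
qed

lemma box_cover_left: "box_cover 1 I J (\<lambda>i j. p i)"
  by (rule box_coverI[of "{()}" "\<lambda>_. 1" "\<lambda>_. {i \<in> I. p i}" _ "\<lambda>_. J"]) auto

lemma box_cover_right: "box_cover 1 I J (\<lambda>i j. q j)"
  by (rule box_coverI[of "{()}" "\<lambda>_. 1" "\<lambda>_. I" _ "\<lambda>_. {j \<in> J. q j}"]) auto

text \<open>The boxes are the fibres over a common value. Distinct fibres are disjoint on both
  sides, so each may have weight 1.\<close>

lemma box_cover_eq:
  assumes "finite I"
  shows "box_cover 1 I J (\<lambda>i j. p i = q j)"
proof -
  have 1: "indicator {i \<in> I. p i = s} i = (if s = p i then 1 else 0 :: real)" if "i \<in> I" for s i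
    using that by (auto simp: indicator_def)
  have 2: "indicator {i \<in> J. q i = s} i = (if s = q i then 1 else 0 :: real)" if "i \<in> J" for s i
    using that by (auto simp: indicator_def)
  show ?thesis
  proof (rule box_coverI[of "p ` I" "\<lambda>_. 1" "\<lambda>s. {i \<in> I. p i = s}" _ "\<lambda>s. {j \<in> J. q j = s}"])
    fix i j assume ij: "i \<in> I" "j \<in> J" "p i = q j"
    have "(\<Sum>s\<in>p ` I. 1 * (indicator {i \<in> I. p i = s} i * indicator {j \<in> J. q j = s} j))
        = (\<Sum>s\<in>p ` I. if s = p i then 1 else 0 :: real)"
      using ij by (intro sum.cong refl) (simp add: 1 2)
    also have "\<dots> = 1" using assms ij(1) by simp
    finally show "1 \<le> 1 * (\<Sum>s\<in>p ` I. 1 * (indicator {i \<in> I. p i = s} i * indicator {j \<in> J. q j = s} j :: real))"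
      by simp
  qed (use assms in \<open>auto simp: 1 2 sum.delta\<close>)
qed

text \<open>Split the values into two halves uniformly at random, and take the box of all \<open>i\<close> with value
  in the first half and all \<open>j\<close> with value in the second half.\<close>

lemma box_cover_neq:
  assumes "finite I" "finite J"
  shows "box_cover 4 I J (\<lambda>i j. p i \<noteq> q j)"
proof -
  define U where "U = p ` I \<union> q ` J"
  have U: "finite U" using assms by (simp add: U_def)
  let ?w = "1 / 2 ^ card U :: real"
  have le: "(\<Sum>c\<in>Pow U. ?w * indicator (Z c) i) \<le> 1" for Z and i :: 'x
  proof -
    have "(\<Sum>c\<in>Pow U. ?w * indicator (Z c) i) \<le> (\<Sum>c\<in>Pow U. ?w)"
      by (intro sum_mono) (simp add: indicator_def)
    also have "\<dots> = 1" using U by (simp add: card_Pow)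
    finally show ?thesis .
  qed
  show ?thesis
  proof (rule box_coverI[of "Pow U" "\<lambda>_. ?w" "\<lambda>c. {i \<in> I. p i \<in> c}" _ "\<lambda>c. {j \<in> J. q j \<notin> c}"])
    fix i j assume ij: "i \<in> I" "j \<in> J" "p i \<noteq> q j"
    let ?V = "U - {p i, q j}"
    have uv: "p i \<in> U" "q j \<in> U" using ij by (auto simp: U_def)
    have cardV: "card U = card ?V + 2"
      using uv ij(3) U card_mono[of U "{p i, q j}"] by (simp add: card_Diff_subset)
    have "(\<Sum>c\<in>Pow U. ?w * (indicator {i \<in> I. p i \<in> c} i * indicator {j \<in> J. q j \<notin> c} j))
        = (\<Sum>c\<in>{c \<in> Pow U. p i \<in> c \<and> q j \<notin> c}. ?w)"
      using U ij by (intro sum.mono_neutral_cong_right) (auto simp: indicator_def)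
    also have "{c \<in> Pow U. p i \<in> c \<and> q j \<notin> c} = insert (p i) ` Pow ?V"
    proof (intro subset_antisym subsetI)
      fix c assume "c \<in> {c \<in> Pow U. p i \<in> c \<and> q j \<notin> c}"
      then have "c = insert (p i) (c - {p i})" "c - {p i} \<in> Pow ?V" by auto
      then show "c \<in> insert (p i) ` Pow ?V" by (rule image_eqI)
    qed (use uv ij(3) in auto)
    also have "(\<Sum>c\<in>insert (p i) ` Pow ?V. ?w) = 2 ^ card ?V * ?w"
    proof -
      have "inj_on (insert (p i)) (Pow ?V)" by (auto simp: inj_on_def)
      then show ?thesis using U by (simp add: card_image card_Pow)
    qed
    \<comment> \<open>A random subset of \<open>U\<close> contains \<open>p i\<close> and misses
      \<open>q j\<close> with probability 1/4, whence the constant 4.\<close>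
    also have "\<dots> = 1 / 4" unfolding cardV by (simp add: power_add)
    finally show "1 \<le> 4 * (\<Sum>c\<in>Pow U. ?w * (indicator {i \<in> I. p i \<in> c} i * indicator {j \<in> J. q j \<notin> c} j))"
      by simp
  qed (use U le in auto)
qed

text \<open>One constant serves all finite parts, because both conclusions ask for bounds
  independent of the finite sets.\<close>

definition coverable :: "'i set \<Rightarrow> 'j set \<Rightarrow> ('i \<Rightarrow> 'j \<Rightarrow> bool) \<Rightarrow> bool" where
  "coverable A B E \<longleftrightarrow> (\<exists>C \<ge> 0. \<forall>I J. finite I \<and> finite J \<and> I \<subseteq> A \<and> J \<subseteq> B \<longrightarrow> box_cover C I J E)"

lemma coverableI:
  assumes "0 \<le> C"
    and "\<And>I J. finite I \<Longrightarrow> finite J \<Longrightarrow> I \<subseteq> A \<Longrightarrow> J \<subseteq> B \<Longrightarrow> box_cover C I J E"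
  shows "coverable A B E"
  using assms unfolding coverable_def by auto

lemma coverableE:
  assumes "coverable A B E"
  obtains C where "0 \<le> C"
    "\<And>I J. finite I \<Longrightarrow> finite J \<Longrightarrow> I \<subseteq> A \<Longrightarrow> J \<subseteq> B \<Longrightarrow> box_cover C I J E"
  using assms unfolding coverable_def by auto

lemma coverable_conj:
  assumes "coverable A B E1" "coverable A B E2" shows "coverable A B (\<lambda>i j. E1 i j \<and> E2 i j)"
proof -
  obtain C1 where 1: "0 \<le> C1" "\<And>I J. finite I \<Longrightarrow> finite J \<Longrightarrow> I \<subseteq> A \<Longrightarrow> J \<subseteq> B \<Longrightarrow> box_cover C1 I J E1"
    using assms(1) by (rule coverableE) blast
  obtain C2 where 2: "0 \<le> C2" "\<And>I J. finite I \<Longrightarrow> finite J \<Longrightarrow> I \<subseteq> A \<Longrightarrow> J \<subseteq> B \<Longrightarrow> box_cover C2 I J E2"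
    using assms(2) by (rule coverableE) blast
  show ?thesis
    by (rule coverableI[of "C1 * C2"]) (use 1(1) 2(1) in \<open>auto intro!: box_cover_conj 1(2) 2(2)\<close>)
qed

lemma coverable_disj:
  assumes "coverable A B E1" "coverable A B E2" shows "coverable A B (\<lambda>i j. E1 i j \<or> E2 i j)"
proof -
  obtain C1 where 1: "0 \<le> C1" "\<And>I J. finite I \<Longrightarrow> finite J \<Longrightarrow> I \<subseteq> A \<Longrightarrow> J \<subseteq> B \<Longrightarrow> box_cover C1 I J E1"
    using assms(1) by (rule coverableE) blast
  obtain C2 where 2: "0 \<le> C2" "\<And>I J. finite I \<Longrightarrow> finite J \<Longrightarrow> I \<subseteq> A \<Longrightarrow> J \<subseteq> B \<Longrightarrow> box_cover C2 I J E2"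
    using assms(2) by (rule coverableE) blast
  show ?thesis
  proof (rule coverableI[of "2 * (C1 + C2)"])
    show "0 \<le> 2 * (C1 + C2)" using 1(1) 2(1) by simp
  qed (intro box_cover_disj 1 2)
qed

lemma coverable_left: "coverable A B (\<lambda>i j. p i)"
  by (rule coverableI[of 1]) (auto intro: box_cover_left)

lemma coverable_right: "coverable A B (\<lambda>i j. q j)"
  by (rule coverableI[of 1]) (use box_cover_right in auto)

lemma coverable_eq: "coverable A B (\<lambda>i j. p i = q j)"
  by (rule coverableI[of 1]) (auto intro: box_cover_eq)

lemma coverable_neq: "coverable A B (\<lambda>i j. p i \<noteq> q j)"
  by (rule coverableI[of 4]) (auto intro: box_cover_neq)

text \<open>Case split on one atom at a time. The truth table \<open>F\<close> has to vary in the
  induction, since making atom \<open>x\<close> true replaces \<open>F T\<close> by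
  \<open>F (insert x T)\<close>.\<close>

lemma coverable_bool_combination:
  assumes "finite L"
    and "\<And>l. l \<in> L \<Longrightarrow> coverable A B (E l)" "\<And>l. l \<in> L \<Longrightarrow> coverable A B (\<lambda>i j. \<not> E l i j)"
  shows "coverable A B (\<lambda>i j. F {l \<in> L. E l i j})"
  using assms
proof (induction L arbitrary: F rule: finite_induct)
  case empty
  then show ?case by (simp add: coverable_left)
next
  case (insert x L)
  have eq: "F {l \<in> insert x L. E l i j} \<longleftrightarrow>
      (E x i j \<and> F (insert x {l \<in> L. E l i j})) \<or> (\<not> E x i j \<and> F {l \<in> L. E l i j})" for i j
  proof (cases "E x i j")
    case True
    then have "{l \<in> insert x L. E l i j} = insert x {l \<in> L. E l i j}" by auto
    then show ?thesis using True by simp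
  next
    case False
    then have "{l \<in> insert x L. E l i j} = {l \<in> L. E l i j}" by auto
    then show ?thesis using False by simp
  qed
  have 1: "coverable A B (\<lambda>i j. F (insert x {l \<in> L. E l i j}))"
    by (rule insert.IH[where F="\<lambda>T. F (insert x T)"]) (use insert.prems in auto)
  have 2: "coverable A B (\<lambda>i j. F {l \<in> L. E l i j})"
    by (rule insert.IH) (use insert.prems in auto)
  show ?case unfolding eq
    by (intro coverable_disj coverable_conj 1 2 insert.prems) auto
qed

text \<open>Double counting: the sum of w|X| over the boxes is the total load of \<open>A1\<close>,
  hence at most \<open>card A1\<close>, and likewise for \<open>A2\<close>. A box with a side
  shorter than \<open>t\<close> has at most t(|X| + |Y|) pairs.\<close>

lemma box_cover_Zarankiewicz:
  assumes cov: "box_cover C A1 A2 (\<lambda>a b. (a, b) \<in> R)" and C: "0 \<le> C"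
    and fin: "finite A1" "finite A2" and free: "K_free t A1 A2 (R \<inter> A1 \<times> A2)"
  shows "real (card (R \<inter> A1 \<times> A2)) \<le> C * real t * real (card A1 + card A2)"
proof -
  from cov obtain S :: "nat set" and w X Y where S: "finite S"
    "\<And>s. s \<in> S \<Longrightarrow> 0 \<le> w s \<and> X s \<subseteq> A1 \<and> Y s \<subseteq> A2 \<and> (\<forall>i\<in>X s. \<forall>j\<in>Y s. (i, j) \<in> R)"
    "\<And>i. i \<in> A1 \<Longrightarrow> (\<Sum>s\<in>S. w s * indicator (X s) i) \<le> 1"
    "\<And>j. j \<in> A2 \<Longrightarrow> (\<Sum>s\<in>S. w s * indicator (Y s) j) \<le> 1"
    "\<And>i j. i \<in> A1 \<Longrightarrow> j \<in> A2 \<Longrightarrow> (i, j) \<in> R \<Longrightarrow>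
           1 \<le> C * (\<Sum>s\<in>S. w s * (indicator (X s) i * indicator (Y s) j))"
    by (rule box_coverE) blast
  have small: "real (card (X s)) * real (card (Y s)) \<le> real t * (real (card (X s)) + real (card (Y s)))"
    if s: "s \<in> S" for s
  proof -
    have XY: "X s \<subseteq> A1" "Y s \<subseteq> A2" "X s \<times> Y s \<subseteq> R" using S(2)[OF s] by auto
    have "card (X s) < t \<or> card (Y s) < t"
    proof (rule ccontr)
      assume "\<not> ?thesis"
      then obtain S1 S2 where S12: "S1 \<subseteq> X s" "card S1 = t" "S2 \<subseteq> Y s" "card S2 = t"
        by (meson not_less obtain_subset_with_card_n)
      then have "\<exists>S1 \<subseteq> A1. \<exists>S2 \<subseteq> A2. finite S1 \<and> finite S2 \<and> card S1 = t \<and> card S2 = t \<and>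
          S1 \<times> S2 \<subseteq> R \<inter> A1 \<times> A2"
        using XY fin S12 finite_subset[of S1 A1] finite_subset[of S2 A2]
        by (intro exI[of _ S1] exI[of _ S2] conjI) auto
      then show False using free unfolding K_free_def by blast
    qed
    then have "card (X s) * card (Y s) \<le> t * (card (X s) + card (Y s))"
      by (metis add.commute distrib_left mult_le_mono1 mult.commute less_imp_le trans_le_add1)
    then show ?thesis by (metis of_nat_add of_nat_le_iff of_nat_mult)
  qed
  have ind: "(\<Sum>i\<in>A. indicator B i) = real (card B)" if "B \<subseteq> A" "finite A" for A B :: "'x set"
  proof -
    have "(\<Sum>i\<in>A. indicator B i) = (\<Sum>i\<in>B. 1 :: real)"
      using that by (intro sum.mono_neutral_cong_right) (auto simp: indicator_def)
    then show ?thesis by simp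
  qed
  have swap1: "(\<Sum>i\<in>A1. \<Sum>s\<in>S. w s * indicator (X s) i) = (\<Sum>s\<in>S. w s * real (card (X s)))"
    using S(2) fin by (subst sum.swap) (auto simp: sum_distrib_left[symmetric] ind intro!: sum.cong)
  have swap2: "(\<Sum>i\<in>A2. \<Sum>s\<in>S. w s * indicator (Y s) i) = (\<Sum>s\<in>S. w s * real (card (Y s)))"
    using S(2) fin by (subst sum.swap) (auto simp: sum_distrib_left[symmetric] ind intro!: sum.cong)
  have swap3: "(\<Sum>p\<in>A1 \<times> A2. \<Sum>s\<in>S. w s * (indicator (X s) (fst p) * indicator (Y s) (snd p)))
      = (\<Sum>s\<in>S. w s * (real (card (X s)) * real (card (Y s))))"
  proof (subst sum.swap, intro sum.cong refl)
    fix s assume s: "s \<in> S"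
    have "(\<Sum>p\<in>A1 \<times> A2. w s * (indicator (X s) (fst p) * indicator (Y s) (snd p)))
      = w s * ((\<Sum>i\<in>A1. indicator (X s) i) * (\<Sum>j\<in>A2. indicator (Y s) j))"
      unfolding sum_product by (simp add: sum.cartesian_product split_beta sum_distrib_left)
    then show "(\<Sum>p\<in>A1 \<times> A2. w s * (indicator (X s) (fst p) * indicator (Y s) (snd p)))
      = w s * (real (card (X s)) * real (card (Y s)))"
      using S(2)[OF s] fin by (simp add: ind)
  qed
  have "real (card (R \<inter> A1 \<times> A2)) = (\<Sum>p\<in>R \<inter> A1 \<times> A2. 1)" by simp
  also have "\<dots> \<le> (\<Sum>p\<in>R \<inter> A1 \<times> A2. C * (\<Sum>s\<in>S. w s * (indicator (X s) (fst p) * indicator (Y s) (snd p))))"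
    using S(5) by (intro sum_mono) auto
  also have "\<dots> \<le> (\<Sum>p\<in>A1 \<times> A2. C * (\<Sum>s\<in>S. w s * (indicator (X s) (fst p) * indicator (Y s) (snd p))))"
    using fin C S(2) by (intro sum_mono2) (auto intro!: mult_nonneg_nonneg sum_nonneg)
  also have "\<dots> = C * (\<Sum>s\<in>S. w s * (real (card (X s)) * real (card (Y s))))"
    by (simp add: sum_distrib_left[symmetric] swap3)
  also have "\<dots> \<le> C * (\<Sum>s\<in>S. w s * (real t * (real (card (X s)) + real (card (Y s)))))"
    using S(2) small C by (intro mult_left_mono sum_mono) auto
  also have "(\<Sum>s\<in>S. w s * (real t * (real (card (X s)) + real (card (Y s)))))
      = real t * ((\<Sum>i\<in>A1. \<Sum>s\<in>S. w s * indicator (X s) i) + (\<Sum>i\<in>A2. \<Sum>s\<in>S. w s * indicator (Y s) i))"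
    unfolding swap1 swap2 by (simp add: sum_distrib_left sum.distrib algebra_simps)
  also have "C * \<dots> \<le> C * (real t * ((\<Sum>i\<in>A1. 1) + (\<Sum>i\<in>A2. 1)))"
    using S(3,4) C by (intro mult_left_mono add_mono sum_mono) auto
  finally show ?thesis by (simp add: algebra_simps)
qed

text \<open>If every box had a side of measure at most \<open>?e\<close>, each product of the two
  measures would be at most \<open>?e\<close> times their sum, and the loads would bound the measure
  of \<open>E\<close> by 2 C \<open>?e\<close>.\<close>

lemma box_cover_pmf:
  fixes L :: "'x pmf" and N :: "'y pmf"
  assumes cov: "box_cover C (set_pmf L) (set_pmf N) E" and C: "0 < C"
    and fin: "finite (set_pmf L)" "finite (set_pmf N)"
    and half: "1 / 2 \<le> (\<Sum>i\<in>set_pmf L. \<Sum>j\<in>set_pmf N. pmf L i * pmf N j * of_bool (E i j))"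
  shows "\<exists>X \<subseteq> set_pmf L. \<exists>Y \<subseteq> set_pmf N. measure_pmf.prob L X > 1 / (8 * C) \<and>
    measure_pmf.prob N Y > 1 / (8 * C) \<and> (\<forall>i\<in>X. \<forall>j\<in>Y. E i j)"
proof (rule ccontr)
  assume neg: "\<not> ?thesis"
  let ?I = "set_pmf L" and ?J = "set_pmf N"
  from cov obtain S :: "nat set" and w X Y where S: "finite S"
    "\<And>s. s \<in> S \<Longrightarrow> 0 \<le> w s \<and> X s \<subseteq> ?I \<and> Y s \<subseteq> ?J \<and> (\<forall>i\<in>X s. \<forall>j\<in>Y s. E i j)"
    "\<And>i. i \<in> ?I \<Longrightarrow> (\<Sum>s\<in>S. w s * indicator (X s) i) \<le> 1"
    "\<And>j. j \<in> ?J \<Longrightarrow> (\<Sum>s\<in>S. w s * indicator (Y s) j) \<le> 1"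
    "\<And>i j. i \<in> ?I \<Longrightarrow> j \<in> ?J \<Longrightarrow> E i j \<Longrightarrow>
           1 \<le> C * (\<Sum>s\<in>S. w s * (indicator (X s) i * indicator (Y s) j))"
    by (rule box_coverE) blast
  let ?l = "\<lambda>s. measure_pmf.prob L (X s)" and ?n = "\<lambda>s. measure_pmf.prob N (Y s)"
  \<comment> \<open>Chosen so that 2 C \<open>?e\<close> is 1/4, strictly below the assumed
    1/2.\<close>
  let ?e = "1 / (8 * C)"
  have ind1: "(\<Sum>i\<in>?I. pmf L i * indicator (X s) i) = ?l s" if "s \<in> S" for s
  proof -
    have "(\<Sum>i\<in>?I. pmf L i * indicator (X s) i) = (\<Sum>i\<in>X s. pmf L i)"
      using fin S(2)[OF that] by (intro sum.mono_neutral_cong_right) (auto simp: indicator_def)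
    then show ?thesis
      using fin S(2)[OF that] by (subst measure_measure_pmf_finite) (auto intro: finite_subset)
  qed
  have ind2: "(\<Sum>i\<in>?J. pmf N i * indicator (Y s) i) = ?n s" if "s \<in> S" for s
  proof -
    have "(\<Sum>i\<in>?J. pmf N i * indicator (Y s) i) = (\<Sum>i\<in>Y s. pmf N i)"
      using fin S(2)[OF that] by (intro sum.mono_neutral_cong_right) (auto simp: indicator_def)
    then show ?thesis
      using fin S(2)[OF that] by (subst measure_measure_pmf_finite) (auto intro: finite_subset)
  qed
  have tot1: "(\<Sum>s\<in>S. w s * ?l s) \<le> 1"
  proof -
    have "(\<Sum>s\<in>S. w s * ?l s) = (\<Sum>s\<in>S. \<Sum>i\<in>?I. pmf L i * (w s * indicator (X s) i))"
      by (intro sum.cong refl) (simp add: ind1[symmetric] sum_distrib_left algebra_simps)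
    also have "\<dots> = (\<Sum>i\<in>?I. pmf L i * (\<Sum>s\<in>S. w s * indicator (X s) i))"
      by (subst sum.swap) (simp add: sum_distrib_left)
    also have "\<dots> \<le> (\<Sum>i\<in>?I. pmf L i * 1)"
      using S(3) by (intro sum_mono mult_left_mono) auto
    also have "\<dots> = 1" using fin by (simp add: sum_pmf_eq_1)
    finally show ?thesis .
  qed
  have tot2: "(\<Sum>s\<in>S. w s * ?n s) \<le> 1"
  proof -
    have "(\<Sum>s\<in>S. w s * ?n s) = (\<Sum>s\<in>S. \<Sum>i\<in>?J. pmf N i * (w s * indicator (Y s) i))"
      by (intro sum.cong refl) (simp add: ind2[symmetric] sum_distrib_left algebra_simps)
    also have "\<dots> = (\<Sum>i\<in>?J. pmf N i * (\<Sum>s\<in>S. w s * indicator (Y s) i))"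
      by (subst sum.swap) (simp add: sum_distrib_left)
    also have "\<dots> \<le> (\<Sum>i\<in>?J. pmf N i * 1)"
      using S(4) by (intro sum_mono mult_left_mono) auto
    also have "\<dots> = 1" using fin by (simp add: sum_pmf_eq_1)
    finally show ?thesis .
  qed
  have bound: "w s * (?l s * ?n s) \<le> ?e * (w s * ?l s) + ?e * (w s * ?n s)" if s: "s \<in> S" for s
  proof -
    have "X s \<subseteq> ?I" "Y s \<subseteq> ?J" "\<forall>i\<in>X s. \<forall>j\<in>Y s. E i j" "0 \<le> w s" using S(2)[OF s] by auto
    then have "?l s \<le> ?e \<or> ?n s \<le> ?e" using neg by (meson not_less)
    then have "?l s * ?n s \<le> ?e * ?n s + ?e * ?l s"
    proof
      assume "?l s \<le> ?e"
      then have "?l s * ?n s \<le> ?e * ?n s" by (intro mult_right_mono) auto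
      moreover have "0 \<le> ?e * ?l s" using C by auto
      ultimately show ?thesis by linarith
    next
      assume "?n s \<le> ?e"
      then have "?l s * ?n s \<le> ?l s * ?e" by (intro mult_left_mono) auto
      moreover have "0 \<le> ?e * ?n s" using C by auto
      ultimately show ?thesis by (simp add: mult.commute)
    qed
    then have "w s * (?l s * ?n s) \<le> w s * (?e * ?n s + ?e * ?l s)"
      using \<open>0 \<le> w s\<close> by (rule mult_left_mono)
    then show ?thesis by (simp add: algebra_simps)
  qed
  have "(\<Sum>i\<in>?I. \<Sum>j\<in>?J. pmf L i * pmf N j * of_bool (E i j))
      \<le> (\<Sum>i\<in>?I. \<Sum>j\<in>?J. pmf L i * pmf N j * (C * (\<Sum>s\<in>S. w s * (indicator (X s) i * indicator (Y s) j))))"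
  proof (intro sum_mono mult_left_mono)
    fix i j assume "i \<in> ?I" "j \<in> ?J"
    moreover have "0 \<le> C * (\<Sum>s\<in>S. w s * (indicator (X s) i * indicator (Y s) j))"
      using C S(2) by (auto intro!: mult_nonneg_nonneg sum_nonneg)
    ultimately show "of_bool (E i j) \<le> C * (\<Sum>s\<in>S. w s * (indicator (X s) i * indicator (Y s) j))"
      using S(5)[of i j] by (cases "E i j") auto
  qed auto
  also have "\<dots> = (\<Sum>i\<in>?I. \<Sum>j\<in>?J. \<Sum>s\<in>S. C * (w s * ((pmf L i * indicator (X s) i) * (pmf N j * indicator (Y s) j))))"
    by (simp add: sum_distrib_left algebra_simps)
  also have "\<dots> = (\<Sum>i\<in>?I. \<Sum>s\<in>S. \<Sum>j\<in>?J. C * (w s * ((pmf L i * indicator (X s) i) * (pmf N j * indicator (Y s) j))))"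
    by (intro sum.cong refl sum.swap)
  also have "\<dots> = (\<Sum>s\<in>S. \<Sum>i\<in>?I. \<Sum>j\<in>?J. C * (w s * ((pmf L i * indicator (X s) i) * (pmf N j * indicator (Y s) j))))"
    by (rule sum.swap)
  also have "\<dots> = (\<Sum>s\<in>S. C * (w s * ((\<Sum>i\<in>?I. pmf L i * indicator (X s) i) * (\<Sum>j\<in>?J. pmf N j * indicator (Y s) j))))"
    unfolding sum_product by (simp only: sum_distrib_left)
  also have "\<dots> = C * (\<Sum>s\<in>S. w s * (?l s * ?n s))"
    by (simp add: ind1 ind2 sum_distrib_left)
  also have "\<dots> \<le> C * (\<Sum>s\<in>S. ?e * (w s * ?l s) + ?e * (w s * ?n s))"
    using C bound by (intro mult_left_mono sum_mono) auto
  also have "\<dots> = C * (?e * (\<Sum>s\<in>S. w s * ?l s) + ?e * (\<Sum>s\<in>S. w s * ?n s))"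
    by (simp add: sum.distrib sum_distrib_left)
  also have "\<dots> \<le> C * (?e * 1 + ?e * 1)"
    using C tot1 tot2 by (intro mult_left_mono add_mono) auto
  also have "\<dots> = 1 / 4" using C by simp
  finally show False using half by simp
qed

lemma coverable_sEH:
  assumes "coverable A B (\<lambda>a b. (a, b) \<in> R)" "coverable A B (\<lambda>a b. (a, b) \<notin> R)"
  shows "sEH A B R"
proof -
  obtain C1 where C1: "0 \<le> C1" "\<And>I J. finite I \<Longrightarrow> finite J \<Longrightarrow> I \<subseteq> A \<Longrightarrow> J \<subseteq> B \<Longrightarrow>
      box_cover C1 I J (\<lambda>a b. (a, b) \<in> R)"
    using assms(1) by (rule coverableE) blast
  obtain C2 where C2: "0 \<le> C2" "\<And>I J. finite I \<Longrightarrow> finite J \<Longrightarrow> I \<subseteq> A \<Longrightarrow> J \<subseteq> B \<Longrightarrow>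
      box_cover C2 I J (\<lambda>a b. (a, b) \<notin> R)"
    using assms(2) by (rule coverableE) blast
  \<comment> \<open>Adding 1 makes \<open>C\<close> positive, as the threshold 1/(8C)
    requires.\<close>
  define C where "C = C1 + C2 + 1"
  have Cpos: "0 < C" "C1 \<le> C" "C2 \<le> C" using C1(1) C2(1) by (auto simp: C_def)
  show ?thesis
    unfolding sEH_def
  proof (intro exI[of _ "1 / (8 * C)"] conjI allI impI, goal_cases)
    case 1
    show ?case using Cpos by simp
  next
    case (2 L N)
    let ?I = "set_pmf L" and ?J = "set_pmf N"
    have "1 = (\<Sum>i\<in>?I. pmf L i) * (\<Sum>j\<in>?J. pmf N j)" using 2 by (simp add: sum_pmf_eq_1)
    also have "\<dots> = (\<Sum>i\<in>?I. \<Sum>j\<in>?J. pmf L i * pmf N j)" by (simp add: sum_product)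
    also have "\<dots> = (\<Sum>i\<in>?I. \<Sum>j\<in>?J. pmf L i * pmf N j * of_bool ((i, j) \<in> R) + pmf L i * pmf N j * of_bool ((i, j) \<notin> R))"
      by (intro sum.cong refl) auto
    also have "\<dots> = (\<Sum>i\<in>?I. \<Sum>j\<in>?J. pmf L i * pmf N j * of_bool ((i, j) \<in> R)) +
        (\<Sum>i\<in>?I. \<Sum>j\<in>?J. pmf L i * pmf N j * of_bool ((i, j) \<notin> R))"
      by (simp add: sum.distrib)
    finally consider "1 / 2 \<le> (\<Sum>i\<in>?I. \<Sum>j\<in>?J. pmf L i * pmf N j * of_bool ((i, j) \<in> R))"
      | "1 / 2 \<le> (\<Sum>i\<in>?I. \<Sum>j\<in>?J. pmf L i * pmf N j * of_bool ((i, j) \<notin> R))" by linarith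
    then show ?case
    proof cases
      case 1
      have "box_cover C ?I ?J (\<lambda>a b. (a, b) \<in> R)" by (rule box_cover_mono[OF C1(2)]) (use Cpos 2 in auto)
      from box_cover_pmf[OF this Cpos(1) _ _ 1] 2 obtain X Y where XY: "X \<subseteq> ?I" "Y \<subseteq> ?J"
         "measure_pmf.prob L X > 1 / (8 * C)" "measure_pmf.prob N Y > 1 / (8 * C)" "\<forall>i\<in>X. \<forall>j\<in>Y. (i, j) \<in> R"
        by blast
      moreover have "X \<subseteq> A" "Y \<subseteq> B" using XY(1,2) 2 by auto
      ultimately show ?thesis by (intro exI[of _ X] exI[of _ Y]) auto
    next
      case b: 2
      have "box_cover C ?I ?J (\<lambda>a b. (a, b) \<notin> R)" by (rule box_cover_mono[OF C2(2)]) (use Cpos 2 in auto)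
      from box_cover_pmf[OF this Cpos(1) _ _ b] 2 obtain X Y where XY: "X \<subseteq> ?I" "Y \<subseteq> ?J"
         "measure_pmf.prob L X > 1 / (8 * C)" "measure_pmf.prob N Y > 1 / (8 * C)" "\<forall>i\<in>X. \<forall>j\<in>Y. (i, j) \<notin> R"
        by blast
      moreover have "X \<subseteq> A" "Y \<subseteq> B" using XY(1,2) 2 by auto
      ultimately show ?thesis by (intro exI[of _ X] exI[of _ Y]) auto
    qed
  qed
qed

lemma coverable_linear_Zarankiewicz:
  assumes "coverable (tuples M x1) (tuples M x2) (\<lambda>a b. (a, b) \<in> defined_relation M \<phi> x1 x2)"
  shows "linear_Zarankiewicz M \<phi> x1 x2"
proof -
  obtain C where C: "0 \<le> C" "\<And>I J. finite I \<Longrightarrow> finite J \<Longrightarrow> I \<subseteq> tuples M x1 \<Longrightarrow> J \<subseteq> tuples M x2 \<Longrightarrow>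
      box_cover C I J (\<lambda>a b. (a, b) \<in> defined_relation M \<phi> x1 x2)"
    using assms by (rule coverableE) blast
  show ?thesis
    unfolding linear_Zarankiewicz_def
  proof (intro allI exI impI, elim conjE)
    fix t k A1 A2
    assume A: "A1 \<subseteq> tuples M x1" "finite A1" "card A1 = k" "A2 \<subseteq> tuples M x2" "finite A2" "card A2 = k"
      "K_free t A1 A2 (defined_relation M \<phi> x1 x2 \<inter> A1 \<times> A2)"
    \<comment> \<open>The factor 2 appears because the bound from the cover counts both parts, each
      of size \<open>k\<close>.\<close>
    show "real (card (defined_relation M \<phi> x1 x2 \<inter> A1 \<times> A2)) \<le> (2 * C * real t) * real k"
      using box_cover_Zarankiewicz[OF C(2) C(1)] A by fastforce
  qed
qed

section \<open>Formulas\<close>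

lemma sat_cong: "(\<And>v. v \<in> fv \<phi> \<Longrightarrow> e v = e' v) \<Longrightarrow> sat M e \<phi> \<longleftrightarrow> sat M e' \<phi>"
proof (induction \<phi> arbitrary: e e')
  case (Rel vs)
  then have "map e vs = map e' vs" by simp
  then show ?case by (simp only: sat.simps)
next
  case (Ex v \<phi>)
  have "sat M (e(v := a)) \<phi> \<longleftrightarrow> sat M (e'(v := a)) \<phi>" for a
    by (rule Ex.IH) (use Ex.prems in auto)
  then show ?case by simp
next
  case (Conj \<phi>1 \<phi>2)
  from Conj.IH(1)[of e e'] Conj.IH(2)[of e e'] Conj.prems show ?case by auto
next
  case (Neg \<phi>)
  from Neg.IH[of e e'] Neg.prems show ?case by auto
qed auto

text \<open>Bound variables are renamed as well; injectivity of \<open>\<rho>\<close> then rules out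
  capture.\<close>

primrec ren :: "(nat \<Rightarrow> nat) \<Rightarrow> form \<Rightarrow> form" where
  "ren \<rho> (Eq u v) = Eq (\<rho> u) (\<rho> v)"
| "ren \<rho> (Rel vs) = Rel (map \<rho> vs)"
| "ren \<rho> (Neg \<phi>) = Neg (ren \<rho> \<phi>)"
| "ren \<rho> (Conj \<phi> \<psi>) = Conj (ren \<rho> \<phi>) (ren \<rho> \<psi>)"
| "ren \<rho> (Ex v \<phi>) = Ex (\<rho> v) (ren \<rho> \<phi>)"

lemma sat_ren: "inj \<rho> \<Longrightarrow> sat M e (ren \<rho> \<phi>) \<longleftrightarrow> sat M (e \<circ> \<rho>) \<phi>"
proof (induction \<phi> arbitrary: e)
  case (Ex v \<phi>)
  have "(e(\<rho> v := a)) \<circ> \<rho> = (e \<circ> \<rho>)(v := a)" for a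
    using Ex.prems by (auto simp: fun_eq_iff inj_eq)
  then show ?case using Ex by (simp del: fun_upd_apply comp_apply)
qed auto

lemma fv_ren: "inj \<rho> \<Longrightarrow> fv (ren \<rho> \<phi>) = \<rho> ` fv \<phi>"
  by (induction \<phi>) (auto simp: inj_eq)

lemma r_form_ren [simp]: "r_form r (ren \<rho> \<phi>) \<longleftrightarrow> r_form r \<phi>"
  by (induction \<phi>) auto

text \<open>The empty conjunction is a sentence that also holds in the structure with empty universe.\<close>

primrec conjs :: "form list \<Rightarrow> form" where
  "conjs [] = Neg (Ex 0 (Neg (Eq 0 0)))"
| "conjs (\<phi> # \<phi>s) = Conj \<phi> (conjs \<phi>s)"

lemma sat_conjs [simp]: "sat M e (conjs \<phi>s) \<longleftrightarrow> (\<forall>\<phi>\<in>set \<phi>s. sat M e \<phi>)"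
  by (induction \<phi>s) auto

lemma fv_conjs [simp]: "fv (conjs \<phi>s) = (\<Union>\<phi>\<in>set \<phi>s. fv \<phi>)"
  by (induction \<phi>s) auto

lemma r_form_conjs [simp]: "r_form r (conjs \<phi>s) \<longleftrightarrow> (\<forall>\<phi>\<in>set \<phi>s. r_form r \<phi>)"
  by (induction \<phi>s) auto

section \<open>Blocks of existential quantifiers\<close>

primrec exs :: "nat list \<Rightarrow> form \<Rightarrow> form" where
  "exs [] \<phi> = \<phi>"
| "exs (v # vs) \<phi> = Ex v (exs vs \<phi>)"

lemma fv_exs [simp]: "fv (exs vs \<phi>) = fv \<phi> - set vs"
  by (induction vs) auto

lemma r_form_exs [simp]: "r_form r (exs vs \<phi>) \<longleftrightarrow> r_form r \<phi>"
  by (induction vs) auto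

text \<open>The assignments reached from \<open>e\<close> by a block of quantifiers over
  \<open>V\<close>; the order inside the block does not matter.\<close>

definition varies :: "'a struct \<Rightarrow> (nat \<Rightarrow> 'a) \<Rightarrow> nat set \<Rightarrow> (nat \<Rightarrow> 'a) \<Rightarrow> bool" where
  "varies M e V e' \<longleftrightarrow> (\<forall>v. v \<notin> V \<longrightarrow> e' v = e v) \<and> (\<forall>v\<in>V. e' v \<in> univ M)"

lemma varies_insert:
  "varies M e (insert v V) e' \<longleftrightarrow> (\<exists>a\<in>univ M. varies M (e(v := a)) V e')"
proof
  assume l: "varies M e (insert v V) e'"
  then show "\<exists>a\<in>univ M. varies M (e(v := a)) V e'"
    unfolding varies_def by (intro bexI[of _ "e' v"]) auto
next
  assume "\<exists>a\<in>univ M. varies M (e(v := a)) V e'"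
  then show "varies M e (insert v V) e'"
    unfolding varies_def by (auto split: if_splits)
qed

lemma sat_exs: "sat M e (exs vs \<phi>) \<longleftrightarrow> (\<exists>e'. varies M e (set vs) e' \<and> sat M e' \<phi>)"
proof (induction vs arbitrary: e)
  case Nil
  have "varies M e {} e' \<longleftrightarrow> e' = e" for e' by (auto simp: varies_def)
  then show ?case by simp
next
  case (Cons v vs)
  show ?case by (simp only: exs.simps sat.simps Cons.IH list.set varies_insert) blast
qed

text \<open>The truth of a sentence does not depend on the assignment, so a sentence that fails in
  \<open>N\<close> has its negation in the theory.\<close>

lemma models_Th_sat:
  assumes "models r M (Th r N)" "r_form r \<psi>" "fv \<psi> = {}" "sat M e \<psi>"
  shows "sat N e' \<psi>"
proof (rule ccontr)
  assume "\<not> sat N e' \<psi>"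
  then have "\<not> sat N e'' \<psi>" for e'' using assms(3) sat_cong[of \<psi> e' e''] by auto
  then have "Neg \<psi> \<in> Th r N" using assms by (simp add: Th_def)
  then show False using assms(1,4) unfolding models_def by fastforce
qed

section \<open>Finite patterns in models of one theory\<close>

definition asg :: "'a struct \<Rightarrow> nat set \<Rightarrow> (nat \<Rightarrow> 'a) set" where
  "asg M V = {e. \<forall>v\<in>V. e v \<in> univ M}"

definition asg_rel :: "'a struct \<Rightarrow> form \<Rightarrow> nat set \<Rightarrow> (nat \<Rightarrow> 'a) \<Rightarrow> (nat \<Rightarrow> 'a) \<Rightarrow> bool" where
  "asg_rel M \<phi> V a b \<longleftrightarrow> sat M (\<lambda>v. if v \<in> V then a v else b v) \<phi>"

text \<open>The whole pattern is one existential sentence: it asks for a copy of the variables for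
  each row and each column, with \<open>\<phi>\<close> or its negation prescribed for each
  pair.\<close>

lemma transfer_pattern:
  fixes M :: "'a struct" and N :: "'b struct" and as bs :: "nat \<Rightarrow> nat \<Rightarrow> 'a" and p q :: nat
  assumes mod: "models r M (Th r N)" and \<phi>: "r_form r \<phi>" "fv \<phi> \<subseteq> V \<union> W" "V \<inter> W = {}"
    and fin: "finite V" "finite W"
    and as: "\<And>i. i < p \<Longrightarrow> as i \<in> asg M V" and bs: "\<And>j. j < q \<Longrightarrow> bs j \<in> asg M W"
  shows "\<exists>as' bs'. (\<forall>i<p. as' i \<in> asg N V) \<and> (\<forall>j<q. bs' j \<in> asg N W) \<and>
    (\<forall>i<p. \<forall>j<q. asg_rel M \<phi> V (as i) (bs j) = asg_rel N \<phi> V (as' i) (bs' j))"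
proof -
  \<comment> \<open>Variables of \<open>V\<close> are tagged with the row and all others with the
    column, so a row has the same copy of \<open>V\<close> in every pair. Keeping the variable in
    the code makes \<open>\<rho> i j\<close> injective.\<close>
  define \<rho> where "\<rho> i j v = prod_encode (v, if v \<in> V then i else j)" for i j v :: nat
  have inj: "inj (\<rho> i j)" for i j by (auto simp: inj_def \<rho>_def)
  define U where "U = prod_encode ` (V \<times> {..<p} \<union> W \<times> {..<q})"
  obtain vs where vs: "set vs = U" using fin finite_list[of U] by (auto simp: U_def)
  define lit where "lit i j = (if asg_rel M \<phi> V (as i) (bs j) then ren (\<rho> i j) \<phi> else Neg (ren (\<rho> i j) \<phi>))"
    for i j
  define \<psi> where "\<psi> = conjs (map (\<lambda>(i, j). lit i j) (List.product [0..<p] [0..<q]))"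
  have set_prod: "set (List.product [0..<p] [0..<q]) = {..<p} \<times> {..<q}" by auto
  have fv_lit: "fv (lit i j) \<subseteq> U" if "i < p" "j < q" for i j
  proof -
    have "\<rho> i j ` fv \<phi> \<subseteq> U" using that \<phi>(2) by (auto simp: \<rho>_def U_def)
    then show ?thesis by (simp add: lit_def fv_ren[OF inj])
  qed
  have rl: "r_form r (lit i j)" for i j using \<phi>(1) by (simp add: lit_def)
  have "fv \<psi> \<subseteq> U"
    unfolding \<psi>_def fv_conjs using fv_lit by (fastforce simp: set_prod)
  then have closed: "r_form r (exs vs \<psi>)" "fv (exs vs \<psi>) = {}"
    using rl by (auto simp: \<psi>_def vs)
  define e where "e u = (let (v, i) = prod_decode u in
      if v \<in> V then as i v else bs i v)" for u
  \<comment> \<open>\<open>varies\<close> starts from the assignment with constant value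
    \<open>undefined\<close>, which therefore has to be kept outside \<open>U\<close>.\<close>
  define d where "d u = (if u \<in> U then e u else undefined)" for u
  have d1: "d (prod_encode (v, i)) = as i v" if "v \<in> V" "i < p" for v i
    using that by (auto simp: d_def e_def U_def)
  have d2: "d (prod_encode (v, i)) = bs i v" if "v \<in> W" "i < q" for v i
    using that \<phi>(3) by (auto simp: d_def e_def U_def)
  have "varies M (\<lambda>_. undefined) U d"
    unfolding varies_def using d1 d2 as bs by (auto simp: U_def asg_def) (simp_all add: d_def U_def)
  moreover have "sat M d \<psi>"
  proof -
    have "sat M d (lit i j)" if "i < p" "j < q" for i j
    proof -
      have "sat M d (ren (\<rho> i j) \<phi>) \<longleftrightarrow> asg_rel M \<phi> V (as i) (bs j)"
        unfolding sat_ren[OF inj] asg_rel_def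
        by (rule sat_cong) (use \<phi>(2) that d1 d2 in \<open>auto simp: \<rho>_def\<close>)
      then show ?thesis by (simp add: lit_def)
    qed
    then show ?thesis by (auto simp: \<psi>_def set_prod)
  qed
  ultimately have "sat M (\<lambda>_. undefined) (exs vs \<psi>)"
    unfolding sat_exs vs by blast
  then have "sat N (\<lambda>_. undefined) (exs vs \<psi>)"
    by (rule models_Th_sat[OF mod closed])
  then obtain e' where e': "varies N (\<lambda>_. undefined) U e'" "sat N e' \<psi>"
    unfolding sat_exs vs by blast
  let ?as = "\<lambda>i v. e' (prod_encode (v, i))"
  have "?as i \<in> asg N V" if "i < p" for i
    using e'(1) that by (auto simp: asg_def varies_def U_def)
  moreover have "?as j \<in> asg N W" if "j < q" for j
    using e'(1) that by (auto simp: asg_def varies_def U_def)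
  moreover have "asg_rel M \<phi> V (as i) (bs j) = asg_rel N \<phi> V (?as i) (?as j)" if "i < p" "j < q" for i j
  proof -
    have "sat N e' (lit i j)" using e'(2) that by (auto simp: \<psi>_def set_prod)
    moreover have "sat N e' (ren (\<rho> i j) \<phi>) \<longleftrightarrow> asg_rel N \<phi> V (?as i) (?as j)"
      unfolding sat_ren[OF inj] asg_rel_def by (rule sat_cong) (simp add: \<rho>_def)
    ultimately show ?thesis by (auto simp: lit_def split: if_splits)
  qed
  ultimately show ?thesis by (intro exI[of _ ?as]) auto
qed

text \<open>Saturation speaks of one variable. The first one is chosen to realize all formulas
  \<open>exs vs (conjs qs)\<close> with \<open>qs\<close> a finite list from \<open>p\<close>; it
  then becomes a parameter for the rest.\<close>

lemma omega_saturated_varies: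
  assumes "omega_saturated r M"
  shows "finite F \<Longrightarrow> range e \<subseteq> univ M \<Longrightarrow> (\<And>\<phi>. \<phi> \<in> p \<Longrightarrow> r_form r \<phi> \<and> fv \<phi> \<subseteq> set vs \<union> F) \<Longrightarrow>
    (\<And>q. q \<subseteq> p \<Longrightarrow> finite q \<Longrightarrow> \<exists>e'. varies M e (set vs) e' \<and> (\<forall>\<phi>\<in>q. sat M e' \<phi>)) \<Longrightarrow>
    \<exists>e'. varies M e (set vs) e' \<and> (\<forall>\<phi>\<in>p. sat M e' \<phi>)"
proof (induction vs arbitrary: F e)
  case Nil
  have "e' = e" if "varies M e {} e'" for e' using that by (auto simp: varies_def)
  then have "sat M e \<phi>" if "\<phi> \<in> p" for \<phi>
    using Nil.prems(4)[of "{\<phi>}"] that by auto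
  then show ?case by (intro exI[of _ e]) (auto simp: varies_def)
next
  case (Cons v vs)
  define p' where "p' = (\<lambda>qs. exs vs (conjs qs)) ` {qs. set qs \<subseteq> p}"
  have "\<forall>\<psi>\<in>p'. r_form r \<psi> \<and> fv \<psi> \<subseteq> insert v F"
    using Cons.prems(3) unfolding p'_def by fastforce
  moreover have "\<exists>a\<in>univ M. \<forall>\<psi>\<in>q'. sat M (e(v := a)) \<psi>" if q': "q' \<subseteq> p'" "finite q'" for q'
  proof -
    obtain Q where Q: "Q \<subseteq> {qs. set qs \<subseteq> p}" "finite Q" "q' = (\<lambda>qs. exs vs (conjs qs)) ` Q"
      using finite_subset_image[OF q'(2) q'(1)[unfolded p'_def]] by blast
    then obtain e' where e': "varies M e (insert v (set vs)) e'" "\<forall>\<phi>\<in>\<Union>(set ` Q). sat M e' \<phi>"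
      using Cons.prems(4)[of "\<Union>(set ` Q)"] by auto
    then obtain a where "a \<in> univ M" "varies M (e(v := a)) (set vs) e'"
      by (auto simp: varies_insert)
    then show ?thesis using e'(2) Q(3) by (intro bexI[of _ a]) (auto simp: sat_exs)
  qed
  ultimately obtain a where a: "a \<in> univ M" "\<forall>\<psi>\<in>p'. sat M (e(v := a)) \<psi>"
    using assms[unfolded omega_saturated_def, rule_format, of e F p' v] Cons.prems(1,2) by blast
  have "\<exists>e'. varies M (e(v := a)) (set vs) e' \<and> (\<forall>\<phi>\<in>p. sat M e' \<phi>)"
  proof (rule Cons.IH[of "insert v F"])
    fix q assume q: "q \<subseteq> p" "finite q"
    then obtain qs where "set qs = q" using finite_list by blast
    then have "sat M (e(v := a)) (exs vs (conjs qs))" using a(2) q by (auto simp: p'_def)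
    then show "\<exists>e'. varies M (e(v := a)) (set vs) e' \<and> (\<forall>\<phi>\<in>q. sat M e' \<phi>)"
      using \<open>set qs = q\<close> by (auto simp: sat_exs)
  qed (use Cons.prems a in auto)
  then show ?case using a(1) by (auto simp: varies_insert)
qed

section \<open>Predimension and embeddings\<close>

lemma univ_substr [simp]: "univ (substr N S) = S"
  by (simp add: substr_def)

lemma rel_substr [simp]: "rel (substr N S) = {xs \<in> rel N. set xs \<subseteq> S}"
  by (simp add: substr_def)

lemma substr_substr [simp]: "S \<subseteq> Z \<Longrightarrow> substr (substr N Z) S = substr N S"
  by (auto simp: substr_def)

definition edges :: "'a struct \<Rightarrow> 'a set \<Rightarrow> 'a set set" where
  "edges N S = {e \<in> hyperedges N. e \<subseteq> S}"

lemma predim_substr: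
  "predim n m (substr N S) = int n * int (card S) - int m * int (card (edges N S))"
proof -
  have "hyperedges (substr N S) = edges N S" by (auto simp: hyperedges_def edges_def)
  then show ?thesis by (simp add: predim_def)
qed

lemma finite_edges [simp]: "finite S \<Longrightarrow> finite (edges N S)"
  by (rule finite_subset[of _ "Pow S"]) (auto simp: edges_def)

text \<open>Sizes are modular and edge counts supermodular, since an edge inside the union may lie
  in neither part.\<close>

lemma predim_submodular:
  assumes "finite S" "finite T"
  shows "predim n m (substr N (S \<union> T)) + predim n m (substr N (S \<inter> T))
    \<le> predim n m (substr N S) + predim n m (substr N T)"
proof -
  have "card (edges N S \<union> edges N T) + card (edges N S \<inter> edges N T) = card (edges N S) + card (edges N T)"
    using assms by (intro card_Un_Int[symmetric]) auto
  moreover have "card (edges N S \<union> edges N T) \<le> card (edges N (S \<union> T))"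
    using assms by (intro card_mono) (auto simp: edges_def)
  moreover have "edges N S \<inter> edges N T = edges N (S \<inter> T)" by (auto simp: edges_def)
  ultimately have "card (edges N S) + card (edges N T) \<le> card (edges N (S \<union> T)) + card (edges N (S \<inter> T))"
    by simp
  then have "int m * (int (card (edges N S)) + int (card (edges N T)))
      \<le> int m * (int (card (edges N (S \<union> T))) + int (card (edges N (S \<inter> T))))"
    by (intro mult_left_mono) linarith+
  moreover have "int n * (int (card (S \<union> T)) + int (card (S \<inter> T))) = int n * (int (card S) + int (card T))"
    using card_Un_Int[OF assms] by (metis of_nat_add)
  ultimately show ?thesis unfolding predim_substr by (simp add: algebra_simps)
qed

lemma embedding_substrD:
  assumes "embedding g (substr N X) B"
  shows "inj_on g X" "g ` X \<subseteq> univ B" "\<And>xs. set xs \<subseteq> X \<Longrightarrow> map g xs \<in> rel B \<longleftrightarrow> xs \<in> rel N"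
  using assms by (auto simp: embedding_def)

lemma embedding_substrI:
  assumes "inj_on g X" "g ` X \<subseteq> univ B" "\<And>xs. set xs \<subseteq> X \<Longrightarrow> map g xs \<in> rel B \<longleftrightarrow> xs \<in> rel N"
  shows "embedding g (substr N X) B"
  using assms by (auto simp: embedding_def)

lemma embedding_comp:
  assumes "embedding f A B" "embedding g B C"
  shows "embedding (g \<circ> f) A C"
  unfolding embedding_def
proof (intro conjI allI impI)
  have f: "inj_on f (univ A)" "f ` univ A \<subseteq> univ B" and g: "inj_on g (univ B)" "g ` univ B \<subseteq> univ C"
    using assms by (auto simp: embedding_def)
  show "inj_on (g \<circ> f) (univ A)" by (rule comp_inj_on[OF f(1) inj_on_subset[OF g(1) f(2)]])
  show "(g \<circ> f) ` univ A \<subseteq> univ C" using f(2) g(2) by auto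
  fix xs assume xs: "set xs \<subseteq> univ A"
  then have "set (map f xs) \<subseteq> univ B" using f(2) by auto
  then have "map g (map f xs) \<in> rel C \<longleftrightarrow> map f xs \<in> rel B" using assms(2) unfolding embedding_def by blast
  also have "\<dots> \<longleftrightarrow> xs \<in> rel A" using assms(1) xs unfolding embedding_def by blast
  finally show "map (g \<circ> f) xs \<in> rel C \<longleftrightarrow> xs \<in> rel A" by simp
qed

lemma embedding_into_substr:
  "embedding g A B \<Longrightarrow> g ` univ A \<subseteq> S \<Longrightarrow> embedding g A (substr B S)"
  unfolding embedding_def by (simp add: subset_iff image_iff) blast

lemma embedding_inverse:
  assumes "embedding f (substr N X) N" "X \<subseteq> univ N"
  shows "embedding (inv_into X f) (substr N (f ` X)) N"
proof (rule embedding_substrI)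
  note f = embedding_substrD[OF assms(1)]
  show "inj_on (inv_into X f) (f ` X)" by (rule inj_on_inv_into) simp
  show "inv_into X f ` f ` X \<subseteq> univ N" using assms(2) f(1) by auto
  fix xs assume xs: "set xs \<subseteq> f ` X"
  let ?ys = "map (inv_into X f) xs"
  have "set ?ys \<subseteq> X" using xs f(1) by (auto simp: inv_into_into subset_iff)
  moreover have "map f ?ys = xs" using xs by (auto simp: map_idI f_inv_into_f subset_iff)
  ultimately show "?ys \<in> rel N \<longleftrightarrow> xs \<in> rel N" using f(3)[of ?ys] by simp
qed

lemma edges_image:
  assumes "embedding g A B" "S \<subseteq> univ A"
  shows "edges B (g ` S) = (`) g ` edges A S"
proof (intro subset_antisym subsetI)
  fix e assume "e \<in> edges B (g ` S)"
  then obtain ys where ys: "ys \<in> rel B" "e = set ys" "set ys \<subseteq> g ` S"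
    by (auto simp: edges_def hyperedges_def)
  let ?xs = "map (inv_into S g) ys"
  have xs: "set ?xs \<subseteq> S" using ys(3) by (auto simp: inv_into_into subset_iff)
  have "map g ?xs = ys" using ys(3) by (auto simp: map_idI f_inv_into_f subset_iff)
  then have "?xs \<in> rel A" "e = g ` set ?xs"
    using assms ys xs unfolding embedding_def by (metis order_trans, metis set_map)
  moreover have "set ?xs \<in> edges A S"
    using calculation(1) xs unfolding edges_def hyperedges_def by blast
  ultimately show "e \<in> (`) g ` edges A S" by blast
next
  fix e assume "e \<in> (`) g ` edges A S"
  then obtain xs where xs: "xs \<in> rel A" "e = g ` set xs" "set xs \<subseteq> S"
    by (auto simp: edges_def hyperedges_def)
  then have "map g xs \<in> rel B" using assms unfolding embedding_def by blast
  then show "e \<in> edges B (g ` S)" using xs by (auto simp: edges_def hyperedges_def image_iff intro!: bexI[of _ "map g xs"])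
qed

lemma card_image_embedding: "embedding g A B \<Longrightarrow> S \<subseteq> univ A \<Longrightarrow> card (g ` S) = card S"
  by (rule card_image) (auto simp: embedding_def intro: inj_on_subset)

lemma predim_image:
  assumes "embedding g A B" "S \<subseteq> univ A"
  shows "predim n m (substr B (g ` S)) = predim n m (substr A S)"
proof -
  have "inj_on g S" using assms by (auto simp: embedding_def intro: inj_on_subset)
  then have "inj_on ((`) g) (edges A S)"
    by (rule inj_on_subset[OF inj_on_image_Pow]) (auto simp: edges_def)
  then show ?thesis
    using card_image_embedding[OF assms] by (simp add: predim_substr edges_image[OF assms] card_image)
qed

lemma self_sufficientD:
  "self_sufficient n m N A \<Longrightarrow> finite B \<Longrightarrow> A \<subseteq> B \<Longrightarrow> B \<subseteq> univ N \<Longrightarrow>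
    predim n m (substr N A) \<le> predim n m (substr N B)"
  by (simp add: self_sufficient_def)

text \<open>Submodularity for \<open>Z\<close> and \<open>A\<close>, where self-sufficiency of
  \<open>A\<close> controls the union.\<close>

lemma predim_inter_self_sufficient:
  assumes "self_sufficient n m N A" "finite Z" "Z \<subseteq> univ N"
  shows "predim n m (substr N (Z \<inter> A)) \<le> predim n m (substr N Z)"
proof -
  have A: "finite A" "A \<subseteq> univ N" using assms(1) by (auto simp: self_sufficient_def)
  have "predim n m (substr N A) \<le> predim n m (substr N (Z \<union> A))"
    using A assms by (intro self_sufficientD[OF assms(1)]) auto
  then show ?thesis using predim_submodular[OF assms(2) A(1), of n m N] by linarith
qed

section \<open>Free amalgams\<close>

text \<open>\<open>W\<close> stays in place and \<open>X\<close> is glued on through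
  \<open>h\<close>; every edge lies within one of the two sides.\<close>

definition amalgam :: "('a \<Rightarrow> 'a) \<Rightarrow> 'a struct \<Rightarrow> 'a set \<Rightarrow> 'a set \<Rightarrow> 'a struct" where
  "amalgam h N W X = \<lparr>univ = W \<union> h ` X, rel = rel (substr N W) \<union> map h ` rel (substr N X)\<rparr>"

text \<open>Strength is demanded on one side only: \<open>X0\<close> is self-sufficient within
  \<open>X\<close>, while its image may fail to be so within \<open>W\<close>. The points of
  \<open>X\<close> outside \<open>X0\<close> go to fresh elements, possibly outside
  \<open>N\<close>.\<close>

locale free_amalgam =
  fixes r n m :: nat and N :: "'a struct" and h :: "'a \<Rightarrow> 'a" and X0 X W :: "'a set"
  assumes hypergraph: "hypergraph r N"
    and sub: "X0 \<subseteq> X" "X \<subseteq> univ N" "finite X" "W \<subseteq> univ N" "finite W"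
    and emb: "embedding h (substr N X0) N"
    and inj: "inj_on h X" and over: "h ` X0 \<subseteq> W" and fresh: "h ` (X - X0) \<inter> W = {}"
    and strong: "\<And>S. X0 \<subseteq> S \<Longrightarrow> S \<subseteq> X \<Longrightarrow> predim n m (substr N X0) \<le> predim n m (substr N S)"
begin

abbreviation V where "V \<equiv> amalgam h N W X"

lemma univ_V [simp]: "univ V = W \<union> h ` X"
  by (simp add: amalgam_def)

lemma meet: "W \<inter> h ` X = h ` X0"
  using over fresh sub(1) by blast

lemma in_X0: "x \<in> X \<Longrightarrow> h x \<in> W \<Longrightarrow> x \<in> X0"
  using fresh by auto

text \<open>A glued edge that falls into \<open>W\<close> comes from \<open>X0\<close>, where
  \<open>h\<close> is already an embedding into \<open>N\<close>.\<close>

lemma substr_W: "substr V W = substr N W"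
proof -
  have "map h xs \<in> rel N" if xs: "xs \<in> rel N" "set xs \<subseteq> X" "set (map h xs) \<subseteq> W" for xs
  proof -
    have "set xs \<subseteq> X0" using xs in_X0 by auto
    then show ?thesis using embedding_substrD(3)[OF emb] xs by simp
  qed
  then show ?thesis by (auto simp: substr_def amalgam_def)
qed

lemma embedding_h: "embedding h (substr N X) V"
proof (rule embedding_substrI)
  fix xs assume xs: "set xs \<subseteq> X"
  show "map h xs \<in> rel V \<longleftrightarrow> xs \<in> rel N"
  proof
    assume "map h xs \<in> rel V"
    then consider "map h xs \<in> rel N" "set (map h xs) \<subseteq> W"
      | ys where "ys \<in> rel N" "set ys \<subseteq> X" "map h xs = map h ys"
      by (auto simp: amalgam_def)
    then show "xs \<in> rel N"
    proof cases
      case 1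
      have "set xs \<subseteq> X0" using xs 1(2) in_X0 by auto
      then show ?thesis using embedding_substrD(3)[OF emb] 1 by simp
    next
      case 2
      have "inj_on h (set xs \<union> set ys)" using xs 2 by (intro inj_on_subset[OF inj]) auto
      then have "xs = ys" using 2(3) by (simp add: inj_on_map_eq_map)
      then show ?thesis using 2 by simp
    qed
  qed (use xs in \<open>auto simp: amalgam_def\<close>)
qed (use inj in auto)

lemma hypergraph_V: "hypergraph r V"
  unfolding hypergraph_def r_struct_def
proof (intro conjI ballI allI impI)
  fix xs assume "xs \<in> rel V"
  then consider "xs \<in> rel N" "set xs \<subseteq> W" | ys where "ys \<in> rel N" "set ys \<subseteq> X" "xs = map h ys"
    by (auto simp: amalgam_def)
  note c = this
  have N: "r_struct r N" "\<And>xs. xs \<in> rel N \<Longrightarrow> distinct xs"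
    "\<And>xs ys. xs \<in> rel N \<Longrightarrow> mset ys = mset xs \<Longrightarrow> ys \<in> rel N"
    using hypergraph by (auto simp: hypergraph_def)
  from c show "length xs = r" using N(1) by cases (auto simp: r_struct_def)
  from c show "set xs \<subseteq> univ V" by cases auto
  from c show "distinct xs"
    using N(2) inj by cases (auto simp: distinct_map intro: inj_on_subset)
  fix zs assume zs: "mset zs = mset xs"
  from c show "zs \<in> rel V"
  proof cases
    case 1
    have "set zs = set xs" using zs by (rule mset_eq_setD)
    then show ?thesis using N(3)[OF 1(1) zs] 1 by (auto simp: amalgam_def)
  next
    case 2
    let ?ws = "map (inv_into X h) zs"
    have set_zs: "set zs = h ` set ys" using mset_eq_setD[OF zs] 2 by simp
    have "mset ?ws = image_mset (inv_into X h) (image_mset h (mset ys))"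
      using zs 2 by simp
    also have "\<dots> = image_mset id (mset ys)"
      unfolding multiset.map_comp using 2(2) inj by (intro image_mset_cong) auto
    finally have "?ws \<in> rel N" using N(3)[OF 2(1)] by simp
    moreover have "map h ?ws = zs" unfolding map_map
      by (rule map_idI) (use set_zs 2(2) in \<open>auto simp: f_inv_into_f\<close>)
    moreover have "set ?ws \<subseteq> X" using set_zs 2(2) by (auto simp: inv_into_into)
    ultimately have "zs \<in> map h ` rel (substr N X)"
      by (intro image_eqI[of _ _ ?ws]) simp_all
    then show ?thesis by (simp add: amalgam_def)
  qed
qed

text \<open>Freeness turns submodularity into an equality: as no edge crosses, edges obey
  inclusion-exclusion just like points.\<close>

lemma predim_V:
  assumes "S \<subseteq> univ V"
  shows "predim n m (substr V S) = predim n m (substr V (S \<inter> W)) + predim n m (substr V (S \<inter> h ` X))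
     - predim n m (substr V (S \<inter> h ` X0))"
proof -
  have fin: "finite S" using assms sub by (auto intro: finite_subset)
  have "edges V S = edges V (S \<inter> W) \<union> edges V (S \<inter> h ` X)"
  proof (intro subset_antisym subsetI)
    fix e assume "e \<in> edges V S"
    then obtain xs where xs: "xs \<in> rel V" "e = set xs" "set xs \<subseteq> S" by (auto simp: edges_def hyperedges_def)
    then have "set xs \<subseteq> W \<or> set xs \<subseteq> h ` X"
      unfolding amalgam_def by (force simp: image_iff)
    then show "e \<in> edges V (S \<inter> W) \<union> edges V (S \<inter> h ` X)"
      using xs unfolding edges_def hyperedges_def by blast
  qed (auto simp: edges_def)
  moreover have "edges V (S \<inter> W) \<inter> edges V (S \<inter> h ` X) = edges V (S \<inter> h ` X0)"
    using meet by (auto simp: edges_def)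
  ultimately have "card (edges V S) + card (edges V (S \<inter> h ` X0)) = card (edges V (S \<inter> W)) + card (edges V (S \<inter> h ` X))"
    using fin card_Un_Int[of "edges V (S \<inter> W)" "edges V (S \<inter> h ` X)"] by simp
  then have 1: "int m * int (card (edges V S)) + int m * int (card (edges V (S \<inter> h ` X0)))
      = int m * int (card (edges V (S \<inter> W))) + int m * int (card (edges V (S \<inter> h ` X)))"
    by (metis of_nat_add distrib_left)
  have "S = (S \<inter> W) \<union> (S \<inter> h ` X)" "(S \<inter> W) \<inter> (S \<inter> h ` X) = S \<inter> h ` X0"
    using assms meet by auto
  then have "card S + card (S \<inter> h ` X0) = card (S \<inter> W) + card (S \<inter> h ` X)"
    using fin card_Un_Int[of "S \<inter> W" "S \<inter> h ` X"] by simp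
  then have 2: "int n * int (card S) + int n * int (card (S \<inter> h ` X0))
      = int n * int (card (S \<inter> W)) + int n * int (card (S \<inter> h ` X))"
    by (metis of_nat_add distrib_left)
  show ?thesis unfolding predim_substr using 1 2 by linarith
qed

lemma strong_h:
  assumes "h ` X0 \<subseteq> S" "S \<subseteq> h ` X"
  shows "predim n m (substr V (h ` X0)) \<le> predim n m (substr V S)"
proof -
  obtain T where T: "T \<subseteq> X" "S = h ` T" using assms(2) by (meson subset_imageE)
  have "X0 \<subseteq> T" using assms(1) T sub(1) inj by (auto simp: inj_on_def) (metis imageE image_eqI subsetD)
  then have "predim n m (substr N X0) \<le> predim n m (substr N T)" using T by (intro strong) auto
  moreover have "predim n m (substr V (h ` X0)) = predim n m (substr N X0)"
    using predim_image[OF embedding_h, of X0 n m] sub by simp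
  moreover have "predim n m (substr V S) = predim n m (substr N T)"
    using predim_image[OF embedding_h, of T n m] T by simp
  ultimately show ?thesis by simp
qed

lemma self_sufficient_W: "self_sufficient n m V W"
  unfolding self_sufficient_def
proof (intro conjI allI impI; (elim conjE)?)
  fix B assume B: "finite B" "W \<subseteq> B" "B \<subseteq> univ V"
  have "B \<inter> W = W" "B \<inter> h ` X0 = h ` X0" using B over by auto
  moreover have "predim n m (substr V (h ` X0)) \<le> predim n m (substr V (B \<inter> h ` X))"
    using B over sub(1) by (intro strong_h) auto
  ultimately show "predim n m (substr V W) \<le> predim n m (substr V B)"
    using predim_V[OF B(3)] by simp
qed (use sub in auto)

text \<open>Submodularity carries the strength of \<open>X0\<close> in \<open>X\<close> over to the
  part met by \<open>S\<close>, so the glued points never lower the predimension. Hence the amalgam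
  inherits nonnegative predimensions from \<open>N\<close>.\<close>

lemma predim_V_ge:
  assumes "S \<subseteq> univ V"
  shows "predim n m (substr N (S \<inter> W)) \<le> predim n m (substr V S)"
proof -
  have fin: "finite S" using assms sub by (auto intro: finite_subset)
  let ?S = "S \<inter> h ` X"
  have "predim n m (substr V (h ` X0)) \<le> predim n m (substr V (?S \<union> h ` X0))"
    using sub(1) by (intro strong_h) auto
  moreover have "predim n m (substr V (?S \<union> h ` X0)) + predim n m (substr V (?S \<inter> h ` X0))
      \<le> predim n m (substr V ?S) + predim n m (substr V (h ` X0))"
    using fin sub by (intro predim_submodular) (auto intro: finite_subset)
  moreover have "?S \<inter> h ` X0 = S \<inter> h ` X0" using sub(1) by auto
  moreover have "substr V (S \<inter> W) = substr N (S \<inter> W)"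
    using substr_W substr_substr[of "S \<inter> W" W V] substr_substr[of "S \<inter> W" W N] by simp
  ultimately show ?thesis using predim_V[OF assms] by simp
qed

end

section \<open>Back-and-forth in generic structures\<close>

lemma ex_fresh_extension:
  fixes f :: "nat \<Rightarrow> nat"
  assumes "inj_on f X" "f ` X \<subseteq> W" "finite W"
  shows "\<exists>h. inj_on h X' \<and> (\<forall>x\<in>X. h x = f x) \<and> h ` (X' - X) \<inter> W = {}"
proof -
  define M where "M = Suc (Max (insert 0 W))"
  have M: "w < M" if "w \<in> W" for w
    using assms(3) that by (simp add: M_def less_Suc_eq_le)
  \<comment> \<open>Adding \<open>M\<close> lifts the new points above all of \<open>W\<close>, in
    particular above the values of \<open>f\<close>.\<close>
  define h where "h x = (if x \<in> X then f x else x + M)" for x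
  have fM: "f x < M" if "x \<in> X" for x using M assms(2) that by auto
  have "h x = h y \<Longrightarrow> x = y" for x y
    using assms(1) fM[of x] fM[of y] by (auto simp: h_def inj_on_def split: if_splits)
  then have "inj_on h X'" by (auto simp: inj_on_def)
  moreover have "h ` (X' - X) \<inter> W = {}" using M by (fastforce simp: h_def)
  ultimately show ?thesis by (intro exI[of _ h]) (auto simp: h_def)
qed

lemma embedding_cong:
  assumes "embedding f (substr N X) M" "\<And>x. x \<in> X \<Longrightarrow> h x = f x"
  shows "embedding h (substr N X) M"
proof (rule embedding_substrI)
  note f = embedding_substrD[OF assms(1)]
  show "inj_on h X" using f(1) assms(2) by (simp add: inj_on_def)
  show "h ` X \<subseteq> univ M" using f(2) assms(2) by auto
  fix xs assume xs: "set xs \<subseteq> X"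
  then have "map h xs = map f xs" using assms(2) by auto
  then show "map h xs \<in> rel M \<longleftrightarrow> xs \<in> rel N" using f(3)[OF xs] by (simp only:)
qed

text \<open>A forth step suffices, because \<open>G\<close> is required of domain and image alike
  and the inverse embedding exchanges them. Letting \<open>G\<close> depend on the formula still to
  be evaluated allows the required strength to change as quantifiers are used up.\<close>

lemma back_and_forth:
  fixes N :: "'a struct" and G :: "form \<Rightarrow> 'a set \<Rightarrow> bool"
  assumes univ: "\<And>\<phi> X. G \<phi> X \<Longrightarrow> X \<subseteq> univ N"
    and neg: "\<And>\<phi> X. G (Neg \<phi>) X \<Longrightarrow> G \<phi> X"
    and conj: "\<And>\<phi> \<psi> X. G (Conj \<phi> \<psi>) X \<Longrightarrow> G \<phi> X \<and> G \<psi> X"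
    and ex: "\<And>v \<phi> X f c. G (Ex v \<phi>) X \<Longrightarrow> G (Ex v \<phi>) (f ` X) \<Longrightarrow> embedding f (substr N X) N \<Longrightarrow>
      c \<in> univ N \<Longrightarrow> \<exists>X' g. insert c X \<subseteq> X' \<and> embedding g (substr N X') N \<and> (\<forall>x\<in>X. g x = f x) \<and>
        G \<phi> X' \<and> G \<phi> (g ` X')"
  shows "G \<phi> X \<Longrightarrow> G \<phi> (f ` X) \<Longrightarrow> embedding f (substr N X) N \<Longrightarrow> e ` fv \<phi> \<subseteq> X \<Longrightarrow>
    sat N e \<phi> \<longleftrightarrow> sat N (f \<circ> e) \<phi>"
proof (induction \<phi> arbitrary: X f e)
  case (Eq u v)
  then show ?case using embedding_substrD(1)[OF Eq(3)] by (auto simp: inj_on_eq_iff)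
next
  case (Rel vs)
  have "map f (map e vs) \<in> rel N \<longleftrightarrow> map e vs \<in> rel N"
    using Rel(4) by (intro embedding_substrD(3)[OF Rel(3)]) auto
  then show ?case by (simp add: o_def)
next
  case (Neg \<phi>)
  then show ?case using neg[of \<phi>] by (metis fv.simps(3) sat.simps(3))
next
  case (Conj \<phi> \<psi>)
  then show ?case using conj[of \<phi> \<psi>] by (metis fv.simps(4) sat.simps(4) image_Un le_sup_iff)
next
  case (Ex v \<phi>)
  have fwd: "sat N (f \<circ> e) (form.Ex v \<phi>)"
    if fw: "G (form.Ex v \<phi>) X" "G (form.Ex v \<phi>) (f ` X)" "embedding f (substr N X) N"
      "e ` fv (form.Ex v \<phi>) \<subseteq> X" "sat N e (form.Ex v \<phi>)" for X f e
  proof -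
    from fw(5) obtain c where c: "c \<in> univ N" "sat N (e(v := c)) \<phi>" by auto
    obtain X' g where g: "insert c X \<subseteq> X'" "embedding g (substr N X') N" "\<forall>x\<in>X. g x = f x"
        "G \<phi> X'" "G \<phi> (g ` X')"
      using ex[OF fw(1-3) c(1)] by blast
    have "(e(v := c)) ` fv \<phi> \<subseteq> X'" using fw(4) g(1) by auto
    then have "sat N (g \<circ> e(v := c)) \<phi>" using Ex.IH[OF g(4,5,2)] c(2) by blast
    also have "sat N (g \<circ> e(v := c)) \<phi> \<longleftrightarrow> sat N ((f \<circ> e)(v := g c)) \<phi>"
      by (rule sat_cong) (use fw(4) g(3) in auto)
    finally show ?thesis using embedding_substrD(2)[OF g(2)] g(1) by auto
  qed
  show ?case
  proof
    assume "sat N e (form.Ex v \<phi>)"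
    then show "sat N (f \<circ> e) (form.Ex v \<phi>)" by (rule fwd[OF Ex.prems])
  next
    assume s: "sat N (f \<circ> e) (form.Ex v \<phi>)"
    have X: "X \<subseteq> univ N" by (rule univ[OF Ex.prems(1)])
    note inj = embedding_substrD(1)[OF Ex.prems(3)]
    have img: "inv_into X f ` f ` X = X" using inj by simp
    have "sat N (inv_into X f \<circ> (f \<circ> e)) (form.Ex v \<phi>)"
      by (rule fwd[of "f ` X"]) (use Ex.prems img s embedding_inverse[OF Ex.prems(3) X] in auto)
    also have "?this \<longleftrightarrow> sat N e (form.Ex v \<phi>)"
      by (rule sat_cong) (use Ex.prems(4) inj in auto)
    finally show "sat N e (form.Ex v \<phi>)" .
  qed
qed

section \<open>Tight sets and strength against bounded extensions\<close>

definition tight :: "nat \<Rightarrow> nat \<Rightarrow> 'a struct \<Rightarrow> 'a set \<Rightarrow> 'a set \<Rightarrow> bool" where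
  "tight n m N A Z \<longleftrightarrow> A \<subseteq> Z \<and>
     (\<forall>Z'. A \<subseteq> Z' \<and> Z' \<subset> Z \<longrightarrow> predim n m (substr N Z) < predim n m (substr N Z'))"

definition tight_le :: "nat \<Rightarrow> nat \<Rightarrow> 'a struct \<Rightarrow> (nat \<Rightarrow> bool) \<Rightarrow> nat set \<Rightarrow>
    (nat \<Rightarrow> 'a) \<Rightarrow> (nat \<Rightarrow> 'a) \<Rightarrow> bool" where
  "tight_le n m N Q V e e' \<longleftrightarrow>
     (\<forall>Z. finite Z \<and> Z \<subseteq> univ N \<and> Q (card Z) \<and> tight n m N (e ` V) Z \<longrightarrow>
       (\<exists>g. embedding g (substr N Z) N \<and> (\<forall>v\<in>V. g (e v) = e' v)))"

lemma tight_image: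
  assumes "embedding g (substr M Z) N" "tight n m M A Z"
  shows "tight n m N (g ` A) (g ` Z)"
  unfolding tight_def
proof (intro conjI allI impI; (elim conjE)?)
  have AZ: "A \<subseteq> Z" using assms(2) by (simp add: tight_def)
  then show "g ` A \<subseteq> g ` Z" by auto
  note inj = embedding_substrD(1)[OF assms(1)]
  fix Z'' assume Z'': "g ` A \<subseteq> Z''" "Z'' \<subset> g ` Z"
  then obtain Z' where Z': "Z' \<subseteq> Z" "Z'' = g ` Z'" by (meson psubset_imp_subset subset_imageE)
  have "A \<subseteq> Z'" using Z''(1) AZ Z' inj by (simp add: inj_on_image_subset_iff)
  moreover have "Z' \<noteq> Z" using Z'' Z' by auto
  ultimately have "predim n m (substr M Z) < predim n m (substr M Z')"
    using assms(2) Z'(1) unfolding tight_def by blast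
  then show "predim n m (substr N (g ` Z)) < predim n m (substr N Z'')"
    using predim_image[OF assms(1), of Z n m] predim_image[OF assms(1), of Z' n m] Z' by simp
qed

text \<open>Self-sufficiency tested only on extensions by at most \<open>k\<close> points. Hulls
  that are strong in this sense can be found within a bounded size.\<close>

definition kstrong :: "nat \<Rightarrow> nat \<Rightarrow> 'a struct \<Rightarrow> nat \<Rightarrow> 'a set \<Rightarrow> bool" where
  "kstrong n m N k X \<longleftrightarrow> finite X \<and> X \<subseteq> univ N \<and>
     (\<forall>Z. finite Z \<and> X \<subseteq> Z \<and> Z \<subseteq> univ N \<and> card (Z - X) \<le> k \<longrightarrow>
        predim n m (substr N X) \<le> predim n m (substr N Z))"

lemma kstrongD:
  "kstrong n m N k X \<Longrightarrow> finite Z \<Longrightarrow> X \<subseteq> Z \<Longrightarrow> Z \<subseteq> univ N \<Longrightarrow> card (Z - X) \<le> k \<Longrightarrow>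
    predim n m (substr N X) \<le> predim n m (substr N Z)"
  unfolding kstrong_def by blast

lemma finite_subset_mono_UN:
  fixes F :: "nat \<Rightarrow> 'a set"
  assumes "mono F" "finite S" "S \<subseteq> (\<Union>i. F i)"
  shows "\<exists>i. S \<subseteq> F i"
  using assms(2,3)
proof (induction S rule: finite_induct)
  case (insert x S)
  then obtain i j where "S \<subseteq> F i" "x \<in> F j" by blast
  then have "insert x S \<subseteq> F (max i j)"
    using monoD[OF assms(1), of i "max i j"] monoD[OF assms(1), of j "max i j"] by auto
  then show ?case by blast
qed simp

text \<open>The strength asked of a domain of size \<open>s\<close> on which the formula is to be
  evaluated. At a quantifier the domain gains one point, hence \<open>Suc s\<close>, and is enlarged
  to a hull; \<open>\<beta> \<kappa> t\<close> will bound the size of that hull plus the strength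
  that \<open>\<kappa>\<close> asks of it.\<close>

primrec depth :: "((nat \<Rightarrow> nat) \<Rightarrow> nat \<Rightarrow> nat) \<Rightarrow> form \<Rightarrow> nat \<Rightarrow> nat" where
  "depth \<beta> (Eq u v) = (\<lambda>_. 0)"
| "depth \<beta> (Rel vs) = (\<lambda>_. 0)"
| "depth \<beta> (Neg \<phi>) = depth \<beta> \<phi>"
| "depth \<beta> (Conj \<phi> \<psi>) = (\<lambda>s. max (depth \<beta> \<phi> s) (depth \<beta> \<psi> s))"
| "depth \<beta> (Ex v \<phi>) = (\<lambda>s. \<beta> (depth \<beta> \<phi>) (Suc s))"

locale generic_hypergraph =
  fixes r n m :: nat and K :: "nat struct set" and N :: "nat struct"
  assumes generic: "generic_structure r n m K N" and C0: "K \<subseteq> class_C0 r n m"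
begin

section \<open>Finite subsets of a generic structure\<close>

abbreviation \<delta> where "\<delta> S \<equiv> predim n m (substr N S)"

lemma self_sufficient_cover:
  assumes "finite S" "S \<subseteq> univ N"
  obtains X where "S \<subseteq> X" "self_sufficient n m N X" "substr N X \<in> K"
proof -
  obtain F :: "nat \<Rightarrow> nat set" where F': "(\<Union>i. F i) = univ N"
    "\<forall>i. F i \<subseteq> F (Suc i) \<and> self_sufficient n m (substr N (F (Suc i))) (F i) \<and>
             self_sufficient n m N (F i) \<and> substr N (F i) \<in> K"
    using generic unfolding generic_structure_def by (elim conjE exE)
  then have F: "(\<Union>i. F i) = univ N"
    "\<And>i. F i \<subseteq> F (Suc i)" "\<And>i. self_sufficient n m N (F i)" "\<And>i. substr N (F i) \<in> K"
    by simp_all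
  have mono: "mono F" using F(2) by (simp add: mono_iff_le_Suc)
  obtain i where "S \<subseteq> F i"
    using finite_subset_mono_UN[OF mono assms(1)] assms(2) F(1) by blast
  then show thesis using that F(3,4) by blast
qed

lemma nonneg:
  assumes "finite S" "S \<subseteq> univ N"
  shows "0 \<le> \<delta> S"
proof -
  obtain X where X: "S \<subseteq> X" "substr N X \<in> K" using assms by (rule self_sufficient_cover)
  then have "0 \<le> predim n m (substr (substr N X) S)" using C0 by (auto simp: class_C0_def)
  then show ?thesis using X(1) by simp
qed

lemma hypergraph_N: "hypergraph r N"
  unfolding hypergraph_def
proof (intro conjI ballI allI impI)
  show rs: "r_struct r N" using generic by (simp add: generic_structure_def)
  fix xs assume xs: "xs \<in> rel N"
  then have "set xs \<subseteq> univ N" using rs by (auto simp: r_struct_def)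
  then obtain X where X: "set xs \<subseteq> X" "substr N X \<in> K" by (rule self_sufficient_cover[OF finite_set])
  then have h: "hypergraph r (substr N X)" using C0 by (auto simp: class_C0_def)
  have xs': "xs \<in> rel (substr N X)" using X(1) xs by simp
  then show "distinct xs" using h unfolding hypergraph_def by blast
  fix ys assume ys: "mset ys = mset xs"
  have "ys \<in> rel (substr N X)" using h ys xs' unfolding hypergraph_def by blast
  then show "ys \<in> rel N" by simp
qed

lemma amalgam_embed:
  assumes "free_amalgam r n m N h X0 X W" "self_sufficient n m N W" "amalgam h N W X \<in> K"
  obtains g where "embedding g (amalgam h N W X) N" "\<forall>a\<in>W. g a = a"
    "self_sufficient n m N (g ` univ (amalgam h N W X))"
proof -
  interpret free_amalgam r n m N h X0 X W by fact
  have "\<forall>A. \<forall>B\<in>K. self_sufficient n m N A \<and> self_sufficient n m B A \<and> substr B A = substr N A \<longrightarrow>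
      (\<exists>g. embedding g B N \<and> (\<forall>a\<in>A. g a = a) \<and> self_sufficient n m N (g ` univ B))"
    using generic unfolding generic_structure_def by (elim conjE)
  from this[rule_format, OF assms(3), of W] show thesis
    using that assms(2) self_sufficient_W substr_W by blast
qed

text \<open>Gluing onto the image of \<open>X\<close> itself makes the amalgam a copy of
  \<open>X'\<close>, so closure of \<open>K\<close> under isomorphism puts it into \<open>K\<close>.
  This is why the collapsed class is covered as well.\<close>

lemma self_sufficient_extend:
  assumes iso: "\<And>A f B. A \<in> K \<Longrightarrow> r_struct r B \<Longrightarrow> isomorphism f A B \<Longrightarrow> B \<in> K"
    and ss: "self_sufficient n m N X" "self_sufficient n m N (f ` X)"
    and emb: "embedding f (substr N X) N" and c: "c \<in> univ N"
  shows "\<exists>X' g. insert c X \<subseteq> X' \<and> embedding g (substr N X') N \<and> (\<forall>x\<in>X. g x = f x) \<and>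
        self_sufficient n m N X' \<and> self_sufficient n m N (g ` X')"
proof -
  have X: "finite X" "X \<subseteq> univ N" and Y: "finite (f ` X)" "f ` X \<subseteq> univ N"
    using ss by (auto simp: self_sufficient_def)
  obtain X' where X': "insert c X \<subseteq> X'" "self_sufficient n m N X'" "substr N X' \<in> K"
    by (rule self_sufficient_cover[of "insert c X"]) (use X c in auto)
  have X'u: "finite X'" "X' \<subseteq> univ N" using X'(2) by (auto simp: self_sufficient_def)
  obtain h where h: "inj_on h X'" "\<forall>x\<in>X. h x = f x" "h ` (X' - X) \<inter> f ` X = {}"
    using ex_fresh_extension[OF embedding_substrD(1)[OF emb] subset_refl Y(1)] by blast
  have hX: "h ` X = f ` X" using h(2) by (auto intro: image_cong)
  have emb_h: "embedding h (substr N X) N" by (rule embedding_cong[OF emb]) (use h(2) in simp)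
  interpret free_amalgam r n m N h X X' "f ` X"
  proof
    show "predim n m (substr N X) \<le> predim n m (substr N S)" if "X \<subseteq> S" "S \<subseteq> X'" for S
      by (rule self_sufficientD[OF ss(1)]) (use that X'u in \<open>auto intro: finite_subset\<close>)
  qed (use hypergraph_N X' X'u Y emb_h h hX in auto)
  have uV: "univ V = h ` X'" using hX X'(1) by auto
  have "isomorphism h (substr N X') V"
    unfolding isomorphism_def using embedding_h uV by simp
  then have "V \<in> K" using iso[OF X'(3)] hypergraph_V by (auto simp: hypergraph_def)
  then obtain g where g: "embedding g V N" "\<forall>a\<in>f ` X. g a = a" "self_sufficient n m N (g ` univ V)"
    using amalgam_embed[OF free_amalgam_axioms ss(2)] by blast
  have "embedding (g \<circ> h) (substr N X') N" by (rule embedding_comp[OF embedding_h g(1)])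
  moreover have "(g \<circ> h) ` X' = g ` univ V" using uV by (simp add: image_comp)
  moreover have "(g \<circ> h) x = f x" if "x \<in> X" for x using that h(2) g(2) by auto
  ultimately show ?thesis using X' g(3) by (intro exI[of _ X'] exI[of _ "g \<circ> h"]) auto
qed

text \<open>The image of \<open>X\<close> is only \<open>k\<close>-strong, so the copy of
  \<open>X'\<close> is glued onto a self-sufficient \<open>W\<close> around that image, and the
  amalgam is a genuinely new structure. It belongs to \<open>class_C0\<close> because
  \<open>predim_V_ge\<close> compares it with subsets of \<open>N\<close>.\<close>

lemma kstrong_extend:
  assumes K: "K = class_C0 r n m"
    and ks: "kstrong n m N k X" "kstrong n m N k (f ` X)" and emb: "embedding f (substr N X) N"
    and X': "X \<subseteq> X'" "card (X' - X) \<le> k" "kstrong n m N k' X'" and k': "k' \<le> k"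
  shows "\<exists>g. embedding g (substr N X') N \<and> (\<forall>x\<in>X. g x = f x) \<and> kstrong n m N k' (g ` X')"
proof -
  have X: "finite X" "X \<subseteq> univ N" and Y: "finite (f ` X)" "f ` X \<subseteq> univ N"
    and X'u: "finite X'" "X' \<subseteq> univ N"
    using ks X'(3) by (auto simp: kstrong_def)
  obtain W where W: "f ` X \<subseteq> W" "self_sufficient n m N W" "substr N W \<in> K"
    by (rule self_sufficient_cover[OF Y])
  have Wu: "finite W" "W \<subseteq> univ N" using W(2) by (auto simp: self_sufficient_def)
  obtain h where h: "inj_on h X'" "\<forall>x\<in>X. h x = f x" "h ` (X' - X) \<inter> W = {}"
    using ex_fresh_extension[OF embedding_substrD(1)[OF emb] W(1) Wu(1)] by blast
  have hX: "h ` X = f ` X" using h(2) by (auto intro: image_cong)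
  have emb_h: "embedding h (substr N X) N" by (rule embedding_cong[OF emb]) (use h(2) in simp)
  interpret free_amalgam r n m N h X X' W
  proof
    show "predim n m (substr N X) \<le> predim n m (substr N S)" if S: "X \<subseteq> S" "S \<subseteq> X'" for S
    proof -
      have "finite S" using S X'u by (auto intro: finite_subset)
      moreover have "card (S - X) \<le> k"
        using X'(2) card_mono[OF _ Diff_mono[OF S(2) subset_refl[of X]]] X'u(1) by (meson finite_Diff order_trans)
      ultimately show ?thesis using ks(1) S X'u unfolding kstrong_def by auto
    qed
  qed (use hypergraph_N X' X'u Y emb_h h hX W Wu in auto)
  have "0 \<le> predim n m (substr V S)" if "S \<subseteq> univ V" for S
    using predim_V_ge[OF that] nonneg[of "S \<inter> W"] Wu by (simp add: le_infI2)
  then have "V \<in> K"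
    unfolding K class_C0_def using hypergraph_V Wu X'u by auto
  then obtain g where g: "embedding g V N" "\<forall>a\<in>W. g a = a" "self_sufficient n m N (g ` univ V)"
    using amalgam_embed[OF free_amalgam_axioms W(2)] by blast
  have ginj: "inj_on g (univ V)" and gu: "g ` univ V \<subseteq> univ N" using g(1) by (auto simp: embedding_def)
  have "kstrong n m N k' ((g \<circ> h) ` X')"
    unfolding kstrong_def
  proof (intro conjI allI impI; (elim conjE)?)
    show "finite ((g \<circ> h) ` X')" using X'u by simp
    show "(g \<circ> h) ` X' \<subseteq> univ N" using gu by auto
    fix Z assume Z: "finite Z" "(g \<circ> h) ` X' \<subseteq> Z" "Z \<subseteq> univ N" "card (Z - (g \<circ> h) ` X') \<le> k'"
    \<comment> \<open>Pulled back to the amalgam, \<open>Z\<close> splits freely by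
      \<open>predim_V\<close>. Its part in \<open>W\<close> extends the base by at most
      \<open>k'\<close> points, since points of \<open>W\<close> outside the base are not in the
      copy of \<open>X'\<close>; strength of the base then gives the comparison.\<close>
    define S where "S = {s \<in> univ V. g s \<in> Z}"
    have S: "S \<subseteq> univ V" "h ` X' \<subseteq> S" using Z(2) by (auto simp: S_def)
    have SW: "h ` X \<subseteq> S \<inter> W" using S(2) over X'(1) by auto
    have "g ` S = Z \<inter> g ` univ V" by (auto simp: S_def)
    then have 1: "predim n m (substr V S) \<le> \<delta> Z"
      using predim_inter_self_sufficient[OF g(3) Z(1,3)] predim_image[OF g(1) S(1), of n m] by simp
    have "g ` ((S \<inter> W) - h ` X) \<subseteq> Z - (g \<circ> h) ` X'"
    proof
      fix y assume "y \<in> g ` ((S \<inter> W) - h ` X)"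
      then obtain s where s: "s \<in> S" "s \<in> W" "s \<notin> h ` X" "y = g s" by auto
      then have "s \<notin> h ` X'" using meet by auto
      then have "g s \<notin> g ` h ` X'" using ginj S(1) s(1)
        by (subst inj_on_image_mem_iff[of g "univ V"]) auto
      then show "y \<in> Z - (g \<circ> h) ` X'" using s by (auto simp: S_def image_comp)
    qed
    then have "card (g ` ((S \<inter> W) - h ` X)) \<le> k'"
      using Z(1,4) by (meson card_mono finite_Diff order_trans)
    moreover have "card (g ` ((S \<inter> W) - h ` X)) = card ((S \<inter> W) - h ` X)"
      by (rule card_image, rule inj_on_subset[OF ginj]) auto
    ultimately have "card ((S \<inter> W) - f ` X) \<le> k" using k' hX by simp
    then have "\<delta> (f ` X) \<le> \<delta> (S \<inter> W)"
      using SW hX Wu by (intro kstrongD[OF ks(2)]) auto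
    moreover have "substr V T = substr N T" if "T \<subseteq> W" for T
      using substr_W substr_substr[OF that, of V] substr_substr[OF that, of N] by simp
    then have "substr V (S \<inter> W) = substr N (S \<inter> W)" "substr V (h ` X) = substr N (h ` X)"
      using over by auto
    moreover have "S \<inter> h ` X' = h ` X'" "S \<inter> h ` X = h ` X" using S(2) X'(1) by auto
    ultimately have "predim n m (substr V (h ` X')) \<le> predim n m (substr V S)"
      using predim_V[OF S(1)] hX by simp
    moreover have "\<delta> ((g \<circ> h) ` X') = predim n m (substr V (h ` X'))"
      using predim_image[OF g(1), of "h ` X'" n m] by (simp add: image_comp)
    ultimately show "\<delta> ((g \<circ> h) ` X') \<le> \<delta> Z" using 1 by simp
  qed
  moreover have "embedding (g \<circ> h) (substr N X') N" by (rule embedding_comp[OF embedding_h g(1)])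
  moreover have "(g \<circ> h) x = f x" if "x \<in> X" for x using that h(2) g(2) W(1) by auto
  ultimately show ?thesis by (intro exI[of _ "g \<circ> h"]) auto
qed

text \<open>Minimize the predimension first and the size second. As \<open>Q\<close> passes to
  smaller sizes, proper subsets over \<open>A\<close> compete, and the choice of the size excludes
  equal predimension.\<close>

lemma ex_tight_minimal:
  assumes Q: "\<And>a b. a \<le> b \<Longrightarrow> Q b \<Longrightarrow> Q a"
    and W: "finite W" "A \<subseteq> W" "W \<subseteq> univ N" "Q (card W)"
  obtains Z where "finite Z" "Z \<subseteq> univ N" "Q (card Z)" "tight n m N A Z"
    "\<And>Z'. finite Z' \<Longrightarrow> A \<subseteq> Z' \<Longrightarrow> Z' \<subseteq> univ N \<Longrightarrow> Q (card Z') \<Longrightarrow> \<delta> Z \<le> \<delta> Z'"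
proof -
  define P where "P Z \<longleftrightarrow> finite Z \<and> A \<subseteq> Z \<and> Z \<subseteq> univ N \<and> Q (card Z)" for Z
  have "P W" using W by (simp add: P_def)
  from ex_has_least_nat[of P, OF this, of "\<lambda>Z. nat (\<delta> Z)"]
  obtain Z0 where Z0: "P Z0" "\<And>Z. P Z \<Longrightarrow> nat (\<delta> Z0) \<le> nat (\<delta> Z)" by blast
  have le0: "\<delta> Z0 \<le> \<delta> Z" if "P Z" for Z
    using Z0(2)[OF that] nonneg[of Z] that by (simp add: P_def)
  from ex_has_least_nat[of "\<lambda>Z. P Z \<and> \<delta> Z = \<delta> Z0" Z0 card] Z0(1)
  obtain Z where Z: "P Z" "\<delta> Z = \<delta> Z0" "\<And>Z'. P Z' \<Longrightarrow> \<delta> Z' = \<delta> Z0 \<Longrightarrow> card Z \<le> card Z'" by blast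
  have "tight n m N A Z"
    unfolding tight_def
  proof (intro conjI allI impI; (elim conjE)?)
    show "A \<subseteq> Z" using Z(1) by (simp add: P_def)
    fix Z' assume Z': "A \<subseteq> Z'" "Z' \<subset> Z"
    have fin: "finite Z" using Z(1) by (simp add: P_def)
    have "card Z' < card Z" using Z' fin by (simp add: psubset_card_mono)
    moreover have P: "P Z'"
      using Z(1) Z' fin calculation Q[of "card Z'" "card Z"] unfolding P_def
      by (auto intro: finite_subset)
    ultimately have "\<delta> Z' \<noteq> \<delta> Z0" using Z(3)[OF P] by auto
    then show "\<delta> Z < \<delta> Z'" using le0[OF P] Z(2) by simp
  qed
  moreover have "finite Z" "Z \<subseteq> univ N" "Q (card Z)" using Z(1) by (auto simp: P_def)
  moreover have "\<delta> Z \<le> \<delta> Z'" if "finite Z'" "A \<subseteq> Z'" "Z' \<subseteq> univ N" "Q (card Z')" for Z'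
    using le0[of Z'] Z(2) that by (simp add: P_def)
  ultimately show thesis using that by blast
qed

text \<open>Enlarging a set that is not yet minimal decreases its predimension, which can happen only
  finitely often.\<close>

lemma ex_relatively_minimal:
  fixes \<kappa> :: "nat \<Rightarrow> nat"
  shows "\<exists>S. \<forall>A. finite A \<and> A \<subseteq> univ N \<and> card A \<le> s \<longrightarrow>
    (\<exists>X. finite X \<and> X \<subseteq> univ N \<and> tight n m N A X \<and> card X + \<kappa> (card X) \<le> S \<and>
      (\<forall>Z. finite Z \<and> A \<subseteq> Z \<and> Z \<subseteq> univ N \<and> card Z \<le> card X + \<kappa> (card X) \<longrightarrow> \<delta> X \<le> \<delta> Z))"
proof -
  define min where "min A X \<longleftrightarrow> finite X \<and> X \<subseteq> univ N \<and> tight n m N A X \<and>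
      (\<forall>Z. finite Z \<and> A \<subseteq> Z \<and> Z \<subseteq> univ N \<and> card Z \<le> card X + \<kappa> (card X) \<longrightarrow> \<delta> X \<le> \<delta> Z)" for A X
  have "\<exists>S. \<forall>A W. finite W \<longrightarrow> A \<subseteq> W \<longrightarrow> W \<subseteq> univ N \<longrightarrow> card W \<le> s \<longrightarrow> \<delta> W < int d \<longrightarrow>
    (\<exists>X. min A X \<and> card X + \<kappa> (card X) \<le> S)" for d
  proof (induction d arbitrary: s)
    case 0
    have "\<not> \<delta> W < 0" if "finite W" "W \<subseteq> univ N" for W using nonneg[OF that] by simp
    then show ?case by auto
  next
    case (Suc d)
    \<comment> \<open>Bounds \<open>t + \<kappa> t\<close> for every size \<open>t\<close> up to
      \<open>s\<close>, hence also the size of a set \<open>Z\<close> that refutes the minimality of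
      \<open>X\<close>.\<close>
    define s' where "s' = s + Max (\<kappa> ` {..s})"
    have s': "t + \<kappa> t \<le> s'" if "t \<le> s" for t
      unfolding s'_def using that by (intro add_mono Max_ge) auto
    obtain S where S: "\<forall>A W. finite W \<longrightarrow> A \<subseteq> W \<longrightarrow> W \<subseteq> univ N \<longrightarrow> card W \<le> s' \<longrightarrow> \<delta> W < int d \<longrightarrow>
      (\<exists>X. min A X \<and> card X + \<kappa> (card X) \<le> S)"
      using Suc.IH[of s'] by (elim exE)
    show ?case
    proof (intro exI[of _ "max S s'"] allI impI)
      fix A W assume W: "finite W" "A \<subseteq> W" "W \<subseteq> univ N" "card W \<le> s" "\<delta> W < int (Suc d)"
      obtain X where X: "finite X" "X \<subseteq> univ N" "card X \<le> s" "tight n m N A X"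
        "\<And>Z'. finite Z' \<Longrightarrow> A \<subseteq> Z' \<Longrightarrow> Z' \<subseteq> univ N \<Longrightarrow> card Z' \<le> s \<Longrightarrow> \<delta> X \<le> \<delta> Z'"
        by (rule ex_tight_minimal[of "\<lambda>c. c \<le> s" W A]) (use W in auto)
      show "\<exists>X. min A X \<and> card X + \<kappa> (card X) \<le> max S s'"
      proof (cases "min A X")
        case True
        then show ?thesis using s'[OF X(3)] by (intro exI[of _ X]) auto
      next
        case False
        then obtain Z where Z: "finite Z" "A \<subseteq> Z" "Z \<subseteq> univ N" "card Z \<le> card X + \<kappa> (card X)" "\<delta> Z < \<delta> X"
          using X(1,2,4) by (auto simp: not_le min_def)
        have "card Z \<le> s'" using Z(4) s'[OF X(3)] by simp
        moreover have "\<delta> Z < int d" using X(5)[OF W(1-4)] W(5) Z(5) by simp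
        ultimately obtain X' where "min A X'" "card X' + \<kappa> (card X') \<le> S" using S Z(1-3) by blast
        then show ?thesis by (intro exI[of _ X']) auto
      qed
    qed
  qed
  \<comment> \<open>At most \<open>s\<close> points have predimension at most \<open>n * s\<close>,
    which limits the number of decreases.\<close>
  from this[of "Suc (n * s)"] obtain S where S: "\<forall>A W. finite W \<longrightarrow> A \<subseteq> W \<longrightarrow> W \<subseteq> univ N \<longrightarrow>
      card W \<le> s \<longrightarrow> \<delta> W < int (Suc (n * s)) \<longrightarrow> (\<exists>X. min A X \<and> card X + \<kappa> (card X) \<le> S)"
    by (elim exE)
  have "\<delta> A < int (Suc (n * s))" if "card A \<le> s" for A
  proof -
    have "int n * int (card A) \<le> int n * int s" using that by (intro mult_left_mono) auto
    moreover have "0 \<le> int m * int (card (edges N A))" by simp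
    ultimately show ?thesis unfolding predim_substr by (simp only: of_nat_Suc of_nat_mult)
  qed
  then have "\<exists>X. min A X \<and> card X + \<kappa> (card X) \<le> S" if "finite A" "A \<subseteq> univ N" "card A \<le> s" for A
    by (rule S[rule_format, OF that(1) subset_refl that(2,3)]) (rule that)
  then show ?thesis unfolding min_def conj_assoc by (intro exI[of _ S] allI impI) (simp add: conj_ac)
qed

text \<open>Minimality of the image is checked backwards: a competitor over \<open>e'\<close> can be
  replaced by a tight one, and the second \<open>tight_le\<close> moves that one to a set over
  \<open>e\<close> of the same size and predimension.\<close>

lemma tight_minimal_transfer:
  assumes Q: "\<And>a b. a \<le> b \<Longrightarrow> Q b \<Longrightarrow> Q a"
    and le: "tight_le n m N Q V e e'" "tight_le n m N Q V e' e"
    and X: "finite X" "X \<subseteq> univ N" "Q (card X)" "tight n m N (e ` V) X"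
    and min: "\<And>Z. finite Z \<Longrightarrow> e ` V \<subseteq> Z \<Longrightarrow> Z \<subseteq> univ N \<Longrightarrow> Q (card Z) \<Longrightarrow> \<delta> X \<le> \<delta> Z"
  obtains g where "embedding g (substr N X) N" "\<And>v. v \<in> V \<Longrightarrow> g (e v) = e' v"
    "\<And>Z. finite Z \<Longrightarrow> e' ` V \<subseteq> Z \<Longrightarrow> Z \<subseteq> univ N \<Longrightarrow> Q (card Z) \<Longrightarrow> \<delta> (g ` X) \<le> \<delta> Z"
proof -
  obtain g where g: "embedding g (substr N X) N" "\<forall>v\<in>V. g (e v) = e' v"
    using le(1) X unfolding tight_le_def by blast
  have "\<delta> (g ` X) \<le> \<delta> Z" if Z: "finite Z" "e' ` V \<subseteq> Z" "Z \<subseteq> univ N" "Q (card Z)" for Z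
  proof -
    obtain Z1 where Z1: "finite Z1" "Z1 \<subseteq> univ N" "Q (card Z1)" "tight n m N (e' ` V) Z1"
      "\<And>Z'. finite Z' \<Longrightarrow> e' ` V \<subseteq> Z' \<Longrightarrow> Z' \<subseteq> univ N \<Longrightarrow> Q (card Z') \<Longrightarrow> \<delta> Z1 \<le> \<delta> Z'"
      by (rule ex_tight_minimal[of Q Z "e' ` V"]) (use Q Z in auto)
    obtain h where h: "embedding h (substr N Z1) N" "\<forall>v\<in>V. h (e' v) = e v"
      using le(2) Z1 unfolding tight_le_def by blast
    have "e' ` V \<subseteq> Z1" using Z1(4) by (simp add: tight_def)
    moreover have "e ` V = h ` e' ` V" unfolding image_image using h(2) by (intro image_cong) auto
    ultimately have "e ` V \<subseteq> h ` Z1" by (simp add: image_mono)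
    moreover have "card (h ` Z1) = card Z1" using card_image_embedding[OF h(1)] by simp
    ultimately have "\<delta> X \<le> \<delta> (h ` Z1)"
      using Z1 embedding_substrD(2)[OF h(1)] by (intro min) auto
    also have "\<dots> = \<delta> Z1" using predim_image[OF h(1), of Z1 n m] by simp
    also have "\<delta> X = \<delta> (g ` X)" using predim_image[OF g(1), of X n m] by simp
    finally show ?thesis using Z1(5)[OF Z] by simp
  qed
  then show thesis using that g by blast
qed

text \<open>With no bound on sizes, a set of least predimension over the tuple is self-sufficient,
  and so is its image. The back-and-forth then runs with an invariant that ignores the
  formula.\<close>

lemma sat_transfer_self_sufficient:
  assumes iso: "\<And>A f B. A \<in> K \<Longrightarrow> r_struct r B \<Longrightarrow> isomorphism f A B \<Longrightarrow> B \<in> K"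
    and V: "finite V" "fv \<phi> \<subseteq> V" and e: "e ` V \<subseteq> univ N"
    and le: "tight_le n m N (\<lambda>_. True) V e e'" "tight_le n m N (\<lambda>_. True) V e' e"
  shows "sat N e \<phi> \<longleftrightarrow> sat N e' \<phi>"
proof -
  obtain X where X: "finite X" "X \<subseteq> univ N" "tight n m N (e ` V) X"
    "\<And>Z. finite Z \<Longrightarrow> e ` V \<subseteq> Z \<Longrightarrow> Z \<subseteq> univ N \<Longrightarrow> \<delta> X \<le> \<delta> Z"
    by (rule ex_tight_minimal[of "\<lambda>_. True" "e ` V" "e ` V"]) (use V e in auto)
  obtain g where g: "embedding g (substr N X) N" "\<And>v. v \<in> V \<Longrightarrow> g (e v) = e' v"
    "\<And>Z. finite Z \<Longrightarrow> e' ` V \<subseteq> Z \<Longrightarrow> Z \<subseteq> univ N \<Longrightarrow> \<delta> (g ` X) \<le> \<delta> Z"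
    by (rule tight_minimal_transfer[OF _ le X(1,2) _ X(3)]) (use X in auto)
  have eX: "e ` V \<subseteq> X" using X(3) by (simp add: tight_def)
  have "e' ` V = g ` e ` V" unfolding image_image using g(2) by (intro image_cong) auto
  then have "e' ` V \<subseteq> g ` X" using eX by (simp add: image_mono)
  then have ss: "self_sufficient n m N X" "self_sufficient n m N (g ` X)"
    unfolding self_sufficient_def using X eX g(3) embedding_substrD(2)[OF g(1)] by auto
  have "sat N e \<phi> \<longleftrightarrow> sat N (g \<circ> e) \<phi>"
  proof (rule back_and_forth[where G="\<lambda>_. self_sufficient n m N" and X=X])
    show "\<exists>X' g. insert c X \<subseteq> X' \<and> embedding g (substr N X') N \<and> (\<forall>x\<in>X. g x = f x) \<and>
        self_sufficient n m N X' \<and> self_sufficient n m N (g ` X')"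
      if "self_sufficient n m N X" "self_sufficient n m N (f ` X)" "embedding f (substr N X) N"
         "c \<in> univ N" for X f c
      by (rule self_sufficient_extend[OF iso that])
  qed (use ss g(1) eX V(2) in \<open>auto simp: self_sufficient_def\<close>)
  also have "sat N (g \<circ> e) \<phi> \<longleftrightarrow> sat N e' \<phi>"
    by (rule sat_cong) (use g(2) V(2) in auto)
  finally show ?thesis .
qed

lemma sat_transfer_C0:
  assumes K: "K = class_C0 r n m" and V: "finite V" "fv \<phi> \<subseteq> V"
  shows "\<exists>k. \<forall>e e'. e ` V \<subseteq> univ N \<and> e' ` V \<subseteq> univ N \<and>
    tight_le n m N (\<lambda>c. c \<le> k) V e e' \<and> tight_le n m N (\<lambda>c. c \<le> k) V e' e \<longrightarrow>
    (sat N e \<phi> \<longleftrightarrow> sat N e' \<phi>)"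
proof -
  define bounds where "bounds \<kappa> s S \<longleftrightarrow> (\<forall>A. finite A \<and> A \<subseteq> univ N \<and> card A \<le> s \<longrightarrow>
    (\<exists>X. finite X \<and> X \<subseteq> univ N \<and> tight n m N A X \<and> card X + \<kappa> (card X) \<le> S \<and>
      (\<forall>Z. finite Z \<and> A \<subseteq> Z \<and> Z \<subseteq> univ N \<and> card Z \<le> card X + \<kappa> (card X) \<longrightarrow> \<delta> X \<le> \<delta> Z)))"
    for \<kappa> s S
  \<comment> \<open>A choice of the bounds from \<open>ex_relatively_minimal\<close>, made into a
    function so that \<open>depth\<close> can iterate them along the formula.\<close>
  define \<beta> where "\<beta> \<kappa> s = (SOME S. bounds \<kappa> s S)" for \<kappa> s
  have "bounds \<kappa> s (\<beta> \<kappa> s)" for \<kappa> s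
    unfolding \<beta>_def by (rule someI_ex) (unfold bounds_def, rule ex_relatively_minimal)
  then have \<beta>: "\<exists>X. finite X \<and> X \<subseteq> univ N \<and> tight n m N A X \<and> card X + \<kappa> (card X) \<le> \<beta> \<kappa> s \<and>
      (\<forall>Z. finite Z \<and> A \<subseteq> Z \<and> Z \<subseteq> univ N \<and> card Z \<le> card X + \<kappa> (card X) \<longrightarrow> \<delta> X \<le> \<delta> Z)"
    if "finite A" "A \<subseteq> univ N" "card A \<le> s" for \<kappa> s A
    using that unfolding bounds_def by simp
  have strong: "kstrong n m N c X"
    if "finite X" "X \<subseteq> univ N" "A \<subseteq> X"
      "\<And>Z. finite Z \<Longrightarrow> A \<subseteq> Z \<Longrightarrow> Z \<subseteq> univ N \<Longrightarrow> card Z \<le> card X + c \<Longrightarrow> \<delta> X \<le> \<delta> Z" for A X c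
    unfolding kstrong_def
  proof (intro conjI allI impI; (elim conjE)?)
    fix Z assume Z: "finite Z" "X \<subseteq> Z" "Z \<subseteq> univ N" "card (Z - X) \<le> c"
    have "card Z = card X + card (Z - X)" using Z that(1) by (metis card_Diff_subset card_mono le_add_diff_inverse)
    then show "\<delta> X \<le> \<delta> Z" using Z that by auto
  qed (use that in auto)
  define G where "G \<phi> X = kstrong n m N (depth \<beta> \<phi> (card X)) X" for \<phi> X
  \<comment> \<open>Bounds the size of a hull of the tuple plus the strength demanded of it, so
    tight sets of size up to \<open>k\<close> suffice both to copy the hull and to test the strength
    of the copy.\<close>
  define k where "k = \<beta> (depth \<beta> \<phi>) (card V)"
  show ?thesis
  proof (intro exI[of _ k] allI impI; elim conjE)
    fix e e' assume e: "e ` V \<subseteq> univ N" "e' ` V \<subseteq> univ N"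
      and le: "tight_le n m N (\<lambda>c. c \<le> k) V e e'" "tight_le n m N (\<lambda>c. c \<le> k) V e' e"
    obtain X where X: "finite X" "X \<subseteq> univ N" "tight n m N (e ` V) X"
      "card X + depth \<beta> \<phi> (card X) \<le> k"
      "\<And>Z. finite Z \<Longrightarrow> e ` V \<subseteq> Z \<Longrightarrow> Z \<subseteq> univ N \<Longrightarrow> card Z \<le> card X + depth \<beta> \<phi> (card X) \<Longrightarrow> \<delta> X \<le> \<delta> Z"
      using \<beta>[of "e ` V" "card V" "depth \<beta> \<phi>"] V e card_image_le[OF V(1), of e] unfolding k_def by auto
    let ?Q = "\<lambda>c. c \<le> card X + depth \<beta> \<phi> (card X)"
    have le': "tight_le n m N ?Q V e e'" "tight_le n m N ?Q V e' e"
      using le X(4) unfolding tight_le_def by (meson order_trans)+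
    obtain g where g: "embedding g (substr N X) N" "\<And>v. v \<in> V \<Longrightarrow> g (e v) = e' v"
      "\<And>Z. finite Z \<Longrightarrow> e' ` V \<subseteq> Z \<Longrightarrow> Z \<subseteq> univ N \<Longrightarrow> ?Q (card Z) \<Longrightarrow> \<delta> (g ` X) \<le> \<delta> Z"
      by (rule tight_minimal_transfer[OF _ le' X(1,2) _ X(3)]) (use X in auto)
    have eX: "e ` V \<subseteq> X" using X(3) by (simp add: tight_def)
    have "e' ` V = g ` e ` V" unfolding image_image using g(2) by (intro image_cong) auto
    then have e'X: "e' ` V \<subseteq> g ` X" using eX by (simp add: image_mono)
    have cX: "card (g ` X) = card X" using card_image_embedding[OF g(1)] by simp
    have GX: "G \<phi> X" "G \<phi> (g ` X)"
      unfolding G_def using X eX e'X g(3) cX embedding_substrD(2)[OF g(1)]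
      by (auto intro!: strong[of X "e ` V"] strong[of "g ` X" "e' ` V"])
    have "sat N e \<phi> \<longleftrightarrow> sat N (g \<circ> e) \<phi>"
    proof (rule back_and_forth[where G=G and X=X])
      fix v \<psi> X f c
      assume G: "G (form.Ex v \<psi>) X" "G (form.Ex v \<psi>) (f ` X)" and emb: "embedding f (substr N X) N"
        and c: "c \<in> univ N"
      have Xu: "finite X" "X \<subseteq> univ N" using G(1) by (auto simp: G_def kstrong_def)
      have cX: "card (f ` X) = card X" using card_image_embedding[OF emb] by simp
      \<comment> \<open>The new point accounts for \<open>Suc\<close> in \<open>depth\<close>. The
        resulting bound covers the growth from \<open>X\<close> to \<open>X'\<close> together with
        the strength asked of \<open>X'\<close>.\<close>
      have "card (insert c X) \<le> Suc (card X)" by (rule card_insert_le_m1) auto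
      then obtain X' where X': "finite X'" "X' \<subseteq> univ N" "tight n m N (insert c X) X'"
        "card X' + depth \<beta> \<psi> (card X') \<le> \<beta> (depth \<beta> \<psi>) (Suc (card X))"
        "\<And>Z. finite Z \<Longrightarrow> insert c X \<subseteq> Z \<Longrightarrow> Z \<subseteq> univ N \<Longrightarrow> card Z \<le> card X' + depth \<beta> \<psi> (card X') \<Longrightarrow> \<delta> X' \<le> \<delta> Z"
        using \<beta>[of "insert c X" "Suc (card X)" "depth \<beta> \<psi>"] Xu c by auto
      have sub: "insert c X \<subseteq> X'" using X'(3) by (simp add: tight_def)
      have GX': "kstrong n m N (depth \<beta> \<psi> (card X')) X'"
        by (rule strong[OF X'(1,2) sub X'(5)])
      have "\<exists>g. embedding g (substr N X') N \<and> (\<forall>x\<in>X. g x = f x) \<and> kstrong n m N (depth \<beta> \<psi> (card X')) (g ` X')"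
      proof (rule kstrong_extend[OF K _ _ emb _ _ GX'])
        show "kstrong n m N (\<beta> (depth \<beta> \<psi>) (Suc (card X))) X"
          "kstrong n m N (\<beta> (depth \<beta> \<psi>) (Suc (card X))) (f ` X)" using G cX by (auto simp: G_def)
        show "card (X' - X) \<le> \<beta> (depth \<beta> \<psi>) (Suc (card X))"
          using X'(4) card_mono[of X' "X' - X"] X'(1) by auto
      qed (use X'(4) sub in auto)
      then obtain g where "embedding g (substr N X') N" "\<forall>x\<in>X. g x = f x"
          "kstrong n m N (depth \<beta> \<psi> (card X')) (g ` X')" by blast
      moreover from this have "card (g ` X') = card X'" using card_image_embedding by fastforce
      ultimately show "\<exists>X' g. insert c X \<subseteq> X' \<and> embedding g (substr N X') N \<and> (\<forall>x\<in>X. g x = f x) \<and>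
        G \<psi> X' \<and> G \<psi> (g ` X')"
        using sub GX' by (intro exI[of _ X'] exI[of _ g]) (simp add: G_def)
    qed (use GX g(1) eX V(2) in \<open>auto simp: G_def kstrong_def\<close>)
    also have "sat N (g \<circ> e) \<phi> \<longleftrightarrow> sat N e' \<phi>"
      by (rule sat_cong) (use g(2) V(2) in auto)
    finally show "sat N e \<phi> \<longleftrightarrow> sat N e' \<phi>" .
  qed
qed

end

section \<open>Diagrams and saturation\<close>

text \<open>The element \<open>z\<close> of \<open>Z\<close> is represented by the variable \<open>b + z\<close>.\<close>

definition diagram :: "nat \<Rightarrow> nat struct \<Rightarrow> nat \<Rightarrow> nat list \<Rightarrow> (nat \<Rightarrow> nat) \<Rightarrow> nat set \<Rightarrow> form" where
  "diagram r N b vs e Z = (let zs = sorted_list_of_set Z in exs (map ((+) b) zs) (conjs (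
     map (\<lambda>v. Eq v (b + e v)) vs @
     map (\<lambda>(x, y). Neg (Eq (b + x) (b + y))) (filter (\<lambda>(x, y). x \<noteq> y) (List.product zs zs)) @
     map (\<lambda>xs. if xs \<in> rel N then Rel (map ((+) b) xs) else Neg (Rel (map ((+) b) xs))) (List.n_lists r zs))))"

lemma r_form_diagram: "finite Z \<Longrightarrow> r_form r (diagram r N b vs e Z)"
  by (auto simp: diagram_def Let_def set_n_lists)

lemma fv_diagram: "finite Z \<Longrightarrow> e ` set vs \<subseteq> Z \<Longrightarrow> fv (diagram r N b vs e Z) \<subseteq> set vs"
  by (fastforce simp: diagram_def Let_def set_n_lists split: if_splits)

text \<open>All variables in \<open>vs\<close> lie below \<open>b\<close>, so quantifying over the
  variables \<open>b + z\<close> leaves the values of the tuple untouched.\<close>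

lemma sat_diagram:
  assumes N: "r_struct r N" and M: "r_struct r M"
    and Z: "finite Z" "e ` set vs \<subseteq> Z" and b: "\<forall>v\<in>set vs. v < b"
  shows "sat M e' (diagram r N b vs e Z) \<longleftrightarrow>
    (\<exists>g. embedding g (substr N Z) M \<and> (\<forall>v\<in>set vs. g (e v) = e' v))"
proof -
  define \<psi> where "\<psi> d \<longleftrightarrow> (\<forall>v\<in>set vs. d v = d (b + e v)) \<and>
     (\<forall>x\<in>Z. \<forall>y\<in>Z. x \<noteq> y \<longrightarrow> d (b + x) \<noteq> d (b + y)) \<and>
     (\<forall>xs. length xs = r \<and> set xs \<subseteq> Z \<longrightarrow> (map (\<lambda>x. d (b + x)) xs \<in> rel M \<longleftrightarrow> xs \<in> rel N))" for d :: "nat \<Rightarrow> 'a"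
  have lit: "sat M d (if P then f else Neg f) \<longleftrightarrow> (sat M d f \<longleftrightarrow> P)" for d P f by simp
  have "sat M e' (diagram r N b vs e Z) \<longleftrightarrow> (\<exists>d. varies M e' ((+) b ` Z) d \<and> \<psi> d)"
    unfolding diagram_def Let_def sat_exs sat_conjs \<psi>_def using Z(1)
    by (simp add: ball_Un lit set_n_lists o_def conj_assoc if_distrib[of "sat M _"]) (auto 0 3)
  also have "\<dots> \<longleftrightarrow> (\<exists>g. embedding g (substr N Z) M \<and> (\<forall>v\<in>set vs. g (e v) = e' v))"
  proof
    assume "\<exists>d. varies M e' ((+) b ` Z) d \<and> \<psi> d"
    then obtain d where d: "varies M e' ((+) b ` Z) d" "\<psi> d" by blast
    define g where "g x = d (b + x)" for x
    have "embedding g (substr N Z) M"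
    proof (rule embedding_substrI)
      show "inj_on g Z" using d(2) by (auto simp: \<psi>_def g_def inj_on_def)
      show "g ` Z \<subseteq> univ M" using d(1) by (auto simp: varies_def g_def)
      fix xs assume xs: "set xs \<subseteq> Z"
      show "map g xs \<in> rel M \<longleftrightarrow> xs \<in> rel N"
      \<comment> \<open>The diagram speaks only of lists of length \<open>r\<close>; other lists lie
        in neither relation.\<close>
      proof (cases "length xs = r")
        case True
        then show ?thesis using d(2) xs unfolding \<psi>_def g_def by blast
      next
        case False
        then show ?thesis using N M by (auto simp: r_struct_def)
      qed
    qed
    moreover have "g (e v) = e' v" if v: "v \<in> set vs" for v
    proof -
      have "v \<notin> (+) b ` Z" using b v by auto
      then show ?thesis using d v by (auto simp: \<psi>_def g_def varies_def)
    qed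
    ultimately show "\<exists>g. embedding g (substr N Z) M \<and> (\<forall>v\<in>set vs. g (e v) = e' v)" by blast
  next
    assume "\<exists>g. embedding g (substr N Z) M \<and> (\<forall>v\<in>set vs. g (e v) = e' v)"
    then obtain g where g: "embedding g (substr N Z) M" "\<forall>v\<in>set vs. g (e v) = e' v" by blast
    define d where "d u = (if u \<in> (+) b ` Z then g (u - b) else e' u)" for u
    have db: "d (b + x) = g x" if "x \<in> Z" for x using that by (simp add: d_def)
    have "varies M e' ((+) b ` Z) d"
      using embedding_substrD(2)[OF g(1)] by (auto simp: varies_def d_def)
    moreover have "\<psi> d"
      unfolding \<psi>_def
    proof (intro conjI ballI allI impI; (elim conjE)?)
      fix v assume v: "v \<in> set vs"
      have "v \<notin> (+) b ` Z" using b v by auto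
      then have "d v = e' v" by (simp add: d_def)
      moreover have "e v \<in> Z" using Z(2) v by auto
      ultimately show "d v = d (b + e v)" using g(2) v db by simp
    next
      fix x y assume "x \<in> Z" "y \<in> Z" "x \<noteq> y"
      then show "d (b + x) \<noteq> d (b + y)" using embedding_substrD(1)[OF g(1)] by (simp add: db inj_on_eq_iff)
    next
      fix xs assume xs: "set xs \<subseteq> Z"
      then have "map (\<lambda>x. d (b + x)) xs = map g xs" using db by auto
      then show "map (\<lambda>x. d (b + x)) xs \<in> rel M \<longleftrightarrow> xs \<in> rel N"
        using embedding_substrD(3)[OF g(1) xs] by (simp only:)
    qed
    ultimately show "\<exists>d. varies M e' ((+) b ` Z) d \<and> \<psi> d" by blast
  qed
  finally show ?thesis .
qed

context generic_hypergraph
begin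

text \<open>Compactness: if no \<open>k\<close> worked, saturation would realize a limit of the
  counterexamples, a pair of tuples with the same tight extensions of every finite size that still
  differ on \<open>\<phi>\<close>. This contradicts
  \<open>sat_transfer_self_sufficient\<close>.\<close>

lemma sat_transfer_saturated:
  assumes iso: "\<And>A f B. A \<in> K \<Longrightarrow> r_struct r B \<Longrightarrow> isomorphism f A B \<Longrightarrow> B \<in> K"
    and saturated: "omega_saturated r N" and nonempty: "univ N \<noteq> {}"
    and V: "finite V" "fv \<phi> \<subseteq> V" and \<phi>: "r_form r \<phi>"
  shows "\<exists>k. \<forall>e e'. e ` V \<subseteq> univ N \<and> e' ` V \<subseteq> univ N \<and>
    tight_le n m N (\<lambda>c. c \<le> k) V e e' \<and> tight_le n m N (\<lambda>c. c \<le> k) V e' e \<longrightarrow>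
    (sat N e \<phi> \<longleftrightarrow> sat N e' \<phi>)"
proof (rule ccontr)
  assume neg: "\<not> ?thesis"
  have N: "r_struct r N" using hypergraph_N by (simp add: hypergraph_def)
  have diff: "\<exists>e e'. e ` V \<subseteq> univ N \<and> e' ` V \<subseteq> univ N \<and>
    tight_le n m N (\<lambda>c. c \<le> k) V e e' \<and> tight_le n m N (\<lambda>c. c \<le> k) V e' e \<and>
    sat N e \<phi> \<and> \<not> sat N e' \<phi>" for k
  proof -
    obtain e e' where "e ` V \<subseteq> univ N \<and> e' ` V \<subseteq> univ N \<and>
      tight_le n m N (\<lambda>c. c \<le> k) V e e' \<and> tight_le n m N (\<lambda>c. c \<le> k) V e' e"
      "sat N e \<phi> \<noteq> sat N e' \<phi>" using neg by blast
    \<comment> \<open>The conditions are symmetric in the two assignments, so these may be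
      exchanged.\<close>
    then show ?thesis by (cases "sat N e \<phi>") blast+
  qed
  obtain vs where vs: "set vs = V" using finite_list[OF V(1)] by blast
  define b where "b = Suc (Max (insert 0 V))"
  have b: "\<forall>v\<in>set vs. v < b"
    using V(1) vs by (auto simp: b_def less_Suc_eq_le)
  \<comment> \<open>Even variables carry the first tuple of a pair and odd variables the second, so
    that a pair is a single assignment.\<close>
  have inj: "inj ((*) (2 :: nat))" "inj (\<lambda>v :: nat. Suc (2 * v))" by (auto simp: inj_def)
  let ?l = "ren ((*) 2)" and ?r = "ren (\<lambda>v. Suc (2 * v))"
  let ?imp = "\<lambda>\<psi> \<theta>. Neg (Conj \<psi> (Neg \<theta>))"
  define \<Psi> where "\<Psi> k = {diagram r N b vs e Z | e Z. finite Z \<and> Z \<subseteq> univ N \<and> tight n m N (e ` V) Z \<and> card Z \<le> k}"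
    for k
  define p where "p k = {?l \<phi>, Neg (?r \<phi>)} \<union> (\<lambda>\<psi>. ?imp (?l \<psi>) (?r \<psi>)) ` \<Psi> k \<union> (\<lambda>\<psi>. ?imp (?r \<psi>) (?l \<psi>)) ` \<Psi> k"
    for k
  have \<Psi>: "r_form r \<psi>" "fv \<psi> \<subseteq> V" if \<psi>: "\<psi> \<in> \<Psi> k" for \<psi> k
  proof -
    obtain e Z where Z: "\<psi> = diagram r N b vs e Z" "finite Z" "tight n m N (e ` V) Z"
      using \<psi> unfolding \<Psi>_def by blast
    then have sub: "e ` set vs \<subseteq> Z" using vs by (simp add: tight_def)
    show "r_form r \<psi>" unfolding Z(1) by (rule r_form_diagram[OF Z(2)])
    show "fv \<psi> \<subseteq> V" using fv_diagram[OF Z(2) sub] unfolding Z(1) vs .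
  qed
  \<comment> \<open>A diagram true at \<open>e\<close> yields a copy of its set that is tight over
    the values of \<open>e\<close>; \<open>tight_le\<close> carries this copy on to
    \<open>e'\<close>.\<close>
  have \<Psi>_transfer: "sat N e' \<psi>" if le: "tight_le n m N (\<lambda>c. c \<le> k) V e e'" and \<psi>: "\<psi> \<in> \<Psi> k" and s: "sat N e \<psi>"
    for e e' \<psi> k
  proof -
    obtain e0 Z where Z: "\<psi> = diagram r N b vs e0 Z" "finite Z" "Z \<subseteq> univ N" "tight n m N (e0 ` V) Z" "card Z \<le> k"
      using \<psi> unfolding \<Psi>_def by blast
    have e0: "e0 ` set vs \<subseteq> Z" using Z(4) vs by (simp add: tight_def)
    note sat = sat_diagram[OF N N Z(2) e0 b]
    obtain g where g: "embedding g (substr N Z) N" "\<forall>v\<in>V. g (e0 v) = e v"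
      using s unfolding Z(1) sat vs by blast
    have "g ` e0 ` V = e ` V" unfolding image_image using g(2) by (intro image_cong) auto
    then have "tight n m N (e ` V) (g ` Z)" using tight_image[OF g(1) Z(4)] by simp
    moreover have "finite (g ` Z)" "g ` Z \<subseteq> univ N" "card (g ` Z) \<le> k"
      using Z(2,5) embedding_substrD(2)[OF g(1)] card_image_embedding[OF g(1), of Z] by auto
    ultimately obtain h where h: "embedding h (substr N (g ` Z)) N" "\<forall>v\<in>V. h (e v) = e' v"
      using le unfolding tight_le_def by blast
    have "embedding (h \<circ> g) (substr N Z) N"
      by (rule embedding_comp[OF embedding_into_substr[OF g(1)] h(1)]) simp
    then show ?thesis unfolding Z(1) sat vs using g(2) h(2) by (intro exI[of _ "h \<circ> g"]) simp
  qed
  define U where "U = (*) 2 ` V \<union> (\<lambda>v. Suc (2 * v)) ` V"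
  obtain us where us: "set us = U" using finite_list[of U] V(1) by (auto simp: U_def)
  obtain c where c: "c \<in> univ N" using nonempty by blast
  have "\<Psi> j \<subseteq> \<Psi> k" if "j \<le> k" for j k
    unfolding \<Psi>_def using order_trans[OF _ that] by blast
  then have mono: "mono p"
    unfolding p_def by (intro monoI Un_mono image_mono subset_refl)
  have "\<exists>d. varies N (\<lambda>_. c) (set us) d \<and> (\<forall>\<psi>\<in>(\<Union>k. p k). sat N d \<psi>)"
  proof (rule omega_saturated_varies[OF saturated, of "{}"])
    have ren: "fv (?l \<theta>) \<subseteq> U" "fv (?r \<theta>) \<subseteq> U" if "fv \<theta> \<subseteq> V" for \<theta>
      using that unfolding fv_ren[OF inj(1)] fv_ren[OF inj(2)] U_def by blast+
    fix \<psi> assume "\<psi> \<in> (\<Union>k. p k)"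
    then consider "\<psi> = ?l \<phi>" | "\<psi> = Neg (?r \<phi>)"
      | k \<theta> where "\<theta> \<in> \<Psi> k" "\<psi> = ?imp (?l \<theta>) (?r \<theta>) \<or> \<psi> = ?imp (?r \<theta>) (?l \<theta>)"
      unfolding p_def by blast
    then show "r_form r \<psi> \<and> fv \<psi> \<subseteq> set us \<union> {}"
    proof cases
      case 3
      then show ?thesis using \<Psi>[OF 3(1)] ren[OF \<Psi>(2)[OF 3(1)]] us by auto
    qed (use ren[OF V(2)] \<phi> us in auto)
  next
    fix q assume q: "q \<subseteq> (\<Union>k. p k)" "finite q"
    obtain k where k: "q \<subseteq> p k" using finite_subset_mono_UN[OF mono q(2,1)] by blast
    obtain e e' where e: "e ` V \<subseteq> univ N" "e' ` V \<subseteq> univ N"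
      "tight_le n m N (\<lambda>c. c \<le> k) V e e'" "tight_le n m N (\<lambda>c. c \<le> k) V e' e"
      "sat N e \<phi>" "\<not> sat N e' \<phi>" using diff[of k] by blast
    define d where "d u = (if u \<in> U then if even u then e (u div 2) else e' (u div 2) else c)" for u
    have d0: "d (2 * v) = e v" "d (Suc (2 * v)) = e' v" if "v \<in> V" for v
      using that by (auto simp: d_def U_def)
    have "varies N (\<lambda>_. c) U d"
      unfolding varies_def using e(1,2) by (auto simp: U_def d_def)
    moreover have "sat N d (?l \<psi>) \<longleftrightarrow> sat N e \<psi>" if "fv \<psi> \<subseteq> V" for \<psi>
      unfolding sat_ren[OF inj(1)] by (rule sat_cong) (use that d0 in auto)
    moreover have "sat N d (?r \<psi>) \<longleftrightarrow> sat N e' \<psi>" if "fv \<psi> \<subseteq> V" for \<psi>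
      unfolding sat_ren[OF inj(2)] by (rule sat_cong) (use that d0 in auto)
    ultimately have "\<forall>\<psi>\<in>p k. sat N d \<psi>"
      using e V(2) \<Psi>(2) \<Psi>_transfer[OF e(3)] \<Psi>_transfer[OF e(4)] unfolding p_def by auto
    then show "\<exists>d. varies N (\<lambda>_. c) (set us) d \<and> (\<forall>\<psi>\<in>q. sat N d \<psi>)"
      using k \<open>varies N (\<lambda>_. c) U d\<close> us by blast
  qed (use c in auto)
  then obtain d where d: "varies N (\<lambda>_. c) U d" "\<And>\<psi> k. \<psi> \<in> p k \<Longrightarrow> sat N d \<psi>" unfolding us by blast
  define e where "e = d \<circ> (*) 2"
  define e' where "e' = d \<circ> (\<lambda>v. Suc (2 * v))"
  have eV: "e ` V \<subseteq> univ N" "e' ` V \<subseteq> univ N"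
    using d(1) by (auto simp: e_def e'_def varies_def U_def)
  have \<phi>ee: "sat N e \<phi>" "\<not> sat N e' \<phi>"
    using d(2)[of "?l \<phi>"] d(2)[of "Neg (?r \<phi>)"] by (auto simp: p_def sat_ren[OF inj(1)] sat_ren[OF inj(2)] e_def e'_def)
  have \<Psi>ee: "sat N e \<psi> \<longleftrightarrow> sat N e' \<psi>" if "\<psi> \<in> \<Psi> k" for \<psi> k
    using d(2)[of "?imp (?l \<psi>) (?r \<psi>)" k] d(2)[of "?imp (?r \<psi>) (?l \<psi>)" k] that
    by (auto simp: p_def sat_ren[OF inj(1)] sat_ren[OF inj(2)] e_def e'_def)
  have le: "tight_le n m N (\<lambda>_. True) V d1 d2"
    if ee: "\<And>\<psi> k. \<psi> \<in> \<Psi> k \<Longrightarrow> sat N d1 \<psi> \<Longrightarrow> sat N d2 \<psi>" for d1 d2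
    unfolding tight_le_def
  proof (intro allI impI; elim conjE)
    fix Z assume Z: "finite Z" "Z \<subseteq> univ N" "tight n m N (d1 ` V) Z"
    have sub: "d1 ` set vs \<subseteq> Z" using Z(3) vs by (simp add: tight_def)
    note sat = sat_diagram[OF N N Z(1) sub b]
    have "embedding id (substr N Z) N" using Z(2) by (intro embedding_substrI) auto
    then have "sat N d1 (diagram r N b vs d1 Z)" unfolding sat by (intro exI[of _ id]) simp
    moreover have "diagram r N b vs d1 Z \<in> \<Psi> (card Z)" unfolding \<Psi>_def using Z by blast
    ultimately have "sat N d2 (diagram r N b vs d1 Z)" by (rule ee[rotated])
    then show "\<exists>g. embedding g (substr N Z) N \<and> (\<forall>v\<in>V. g (d1 v) = d2 v)" unfolding sat vs .
  qed
  have "sat N e \<phi> \<longleftrightarrow> sat N e' \<phi>"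
    by (rule sat_transfer_self_sufficient[OF iso V eV(1)]) (use \<Psi>ee in \<open>auto intro!: le\<close>)
  then show False using \<phi>ee by simp
qed

end

section \<open>Orientations\<close>

text \<open>Induction on the size of \<open>I\<close> as in the proof of Halmos and Vaughan: a
  critical proper subfamily is matched by itself and its values are withheld from the rest; if there
  is none, every nonempty proper subfamily has a value to spare.\<close>

lemma Hall:
  fixes A :: "'i \<Rightarrow> 'b set"
  assumes "finite I" "\<And>i. i \<in> I \<Longrightarrow> finite (A i)"
    and "\<And>J. J \<subseteq> I \<Longrightarrow> card J \<le> card (\<Union>(A ` J))"
  shows "\<exists>f. inj_on f I \<and> (\<forall>i\<in>I. f i \<in> A i)"
  using assms
proof (induction "card I" arbitrary: I A rule: less_induct)
  case less
  note fin = less.prems(1) and finA = less.prems(2) and hall = less.prems(3)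
  have finU: "finite (\<Union>(A ` J))" if "J \<subseteq> I" for J
    using that fin finA by (auto intro: finite_subset)
  show ?case
  proof (cases "\<exists>J. J \<noteq> {} \<and> J \<subset> I \<and> card (\<Union>(A ` J)) = card J")
    case True
    then obtain J where J: "J \<noteq> {}" "J \<subset> I" "card (\<Union>(A ` J)) = card J" by blast
    have finJ: "finite J" using J(2) fin by (auto intro: finite_subset)
    have "\<exists>f. inj_on f J \<and> (\<forall>i\<in>J. f i \<in> A i)"
    proof (rule less.hyps)
      show "card J < card I" using J(2) fin by (rule psubset_card_mono[rotated])
    qed (use J(2) finJ finA hall in auto)
    then obtain f where f: "inj_on f J" "\<forall>i\<in>J. f i \<in> A i" by blast
    have "\<exists>g. inj_on g (I - J) \<and> (\<forall>i\<in>I - J. g i \<in> A i - \<Union>(A ` J))"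
    proof (rule less.hyps)
      show "card (I - J) < card I" using J(1,2) fin by (intro psubset_card_mono) auto
      fix L assume L: "L \<subseteq> I - J"
      have finL: "finite L" using L fin by (auto intro: finite_subset)
      have "card L + card J = card (L \<union> J)" using L finL finJ by (intro card_Un_disjoint[symmetric]) auto
      also have "\<dots> \<le> card (\<Union>(A ` (L \<union> J)))" using L J(2) by (intro hall) auto
      also have "\<Union>(A ` (L \<union> J)) = (\<Union>i\<in>L. A i - \<Union>(A ` J)) \<union> \<Union>(A ` J)" by auto
      also have "card \<dots> \<le> card (\<Union>i\<in>L. A i - \<Union>(A ` J)) + card (\<Union>(A ` J))" by (rule card_Un_le)
      finally show "card L \<le> card (\<Union>i\<in>L. A i - \<Union>(A ` J))" using J(3) by simp
    qed (use fin finA in auto)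
    then obtain g where g: "inj_on g (I - J)" "\<forall>i\<in>I - J. g i \<in> A i - \<Union>(A ` J)" by blast
    let ?h = "\<lambda>i. if i \<in> J then f i else g i"
    have "f i \<noteq> g j" if "i \<in> J" "j \<in> I - J" for i j using that f(2) g(2) by force
    then have "inj_on ?h I" using f(1) g(1) by (simp add: inj_on_def) metis
    moreover have "\<forall>i\<in>I. ?h i \<in> A i" using f(2) g(2) by auto
    ultimately show ?thesis by blast
  next
    case False
    show ?thesis
    proof (cases "I = {}")
      case True
      then show ?thesis by simp
    next
      case ne: False
      then obtain i where i: "i \<in> I" by blast
      have "1 \<le> card (A i)" using hall[of "{i}"] i by simp
      then obtain x where x: "x \<in> A i" by fastforce
      have "\<exists>f. inj_on f (I - {i}) \<and> (\<forall>j\<in>I - {i}. f j \<in> A j - {x})"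
      proof (rule less.hyps)
        show "card (I - {i}) < card I" using i fin by (intro psubset_card_mono) auto
        fix J assume J: "J \<subseteq> I - {i}"
        show "card J \<le> card (\<Union>j\<in>J. A j - {x})"
        proof (cases "J = {}")
          case nonempty: False
          have "J \<subset> I" using J i by blast
          then have "card J < card (\<Union>(A ` J))"
            using False nonempty hall[of J] by (metis le_neq_implies_less psubset_imp_subset)
          moreover have "(\<Union>j\<in>J. A j - {x}) = \<Union>(A ` J) - {x}" by auto
          ultimately show ?thesis
            using finU[of J] J by (metis Diff_insert0 Diff_empty One_nat_def Suc_leI card_Diff_singleton_if diff_Suc_1 diff_le_mono less_imp_le)
        qed simp
      qed (use fin finA in auto)
      then obtain f where f: "inj_on f (I - {i})" "\<forall>j\<in>I - {i}. f j \<in> A j - {x}" by blast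
      have "inj_on (f(i := x)) I" using f by (auto simp: inj_on_def)
      moreover have "\<forall>j\<in>I. (f(i := x)) j \<in> A j" using f(2) x by auto
      ultimately show ?thesis by blast
    qed
  qed
qed

text \<open>Hall's condition for a set Q of new edges is the strength of \<open>A\<close>: that the
  predimension does not drop on adding \<Union>Q gives m|Q| \<le> n|\<Union>Q - A|. Charges avoid
  \<open>A\<close>, so the layers of a chain do not interfere.\<close>

lemma finite_orientation:
  assumes B: "finite B" "A \<subseteq> B"
    and strong: "\<And>S. A \<subseteq> S \<Longrightarrow> S \<subseteq> B \<Longrightarrow> predim n m (substr N A) \<le> predim n m (substr N S)"
  shows "\<exists>\<sigma>. inj_on \<sigma> ((edges N B - edges N A) \<times> {..<m}) \<and>
    (\<forall>e\<in>edges N B - edges N A. \<forall>u<m. \<sigma> (e, u) \<in> (e - A) \<times> {..<n})"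
proof -
  let ?I = "(edges N B - edges N A) \<times> {..<m}" and ?A = "\<lambda>p. (fst p - A) \<times> {..<n}"
  have "\<exists>\<sigma>. inj_on \<sigma> ?I \<and> (\<forall>p\<in>?I. \<sigma> p \<in> ?A p)"
  proof (rule Hall)
    show "finite ?I" using B by simp
    show "finite (?A p)" if "p \<in> ?I" for p
      using that finite_subset[OF _ B(1), of "fst p"] by (auto simp: edges_def)
    fix J assume J: "J \<subseteq> ?I"
    define Q where "Q = fst ` J"
    have Q: "Q \<subseteq> edges N B - edges N A" using J by (auto simp: Q_def)
    have QB: "\<Union>Q \<subseteq> B" using Q by (auto simp: edges_def)
    have finQ: "finite Q" "finite (\<Union>Q)" "finite A"
      using Q QB B by (auto intro: finite_subset[OF _ finite_edges[OF B(1)]] finite_subset)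
    have "J \<subseteq> Q \<times> {..<m}" using J by (force simp: Q_def)
    then have 1: "card J \<le> card Q * m"
      using finQ card_mono[of "Q \<times> {..<m}" J] by (simp add: card_cartesian_product)
    have "\<Union>(?A ` J) = (\<Union>Q - A) \<times> {..<n}" by (auto simp: Q_def)
    then have 2: "card (\<Union>(?A ` J)) = card (\<Union>Q - A) * n" by (simp add: card_cartesian_product)
    let ?S = "A \<union> \<Union>Q"
    have "card (edges N A) + card Q = card (edges N A \<union> Q)"
      using Q finQ by (intro card_Un_disjoint[symmetric]) auto
    also have "\<dots> \<le> card (edges N ?S)"
      using Q finQ by (intro card_mono) (auto simp: edges_def)
    finally have "int m * (int (card (edges N A)) + int (card Q)) \<le> int m * int (card (edges N ?S))"
      by (intro mult_left_mono) linarith+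
    moreover have "card ?S = card A + card (\<Union>Q - A)"
      using finQ by (metis Un_Diff_cancel card_Un_disjoint Diff_disjoint finite_Diff)
    moreover have "predim n m (substr N A) \<le> predim n m (substr N ?S)"
      using QB B(2) by (intro strong) auto
    ultimately have "int m * int (card Q) \<le> int n * int (card (\<Union>Q - A))"
      unfolding predim_substr by (simp add: algebra_simps)
    then have "m * card Q \<le> n * card (\<Union>Q - A)" by (metis of_nat_le_iff of_nat_mult)
    then show "card J \<le> card (\<Union>(?A ` J))" using 1 2 by (simp add: mult.commute)
  qed
  then show ?thesis by (metis (no_types, lifting) SigmaI fst_conv lessThan_iff)
qed

context generic_hypergraph
begin

text \<open>Each edge is charged in the layer of the generic chain in which it is completed, to
  points that are new in that layer.\<close>

lemma orientation:
  assumes r: "1 \<le> r"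
  shows "\<exists>\<sigma>. inj_on \<sigma> (hyperedges N \<times> {..<m}) \<and> (\<forall>e\<in>hyperedges N. \<forall>u<m. \<sigma> (e, u) \<in> e \<times> {..<n})"
proof -
  obtain F :: "nat \<Rightarrow> nat set" where F': "(\<Union>i. F i) = univ N"
    "\<forall>i. F i \<subseteq> F (Suc i) \<and> self_sufficient n m (substr N (F (Suc i))) (F i) \<and>
             self_sufficient n m N (F i) \<and> substr N (F i) \<in> K"
    using generic unfolding generic_structure_def by (elim conjE exE)
  then have F: "\<And>i. F i \<subseteq> F (Suc i)" "\<And>i. self_sufficient n m N (F i)" by simp_all
  \<comment> \<open>Prefixing the empty set makes the edges inside \<open>F 0\<close> a layer too.
    The empty set is self-sufficient because predimensions are nonnegative.\<close>
  define G where "G i = (case i of 0 \<Rightarrow> {} | Suc j \<Rightarrow> F j)" for i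
  have G0: "G 0 = {}" and GS: "G (Suc i) = F i" for i by (simp_all add: G_def)
  have Gstep: "G i \<subseteq> G (Suc i)" for i using F(1) by (cases i) (auto simp: G0 GS)
  then have mono: "mono G" by (simp add: mono_iff_le_Suc)
  have Gfin: "finite (G i)" "G i \<subseteq> univ N" for i
    using F(2) by (cases i; auto simp: G0 GS self_sufficient_def)+
  have Gss: "self_sufficient n m N (G i)" for i
  proof (cases i)
    case 0
    have "\<delta> {} \<le> 0" by (simp add: predim_substr)
    then have "\<delta> {} \<le> \<delta> B" if "finite B" "B \<subseteq> univ N" for B
      using nonneg[OF that] by (rule order_trans)
    then show ?thesis using 0 by (simp add: G0 self_sufficient_def)
  qed (simp add: GS F(2))
  have "\<exists>\<sigma>. inj_on \<sigma> ((edges N (G (Suc i)) - edges N (G i)) \<times> {..<m}) \<and>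
    (\<forall>e\<in>edges N (G (Suc i)) - edges N (G i). \<forall>u<m. \<sigma> (e, u) \<in> (e - G i) \<times> {..<n})" for i
  proof (rule finite_orientation)
    show "\<delta> (G i) \<le> \<delta> S" if "G i \<subseteq> S" "S \<subseteq> G (Suc i)" for S
      by (rule self_sufficientD[OF Gss]) (use that Gfin[of "Suc i"] in \<open>auto intro: finite_subset\<close>)
  qed (use Gfin Gstep in auto)
  then obtain \<sigma> where \<sigma>: "\<And>i. inj_on (\<sigma> i) ((edges N (G (Suc i)) - edges N (G i)) \<times> {..<m})"
    "\<And>i e u. e \<in> edges N (G (Suc i)) - edges N (G i) \<Longrightarrow> u < m \<Longrightarrow> \<sigma> i (e, u) \<in> (e - G i) \<times> {..<n}"
    by metis
  define level where "level e = (LEAST i. e \<subseteq> G (Suc i))" for e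
  have level: "e \<in> edges N (G (Suc (level e))) - edges N (G (level e))" if e: "e \<in> hyperedges N" for e
  proof -
    obtain xs where xs: "xs \<in> rel N" "e = set xs" using e by (auto simp: hyperedges_def)
    then have l: "length xs = r" "set xs \<subseteq> univ N"
      using hypergraph_N by (auto simp: hypergraph_def r_struct_def)
    have "mono F" using F(1) by (simp add: mono_iff_le_Suc)
    then obtain i where "e \<subseteq> F i"
      using finite_subset_mono_UN[of F e] l xs(2) F'(1) by auto
    then have 1: "e \<subseteq> G (Suc (level e))"
      unfolding level_def using LeastI[of "\<lambda>i. e \<subseteq> G (Suc i)" i] by (simp add: GS)
    have "\<not> e \<subseteq> G (level e)"
    proof (cases "level e")
      case 0
      \<comment> \<open>An empty edge would already lie in \<open>G 0\<close>; positivity of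
        \<open>r\<close> excludes it.\<close>
      have "e \<noteq> {}" using l(1) xs(2) r by auto
      then show ?thesis using 0 by (simp add: G0)
    next
      case (Suc j)
      have "\<not> e \<subseteq> G (Suc j)"
        by (rule not_less_Least[of j "\<lambda>i. e \<subseteq> G (Suc i)"]) (use Suc in \<open>simp add: level_def\<close>)
      then show ?thesis using Suc by simp
    qed
    then show ?thesis using 1 e by (simp add: edges_def)
  qed
  define \<tau> where "\<tau> p = \<sigma> (level (fst p)) p" for p
  have \<tau>: "\<tau> (e, u) \<in> (e - G (level e)) \<times> {..<n}" if "e \<in> hyperedges N" "u < m" for e u
    using \<sigma>(2)[OF level[OF that(1)] that(2)] by (simp add: \<tau>_def)
  \<comment> \<open>A charged point is new in the layer of its edge, so it determines that layer;
    one inequality suffices by symmetry.\<close>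
  have le: "level e \<le> level e'" if "e \<in> hyperedges N" "e' \<in> hyperedges N" "u < m" "u' < m" "\<tau> (e, u) = \<tau> (e', u')" for e e' u u'
  proof (rule ccontr)
    assume "\<not> ?thesis"
    then have "G (Suc (level e')) \<subseteq> G (level e)" by (intro monoD[OF mono]) simp
    moreover have "fst (\<tau> (e', u')) \<in> e'" "fst (\<tau> (e, u)) \<notin> G (level e)"
      using \<tau>[OF that(1,3)] \<tau>[OF that(2,4)] by auto
    moreover have "e' \<subseteq> G (Suc (level e'))" using level[OF that(2)] by (simp add: edges_def)
    ultimately show False using that(5) by auto
  qed
  have "inj_on \<tau> (hyperedges N \<times> {..<m})"
  proof (rule inj_onI)
    fix p p' assume p: "p \<in> hyperedges N \<times> {..<m}" "p' \<in> hyperedges N \<times> {..<m}" "\<tau> p = \<tau> p'"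
    obtain e u e' u' where [simp]: "p = (e, u)" "p' = (e', u')" by (cases p, cases p') auto
    have lev: "level e = level e'" using le[of e e' u u'] le[of e' e u' u] p by simp
    then have "\<sigma> (level e) p = \<sigma> (level e) p'" using p(3) by (simp add: \<tau>_def)
    moreover have "p \<in> (edges N (G (Suc (level e))) - edges N (G (level e))) \<times> {..<m}"
      "p' \<in> (edges N (G (Suc (level e))) - edges N (G (level e))) \<times> {..<m}"
      using level[of e] level[of e'] lev p by auto
    ultimately show "p = p'" using \<sigma>(1)[of "level e"] by (simp add: inj_on_eq_iff)
  qed
  moreover have "\<tau> (e, u) \<in> e \<times> {..<n}" if "e \<in> hyperedges N" "u < m" for e u
    using \<tau>[OF that] by auto
  ultimately show ?thesis by (intro exI[of _ \<tau>]) auto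
qed

end

text \<open>\<open>\<sigma>\<close> charges each of the \<open>m\<close> units of every hyperedge to one of the \<open>n\<close> slots of one of its
  vertices. The hyperedge charged to a slot \<open>s\<close> of \<open>v\<close> is encoded by the \<open>r\<close> unary functions
  \<open>v \<mapsto> step (s, p) v\<close>, \<open>p < r\<close>; an unused slot yields the constant tuple of \<open>v\<close>, which is not a
  hyperedge since \<open>r \<ge> 2\<close>.\<close>

locale oriented_hypergraph =
  fixes r n m :: nat and N :: "'a :: linorder struct" and \<sigma> :: "'a set \<times> nat \<Rightarrow> 'a \<times> nat"
  assumes r2: "2 \<le> r" and m1: "1 \<le> m" and hyp: "hypergraph r N"
    and inj: "inj_on \<sigma> (hyperedges N \<times> {..<m})"
    and charge: "\<And>e u. e \<in> hyperedges N \<Longrightarrow> u < m \<Longrightarrow> \<sigma> (e, u) \<in> e \<times> {..<n}"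
begin

section \<open>Slots, unary functions and words\<close>

definition owned :: "'a \<Rightarrow> nat \<Rightarrow> 'a set \<Rightarrow> bool" where
  "owned v s e \<longleftrightarrow> e \<in> hyperedges N \<and> (\<exists>u<m. \<sigma> (e, u) = (v, s))"

definition slot :: "'a \<Rightarrow> nat \<Rightarrow> 'a list" where
  "slot v s = (if \<exists>e. owned v s e then sorted_list_of_set (SOME e. owned v s e) else replicate r v)"

definition step :: "nat \<times> nat \<Rightarrow> 'a \<Rightarrow> 'a" where
  "step c v = slot v (fst c) ! snd c"

text \<open>The head of a word is applied last, so prefixing a letter continues a path.\<close>

definition ev :: "(nat \<times> nat) list \<Rightarrow> 'a \<Rightarrow> 'a" where
  "ev w v = foldr step w v"

definition words :: "nat \<Rightarrow> (nat \<times> nat) list set" where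
  "words k = {w. set w \<subseteq> {..<n} \<times> {..<r} \<and> length w \<le> k}"

lemma finite_words: "finite (words k)"
  unfolding words_def by (rule finite_lists_length_le) simp

lemma ev_Nil [simp]: "ev [] v = v" and ev_Cons [simp]: "ev (c # w) v = step c (ev w v)"
  by (simp_all add: ev_def)

lemma hyperedge:
  assumes "e \<in> hyperedges N"
  shows "finite e" "card e = r" "e \<subseteq> univ N"
  using assms hyp by (auto simp: hyperedges_def hypergraph_def r_struct_def distinct_card)

text \<open>Injectivity of \<open>\<sigma>\<close> leaves at most one hyperedge per slot, so the
  choice made in \<open>slot\<close> is determined.\<close>

lemma slot_owned:
  assumes "owned v s e"
  shows "set (slot v s) = e" "length (slot v s) = r"
proof -
  have "e' = e" if "owned v s e'" for e'
    using that assms inj unfolding owned_def by (metis SigmaI inj_onD lessThan_iff prod.inject)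
  then have "(SOME e. owned v s e) = e" using some_equality[of "owned v s" e] assms by blast
  then have "slot v s = sorted_list_of_set e" using assms by (auto simp: slot_def)
  moreover have "e \<in> hyperedges N" using assms by (simp add: owned_def)
  ultimately show "set (slot v s) = e" "length (slot v s) = r" using hyperedge by simp_all
qed

lemma slot_not_owned: "\<nexists>e. owned v s e \<Longrightarrow> slot v s = replicate r v"
  by (simp add: slot_def)

lemma step_univ: "v \<in> univ N \<Longrightarrow> snd c < r \<Longrightarrow> step c v \<in> univ N"
proof (cases "\<exists>e. owned v (fst c) e")
  case True
  assume "snd c < r"
  then obtain e where e: "owned v (fst c) e" using True by blast
  then have "step c v \<in> e" using slot_owned[OF e] \<open>snd c < r\<close> by (metis nth_mem step_def)
  then show ?thesis using hyperedge(3)[of e] e by (auto simp: owned_def)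
qed (simp add: step_def slot_not_owned)

lemma ev_univ: "v \<in> univ N \<Longrightarrow> w \<in> words k \<Longrightarrow> ev w v \<in> univ N"
proof (induction w arbitrary: k)
  case (Cons c w)
  then have "w \<in> words k" "snd c < r" by (auto simp: words_def)
  then show ?case using Cons.IH[of k] Cons.prems by (simp add: step_univ)
qed simp

lemma rel_iff:
  "xs \<in> rel N \<longleftrightarrow> distinct xs \<and> length xs = r \<and>
     (\<exists>v\<in>set xs. \<exists>s<n. \<forall>x\<in>set xs. \<exists>p<r. step (s, p) v = x)" (is "?L \<longleftrightarrow> ?R")
proof
  assume xs: ?L
  then have 1: "distinct xs" "length xs = r" using hyp by (auto simp: hypergraph_def r_struct_def)
  let ?e = "set xs"
  have e: "?e \<in> hyperedges N" using xs by (simp add: hyperedges_def)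
  obtain v s where vs: "\<sigma> (?e, 0) = (v, s)" by (cases "\<sigma> (?e, 0)")
  \<comment> \<open>One unit already places the hyperedge in a slot, so unit 0 is enough.\<close>
  have "0 < m" using m1 by simp
  then have o: "owned v s ?e" "v \<in> ?e" "s < n" using e vs charge[OF e, of 0] by (auto simp: owned_def)
  have "\<exists>p<r. step (s, p) v = x" if "x \<in> ?e" for x
    using that slot_owned[OF o(1)] unfolding step_def by (metis fst_conv snd_conv in_set_conv_nth)
  then show ?R using 1 o by blast
next
  assume ?R
  then obtain v s where vs: "distinct xs" "length xs = r" "s < n" "\<forall>x\<in>set xs. \<exists>p<r. step (s, p) v = x" by blast
  have card: "card (set xs) = r" using vs by (simp add: distinct_card)
  show ?L
  proof (cases "\<exists>e. owned v s e")
    case True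
    then obtain e where e: "owned v s e" by blast
    have "set xs \<subseteq> set (slot v s)"
    proof
      fix x assume "x \<in> set xs"
      then obtain p where "p < r" "slot v s ! p = x" using vs(4) by (auto simp: step_def)
      then show "x \<in> set (slot v s)" using slot_owned(2)[OF e] by (metis nth_mem)
    qed
    then have "set xs \<subseteq> e" using slot_owned(1)[OF e] by simp
    moreover have eh: "e \<in> hyperedges N" using e by (simp add: owned_def)
    ultimately have "set xs = e" using hyperedge[OF eh] card by (simp add: card_subset_eq)
    moreover obtain ys where ys: "ys \<in> rel N" "e = set ys" using eh by (auto simp: hyperedges_def)
    moreover have "distinct ys" using ys(1) hyp by (auto simp: hypergraph_def)
    ultimately have "mset xs = mset ys" using vs(1) by (simp add: set_eq_iff_mset_eq_distinct)
    then show ?L using ys(1) hyp unfolding hypergraph_def by blast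
  next
    case False
    then have "set xs \<subseteq> {v}" using vs(4) by (auto simp: step_def slot_not_owned)
    then have "card (set xs) \<le> 1" by (metis card_mono card.empty card_insert_disjoint empty_iff finite.simps One_nat_def)
    then show ?thesis using card r2 by simp
  qed
qed

text \<open>An edge of \<open>Z\<close> not inside \<open>Z'\<close> has no unit charged to
  \<open>Z'\<close>, so its \<open>m\<close> units occupy slots of \<open>Z - Z'\<close>, of which
  there are \<open>n\<close> per point.\<close>

lemma predim_closed:
  assumes Z: "finite Z" "Z' \<subseteq> Z"
    and closed: "\<And>v s e. v \<in> Z' \<Longrightarrow> owned v s e \<Longrightarrow> e \<subseteq> Z \<Longrightarrow> e \<subseteq> Z'"
  shows "predim n m (substr N Z') \<le> predim n m (substr N Z)"
proof -
  let ?D = "edges N Z - edges N Z'"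
  have finZ': "finite Z'" using Z by (auto intro: finite_subset)
  have "\<sigma> ` (?D \<times> {..<m}) \<subseteq> (Z - Z') \<times> {..<n}"
  proof
    fix q assume "q \<in> \<sigma> ` (?D \<times> {..<m})"
    then obtain e u where e: "e \<in> ?D" "u < m" "q = \<sigma> (e, u)" by auto
    have eh: "e \<in> hyperedges N" "e \<subseteq> Z" "\<not> e \<subseteq> Z'" using e(1) by (auto simp: edges_def)
    obtain v s where q: "q = (v, s)" by (cases q)
    have "owned v s e" using eh(1) e q by (auto simp: owned_def)
    then have "v \<notin> Z'" using closed eh by blast
    then show "q \<in> (Z - Z') \<times> {..<n}" using charge[OF eh(1) e(2)] e(3) eh(2) q by auto
  qed
  then have "card (\<sigma> ` (?D \<times> {..<m})) \<le> card ((Z - Z') \<times> {..<n})"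
    using Z(1) by (intro card_mono) auto
  moreover have "inj_on \<sigma> (?D \<times> {..<m})"
    by (rule inj_on_subset[OF inj]) (auto simp: edges_def)
  ultimately have 1: "card ?D * m \<le> card (Z - Z') * n"
    by (simp add: card_image card_cartesian_product)
  have "edges N Z' \<subseteq> edges N Z" using Z(2) by (auto simp: edges_def)
  then have 2: "card (edges N Z) = card (edges N Z') + card ?D"
    using finite_edges[OF Z(1), of N] finite_edges[OF finZ', of N]
    by (metis card_Diff_subset card_mono le_add_diff_inverse)
  have 3: "card Z = card Z' + card (Z - Z')"
    using Z finZ' by (metis card_Diff_subset card_mono le_add_diff_inverse)
  have "int m * int (card ?D) \<le> int n * int (card (Z - Z'))"
    using 1 by (metis mult.commute of_nat_le_iff of_nat_mult)
  then show ?thesis unfolding predim_substr 2 3 by (simp add: algebra_simps)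
qed

text \<open>The sets \<open>T j\<close> grow strictly until they fill \<open>Z\<close>: a stable
  \<open>T j\<close> is closed, so \<open>predim_closed\<close> makes its predimension at most that
  of \<open>Z\<close>, and tightness leaves only \<open>Z\<close> itself.\<close>

lemma tight_reachable:
  assumes Z: "finite Z" "card Z \<le> k" "tight n m N (e ` V) Z" "z \<in> Z"
  shows "\<exists>v\<in>V. \<exists>w\<in>words k. z = ev w (e v)"
proof -
  define T where "T j = {z \<in> Z. \<exists>v\<in>V. \<exists>w\<in>words j. z = ev w (e v)}" for j
  have words_mono: "words j \<subseteq> words (Suc j)" for j by (auto simp: words_def)
  have TZ: "T j \<subseteq> Z" for j by (auto simp: T_def)
  have step: "T j \<subseteq> T (Suc j)" for j using words_mono[of j] by (auto simp: T_def)
  have mono: "T i \<subseteq> T j" if "i \<le> j" for i j using lift_Suc_mono_le[of T, OF step that] .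
  have eT: "e ` V \<subseteq> T j" for j
  proof -
    have "e ` V \<subseteq> Z" using Z(3) by (simp add: tight_def)
    moreover have "[] \<in> words j" by (simp add: words_def)
    ultimately show ?thesis by (force simp: T_def)
  qed
  have stable: "T j = Z" if eq: "T (Suc j) = T j" for j
  proof (rule ccontr)
    assume "T j \<noteq> Z"
    then have "T j \<subset> Z" using TZ[of j] by blast
    then have "predim n m (substr N Z) < predim n m (substr N (T j))"
      using Z(3) eT[of j] by (simp add: tight_def)
    moreover have "predim n m (substr N (T j)) \<le> predim n m (substr N Z)"
    proof (rule predim_closed[OF Z(1) TZ])
      fix v s f assume v: "v \<in> T j" and o: "owned v s f" and f: "f \<subseteq> Z"
      obtain v0 w where w: "v0 \<in> V" "w \<in> words j" "v = ev w (e v0)" using v by (auto simp: T_def)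
      have sn: "s < n" using o charge by (force simp: owned_def)
      have "x \<in> T (Suc j)" if x: "x \<in> f" for x
      proof -
        obtain p where p: "p < r" "step (s, p) v = x"
          using x slot_owned[OF o] unfolding step_def by (metis fst_conv snd_conv in_set_conv_nth)
        have "(s, p) # w \<in> words (Suc j)" using w(2) sn p(1) by (auto simp: words_def)
        moreover have "x = ev ((s, p) # w) (e v0)" using p(2) w(3) by simp
        ultimately show ?thesis using w(1) x f unfolding T_def by blast
      qed
      then show "f \<subseteq> T j" using eq by blast
    qed
    ultimately show False by simp
  qed
  have "T k = Z"
  proof (rule ccontr)
    assume ne: "T k \<noteq> Z"
    \<comment> \<open>At least one point is gained per round; at \<open>Suc k\<close> the count
      would exceed \<open>card Z\<close>.\<close>
    have "j \<le> card (T j)" if "j \<le> Suc k" for j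
      using that
    proof (induction j)
      case (Suc j)
      then have "T j \<noteq> Z" using ne mono[of j k] TZ by fastforce
      then have "T j \<subset> T (Suc j)" using stable[of j] step[of j] by blast
      then have "card (T j) < card (T (Suc j))"
        using Z(1) TZ finite_subset by (metis psubset_card_mono)
      then show ?case using Suc by simp
    qed simp
    from this[of "Suc k"] show False
      using card_mono[OF Z(1) TZ[of "Suc k"]] Z(2) by simp
  qed
  then show ?thesis using Z(4) by (auto simp: T_def)
qed

text \<open>Words of length up to \<open>k\<close> name all points of \<open>Z\<close>. One more
  letter is spent to say that a function takes one point to another, which by \<open>rel_iff\<close>
  decides the edges.\<close>

lemma words_tight_le:
  assumes e: "e ` V \<subseteq> univ N" "e' ` V \<subseteq> univ N"
    and eq: "\<And>v w v' w'. v \<in> V \<Longrightarrow> w \<in> words (Suc k) \<Longrightarrow> v' \<in> V \<Longrightarrow> w' \<in> words (Suc k) \<Longrightarrow>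
      ev w (e v) = ev w' (e v') \<longleftrightarrow> ev w (e' v) = ev w' (e' v')"
  shows "tight_le n m N (\<lambda>c. c \<le> k) V e e'"
  unfolding tight_le_def
proof (intro allI impI; elim conjE)
  fix Z assume Z: "finite Z" "Z \<subseteq> univ N" "card Z \<le> k" "tight n m N (e ` V) Z"
  have sub: "words k \<subseteq> words (Suc k)" by (auto simp: words_def)
  have "\<forall>z\<in>Z. \<exists>t. fst t \<in> V \<and> snd t \<in> words k \<and> z = ev (snd t) (e (fst t))"
    using tight_reachable[OF Z(1,3,4)] by (metis fst_conv snd_conv)
  then obtain t where t: "\<And>z. z \<in> Z \<Longrightarrow> fst (t z) \<in> V" "\<And>z. z \<in> Z \<Longrightarrow> snd (t z) \<in> words k"
      "\<And>z. z \<in> Z \<Longrightarrow> z = ev (snd (t z)) (e (fst (t z)))" by metis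
  \<comment> \<open>The word naming \<open>z\<close> is read at the other tuple; \<open>g_eq\<close>
    shows that the choice of the word does not matter.\<close>
  define g where "g z = ev (snd (t z)) (e' (fst (t z)))" for z
  have g_eq: "z = ev w (e v) \<longleftrightarrow> g z = ev w (e' v)" if "z \<in> Z" "v \<in> V" "w \<in> words (Suc k)" for z v w
  proof -
    have "ev (snd (t z)) (e (fst (t z))) = ev w (e v) \<longleftrightarrow> g z = ev w (e' v)"
      unfolding g_def using that t(1,2)[OF that(1)] sub by (intro eq) auto
    then show ?thesis using t(3)[OF that(1)] by simp
  qed
  have inj_g: "inj_on g Z"
  proof (rule inj_onI)
    fix x y assume xy: "x \<in> Z" "y \<in> Z" "g x = g y"
    have "x = ev (snd (t y)) (e (fst (t y)))"
      by (subst g_eq) (use xy t(1,2)[OF xy(2)] sub in \<open>auto simp: g_def\<close>)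
    then show "x = y" using t(3)[OF xy(2)] by simp
  qed
  have step_g: "step (s, p) x = y \<longleftrightarrow> step (s, p) (g x) = g y" if "x \<in> Z" "y \<in> Z" "s < n" "p < r" for s p x y
  proof -
    have "(s, p) # snd (t x) \<in> words (Suc k)" using t(2)[OF that(1)] that by (auto simp: words_def)
    from g_eq[OF that(2) t(1)[OF that(1)] this] show ?thesis
      using t(3)[OF that(1)] by (auto simp: g_def)
  qed
  have "embedding g (substr N Z) N"
  proof (rule embedding_substrI[OF inj_g])
    show "g ` Z \<subseteq> univ N" unfolding g_def using t(1,2) e(2) ev_univ by blast
    fix xs assume xs: "set xs \<subseteq> Z"
    have "distinct (map g xs) \<longleftrightarrow> distinct xs" using inj_on_subset[OF inj_g xs] by (simp add: distinct_map)
    moreover have "(\<exists>v\<in>set (map g xs). \<exists>s<n. \<forall>x\<in>set (map g xs). \<exists>p<r. step (s, p) v = x)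
        \<longleftrightarrow> (\<exists>v\<in>set xs. \<exists>s<n. \<forall>x\<in>set xs. \<exists>p<r. step (s, p) (g v) = g x)" by simp
    moreover have "\<dots> \<longleftrightarrow> (\<exists>v\<in>set xs. \<exists>s<n. \<forall>x\<in>set xs. \<exists>p<r. step (s, p) v = x)"
      using step_g xs by (intro bex_cong refl ex_cong conj_cong ball_cong) (auto simp: subset_iff)
    ultimately show "map g xs \<in> rel N \<longleftrightarrow> xs \<in> rel N" unfolding rel_iff by simp
  qed
  moreover have "g (e v) = e' v" if "v \<in> V" for v
  proof -
    have "e v \<in> Z" using Z(4) that by (auto simp: tight_def)
    moreover have "[] \<in> words (Suc k)" by (simp add: words_def)
    ultimately show ?thesis using g_eq[of "e v" v "[]"] that by simp
  qed
  ultimately show "\<exists>g. embedding g (substr N Z) N \<and> (\<forall>v\<in>V. g (e v) = e' v)" by blast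
qed

end

section \<open>Definable relations\<close>

lemma coverable_cong:
  assumes "coverable A B E" "\<And>i j. i \<in> A \<Longrightarrow> j \<in> B \<Longrightarrow> E' i j = E i j"
  shows "coverable A B E'"
proof -
  obtain C where C: "0 \<le> C" "\<And>I J. finite I \<Longrightarrow> finite J \<Longrightarrow> I \<subseteq> A \<Longrightarrow> J \<subseteq> B \<Longrightarrow> box_cover C I J E"
    using assms(1) by (rule coverableE) blast
  show ?thesis
  proof (rule coverableI[OF C(1)])
    fix I J assume IJ: "finite I" "finite J" "I \<subseteq> A" "J \<subseteq> B"
    show "box_cover C I J E'"
      by (rule box_cover_pullback[OF C(2)[OF IJ], of id _ id]) (use IJ assms(2) in auto)
  qed
qed

text \<open>The constant is taken from \<open>N\<close>: each finite part of \<open>M\<close> is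
  copied into \<open>N\<close> as a pattern, and the cover found there is pulled back.\<close>

lemma coverable_models:
  fixes M :: "'a struct" and N :: "'b struct"
  assumes mod: "models r M (Th r N)" and \<phi>: "r_form r \<phi>" "fv \<phi> \<subseteq> V \<union> W" "V \<inter> W = {}"
    and fin: "finite V" "finite W"
    and cov: "coverable (asg N V) (asg N W) (asg_rel N \<phi> V)"
  shows "coverable (asg M V) (asg M W) (asg_rel M \<phi> V)"
proof -
  obtain C where C: "0 \<le> C" "\<And>I J. finite I \<Longrightarrow> finite J \<Longrightarrow> I \<subseteq> asg N V \<Longrightarrow> J \<subseteq> asg N W \<Longrightarrow>
      box_cover C I J (asg_rel N \<phi> V)"
    using cov by (rule coverableE) blast
  show ?thesis
  proof (rule coverableI[OF C(1)])
    fix I J assume IJ: "finite I" "finite J" "I \<subseteq> asg M V" "J \<subseteq> asg M W"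
    obtain f where f: "bij_betw f {0..<card I} I" using ex_bij_betw_nat_finite[OF IJ(1)] by blast
    obtain g where g: "bij_betw g {0..<card J} J" using ex_bij_betw_nat_finite[OF IJ(2)] by blast
    define f' where "f' = inv_into {0..<card I} f"
    define g' where "g' = inv_into {0..<card J} g"
    have f': "f' a < card I" "f (f' a) = a" if "a \<in> I" for a
      using that f bij_betw_inv_into_right[OF f that] bij_betw_apply[OF bij_betw_inv_into[OF f] that]
      by (auto simp: f'_def)
    have g': "g' a < card J" "g (g' a) = a" if "a \<in> J" for a
      using that g bij_betw_inv_into_right[OF g that] bij_betw_apply[OF bij_betw_inv_into[OF g] that]
      by (auto simp: g'_def)
    have "f i \<in> asg M V" if "i < card I" for i
      using IJ(3) bij_betw_apply[OF f, of i] that by auto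
    moreover have "g i \<in> asg M W" if "i < card J" for i
      using IJ(4) bij_betw_apply[OF g, of i] that by auto
    ultimately obtain as bs where ab: "\<forall>i<card I. as i \<in> asg N V" "\<forall>j<card J. bs j \<in> asg N W"
      "\<forall>i<card I. \<forall>j<card J. asg_rel M \<phi> V (f i) (g j) = asg_rel N \<phi> V (as i) (bs j)"
      using transfer_pattern[OF mod \<phi> fin, of "card I" f "card J" g] by blast
    show "box_cover C I J (asg_rel M \<phi> V)"
    proof (rule box_cover_pullback[of C "as ` {..<card I}" "bs ` {..<card J}" "asg_rel N \<phi> V" "as \<circ> f'" _ "bs \<circ> g'"])
      show "box_cover C (as ` {..<card I}) (bs ` {..<card J}) (asg_rel N \<phi> V)"
        using ab by (intro C(2)) auto
      show "asg_rel M \<phi> V i j = asg_rel N \<phi> V ((as \<circ> f') i) ((bs \<circ> g') j)" if "i \<in> I" "j \<in> J" for i j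
        using ab(3) f'[OF that(1)] g'[OF that(2)] by (metis comp_apply)
    qed (use f' g' in auto)
  qed
qed

lemma coverable_defined_relation:
  assumes cov: "coverable (asg M (set x1)) (asg M (set x2)) (asg_rel M \<phi> (set x1))"
    and x: "distinct (x1 @ x2)" and fv: "fv \<phi> \<subseteq> set (x1 @ x2)"
  shows "coverable (tuples M x1) (tuples M x2) (\<lambda>a b. (a, b) \<in> defined_relation M \<phi> x1 x2)"
proof -
  define \<alpha> where "\<alpha> x a v = the (map_of (zip x a) v)" for x and a :: "'a list" and v :: nat
  have \<alpha>: "\<alpha> x a \<in> asg M (set x)" if "a \<in> tuples M x" for x a
    unfolding asg_def
  proof (intro CollectI ballI)
    fix v assume "v \<in> set x"
    moreover have l: "length x = length a" "set a \<subseteq> univ M" using that by (auto simp: tuples_def)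
    ultimately obtain y where y: "map_of (zip x a) v = Some y"
      by (metis map_of_zip_is_None not_None_eq)
    then have "y \<in> set a" by (meson map_of_SomeD set_zip_rightD)
    then show "\<alpha> x a v \<in> univ M" using y l by (auto simp: \<alpha>_def)
  qed
  have rel: "(a, b) \<in> defined_relation M \<phi> x1 x2 \<longleftrightarrow> asg_rel M \<phi> (set x1) (\<alpha> x1 a) (\<alpha> x2 b)"
    if ab: "a \<in> tuples M x1" "b \<in> tuples M x2" for a b
  proof -
    have l: "length x1 = length a" "length x2 = length b" using ab by (auto simp: tuples_def)
    have "the (map_of (zip (x1 @ x2) (a @ b)) v) = (if v \<in> set x1 then \<alpha> x1 a v else \<alpha> x2 b v)" for v
    proof (cases "v \<in> set x1")
      case True
      then obtain y where "map_of (zip x1 a) v = Some y" using l by (metis map_of_zip_is_None not_None_eq)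
      then show ?thesis using True l by (simp add: map_add_def \<alpha>_def)
    next
      case False
      then have None: "map_of (zip x1 a) v = None" using l by simp
      show ?thesis using False l(1) by (simp add: map_add_def \<alpha>_def None split: option.split)
    qed
    then show ?thesis using ab by (simp add: defined_relation_def asg_rel_def)
  qed
  obtain C where C: "0 \<le> C" "\<And>I J. finite I \<Longrightarrow> finite J \<Longrightarrow> I \<subseteq> asg M (set x1) \<Longrightarrow> J \<subseteq> asg M (set x2) \<Longrightarrow>
      box_cover C I J (asg_rel M \<phi> (set x1))"
    using cov by (rule coverableE) blast
  show ?thesis
  proof (rule coverableI[OF C(1)])
    fix I J assume IJ: "finite I" "finite J" "I \<subseteq> tuples M x1" "J \<subseteq> tuples M x2"
    show "box_cover C I J (\<lambda>a b. (a, b) \<in> defined_relation M \<phi> x1 x2)"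
    proof (rule box_cover_pullback[of C "\<alpha> x1 ` I" "\<alpha> x2 ` J"])
      show "box_cover C (\<alpha> x1 ` I) (\<alpha> x2 ` J) (asg_rel M \<phi> (set x1))"
        using IJ \<alpha> by (intro C(2)) auto
      show "(i, j) \<in> defined_relation M \<phi> x1 x2 \<longleftrightarrow> asg_rel M \<phi> (set x1) (\<alpha> x1 i) (\<alpha> x2 j)"
        if "i \<in> I" "j \<in> J" for i j
        by (rule rel) (use that IJ in auto)
    qed auto
  qed
qed

context generic_hypergraph
begin

text \<open>An atom compares two words at single coordinates. If both coordinates lie on one side it
  is a unary condition, and otherwise an equation between a function of \<open>a\<close> and a
  function of \<open>b\<close>.\<close>

lemma coverable_asg_rel:
  assumes r: "2 \<le> r" and m: "1 \<le> m" and fin: "finite V" "finite W"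
    and fv: "fv \<phi> \<subseteq> V \<union> W"
    and transfer: "\<exists>k. \<forall>e e'. e ` (V \<union> W) \<subseteq> univ N \<and> e' ` (V \<union> W) \<subseteq> univ N \<and>
      tight_le n m N (\<lambda>c. c \<le> k) (V \<union> W) e e' \<and> tight_le n m N (\<lambda>c. c \<le> k) (V \<union> W) e' e \<longrightarrow>
      (sat N e \<phi> \<longleftrightarrow> sat N e' \<phi>)"
  shows "coverable (asg N V) (asg N W) (asg_rel N \<phi> V)"
proof -
  obtain k where "\<forall>e e'. e ` (V \<union> W) \<subseteq> univ N \<and> e' ` (V \<union> W) \<subseteq> univ N \<and>
      tight_le n m N (\<lambda>c. c \<le> k) (V \<union> W) e e' \<and> tight_le n m N (\<lambda>c. c \<le> k) (V \<union> W) e' e \<longrightarrow>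
      (sat N e \<phi> \<longleftrightarrow> sat N e' \<phi>)"
    using transfer by (elim exE)
  then have k: "sat N e \<phi> \<longleftrightarrow> sat N e' \<phi>"
    if "e ` (V \<union> W) \<subseteq> univ N" "e' ` (V \<union> W) \<subseteq> univ N"
      "tight_le n m N (\<lambda>c. c \<le> k) (V \<union> W) e e'" "tight_le n m N (\<lambda>c. c \<le> k) (V \<union> W) e' e" for e e'
    using that by blast
  obtain \<sigma> where "inj_on \<sigma> (hyperedges N \<times> {..<m})" "\<forall>e\<in>hyperedges N. \<forall>u<m. \<sigma> (e, u) \<in> e \<times> {..<n}"
    using orientation r by auto
  then interpret oriented_hypergraph r n m N \<sigma>
    by unfold_locales (use r m hypergraph_N in auto)
  define merge where "merge a b v = (if v \<in> V then a v else b v)" for a b :: "nat \<Rightarrow> nat" and v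
  \<comment> \<open>Length \<open>Suc k\<close> is what \<open>words_tight_le\<close> asks for in
    order to compare tight extensions of size up to \<open>k\<close>.\<close>
  define L where "L = ((V \<union> W) \<times> words (Suc k)) \<times> ((V \<union> W) \<times> words (Suc k))"
  define E where "E l a b \<longleftrightarrow> (case l of ((v, w), (v', w')) \<Rightarrow> ev w (merge a b v) = ev w' (merge a b v'))"
    for l :: "(nat \<times> (nat \<times> nat) list) \<times> (nat \<times> (nat \<times> nat) list)" and a b
  have L: "finite L" using fin finite_words by (simp add: L_def)
  have E: "coverable (asg N V) (asg N W) (E l)" "coverable (asg N V) (asg N W) (\<lambda>a b. \<not> E l a b)" for l
  proof -
    obtain v w v' w' where l: "l = ((v, w), (v', w'))" by (metis surj_pair)
    have "coverable (asg N V) (asg N W) (E l) \<and> coverable (asg N V) (asg N W) (\<lambda>a b. \<not> E l a b)"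
    proof (cases "v \<in> V"; cases "v' \<in> V")
      assume "v \<in> V" "v' \<in> V"
      then show ?thesis unfolding E_def merge_def l by (simp add: coverable_left)
    next
      assume "v \<in> V" "v' \<notin> V"
      then show ?thesis
        unfolding E_def merge_def l using coverable_eq[of _ _ "\<lambda>a. ev w (a v)" "\<lambda>b. ev w' (b v')"]
          coverable_neq[of _ _ "\<lambda>a. ev w (a v)" "\<lambda>b. ev w' (b v')"] by simp
    next
      assume "v \<notin> V" "v' \<in> V"
      then show ?thesis
        unfolding E_def merge_def l using coverable_eq[of _ _ "\<lambda>a. ev w' (a v')" "\<lambda>b. ev w (b v)"]
          coverable_neq[of _ _ "\<lambda>a. ev w' (a v')" "\<lambda>b. ev w (b v)"] by (simp add: eq_commute)
    next
      assume "v \<notin> V" "v' \<notin> V"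
      then show ?thesis
        unfolding E_def merge_def l using coverable_right[of "asg N V" "asg N W" "\<lambda>b. ev w (b v) = ev w' (b v')"]
          coverable_right[of "asg N V" "asg N W" "\<lambda>b. ev w (b v) \<noteq> ev w' (b v')"] by simp
    qed
    then show "coverable (asg N V) (asg N W) (E l)" "coverable (asg N V) (asg N W) (\<lambda>a b. \<not> E l a b)"
      by auto
  qed
  have determined: "asg_rel N \<phi> V a b \<longleftrightarrow> asg_rel N \<phi> V a' b'"
    if ab: "a \<in> asg N V" "b \<in> asg N W" "a' \<in> asg N V" "b' \<in> asg N W"
      and eq: "{l \<in> L. E l a b} = {l \<in> L. E l a' b'}" for a b a' b'
  proof -
    have u: "merge a b ` (V \<union> W) \<subseteq> univ N" "merge a' b' ` (V \<union> W) \<subseteq> univ N"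
      using ab by (auto simp: merge_def asg_def)
    have E_eq: "E l a b \<longleftrightarrow> E l a' b'" if "l \<in> L" for l using eq that by blast
    have e: "ev w (merge a b v) = ev w' (merge a b v') \<longleftrightarrow> ev w (merge a' b' v) = ev w' (merge a' b' v')"
      if "v \<in> V \<union> W" "w \<in> words (Suc k)" "v' \<in> V \<union> W" "w' \<in> words (Suc k)" for v w v' w'
      using E_eq[of "((v, w), (v', w'))"] that by (simp add: L_def E_def)
    have "sat N (merge a b) \<phi> \<longleftrightarrow> sat N (merge a' b') \<phi>"
      by (rule k[OF u words_tight_le[OF u e] words_tight_le[OF u(2,1) e[symmetric]]])
    moreover have "asg_rel N \<phi> V c d \<longleftrightarrow> sat N (merge c d) \<phi>" for c d
      by (simp add: asg_rel_def merge_def[abs_def])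
    ultimately show ?thesis by simp
  qed
  \<comment> \<open>The truth table, read off from realized sets of atoms; by
    \<open>determined\<close> it does not depend on the realization.\<close>
  define F where "F T \<longleftrightarrow> (\<exists>a\<in>asg N V. \<exists>b\<in>asg N W. T = {l \<in> L. E l a b} \<and> asg_rel N \<phi> V a b)" for T
  have "coverable (asg N V) (asg N W) (\<lambda>a b. F {l \<in> L. E l a b})"
    by (rule coverable_bool_combination[OF L]) (simp_all add: E)
  then show ?thesis
  proof (rule coverable_cong)
    fix a b assume "a \<in> asg N V" "b \<in> asg N W"
    then show "asg_rel N \<phi> V a b = F {l \<in> L. E l a b}"
      using determined unfolding F_def by blast
  qed
qed

lemma models_linear_Zarankiewicz_sEH:
  fixes M :: "'a struct"
  assumes r: "2 \<le> r" and m: "1 \<le> m" and mod: "models r M (Th r N)"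
    and part: "partitioned_formula r \<phi> x1 x2"
    and transfer: "\<And>V \<phi>. finite V \<Longrightarrow> fv \<phi> \<subseteq> V \<Longrightarrow> r_form r \<phi> \<Longrightarrow>
      \<exists>k. \<forall>e e'. e ` V \<subseteq> univ N \<and> e' ` V \<subseteq> univ N \<and>
        tight_le n m N (\<lambda>c. c \<le> k) V e e' \<and> tight_le n m N (\<lambda>c. c \<le> k) V e' e \<longrightarrow>
        (sat N e \<phi> \<longleftrightarrow> sat N e' \<phi>)"
  shows "linear_Zarankiewicz M \<phi> x1 x2 \<and> sEH (tuples M x1) (tuples M x2) (defined_relation M \<phi> x1 x2)"
proof -
  have x: "distinct (x1 @ x2)" "fv \<phi> \<subseteq> set (x1 @ x2)" "r_form r \<phi>"
    using part by (auto simp: partitioned_formula_def)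
  have cov: "coverable (tuples M x1) (tuples M x2) (\<lambda>a b. (a, b) \<in> defined_relation M \<psi> x1 x2)"
    if "fv \<psi> \<subseteq> set (x1 @ x2)" "r_form r \<psi>" for \<psi>
  proof (rule coverable_defined_relation[OF coverable_models[OF mod that(2)] x(1) that(1)])
    show "coverable (asg N (set x1)) (asg N (set x2)) (asg_rel N \<psi> (set x1))"
      by (rule coverable_asg_rel[OF r m]) (use that in \<open>auto intro!: transfer\<close>)
  qed (use that x(1) in auto)
  \<comment> \<open>On tuples the complement is defined by \<open>Neg \<phi>\<close>, so covers of
    all definable relations give both covers needed for \<open>sEH\<close>.\<close>
  have "coverable (tuples M x1) (tuples M x2) (\<lambda>a b. (a, b) \<notin> defined_relation M \<phi> x1 x2)"
    by (rule coverable_cong[OF cov[of "Neg \<phi>"]]) (use x in \<open>auto simp: defined_relation_def\<close>)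
  then show ?thesis using cov[OF x(2,3)] coverable_linear_Zarankiewicz coverable_sEH by blast
qed

end

theorem theorem5p1:
  fixes r m n :: nat
  assumes "r \<ge> 2" and "m \<ge> 1" and "n \<ge> 1"
  shows "(\<forall>M0. generic_structure r n m (class_C0 r n m) M0 \<longrightarrow>
            (\<forall>M :: 'a struct. models r M (Th r M0) \<longrightarrow>
               (\<forall>\<phi> x1 x2. partitioned_formula r \<phi> x1 x2 \<longrightarrow>
                  linear_Zarankiewicz M \<phi> x1 x2 \<and>
                  sEH (tuples M x1) (tuples M x2) (defined_relation M \<phi> x1 x2)))) \<and>
         (\<forall>\<mu> D\<mu>. appropriate r n m \<mu> \<and> generic_structure r n m (class_Cmu r n m \<mu>) D\<mu> \<longrightarrow>
            (\<forall>M :: 'a struct. models r M (Th r D\<mu>) \<longrightarrow>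
               (\<forall>\<phi> x1 x2. partitioned_formula r \<phi> x1 x2 \<longrightarrow>
                  linear_Zarankiewicz M \<phi> x1 x2 \<and>
                  sEH (tuples M x1) (tuples M x2) (defined_relation M \<phi> x1 x2))))"
proof (intro conjI allI impI; (elim conjE)?)
  fix M0 and M :: "'a struct" and \<phi> x1 x2
  assume gen: "generic_structure r n m (class_C0 r n m) M0" and mod: "models r M (Th r M0)"
    and part: "partitioned_formula r \<phi> x1 x2"
  interpret generic_hypergraph r n m "class_C0 r n m" M0
    by unfold_locales (use gen in auto)
  have "linear_Zarankiewicz M \<phi> x1 x2 \<and> sEH (tuples M x1) (tuples M x2) (defined_relation M \<phi> x1 x2)"
    by (rule models_linear_Zarankiewicz_sEH[OF assms(1,2) mod part sat_transfer_C0[OF refl]])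
  then show "linear_Zarankiewicz M \<phi> x1 x2" "sEH (tuples M x1) (tuples M x2) (defined_relation M \<phi> x1 x2)"
    by blast+
next
  fix \<mu> D\<mu> and M :: "'a struct" and \<phi> x1 x2
  assume app: "appropriate r n m \<mu>" and gen: "generic_structure r n m (class_Cmu r n m \<mu>) D\<mu>"
    and mod: "models r M (Th r D\<mu>)" and part: "partitioned_formula r \<phi> x1 x2"
  interpret generic_hypergraph r n m "class_Cmu r n m \<mu>" D\<mu>
    by unfold_locales (use gen in \<open>auto simp: class_Cmu_def\<close>)
  \<comment> \<open>Strong minimality includes an infinite universe, which is therefore
    nonempty.\<close>
  have D: "omega_saturated r D\<mu>" "univ D\<mu> \<noteq> {}"
    using app gen by (auto simp: appropriate_def strongly_minimal_def)
  have iso: "B \<in> class_Cmu r n m \<mu>"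
    if "A \<in> class_Cmu r n m \<mu>" "r_struct r B" "isomorphism f A B" for A f B
    using app that unfolding appropriate_def amalgamation_class_def by blast
  have "linear_Zarankiewicz M \<phi> x1 x2 \<and> sEH (tuples M x1) (tuples M x2) (defined_relation M \<phi> x1 x2)"
    by (rule models_linear_Zarankiewicz_sEH[OF assms(1,2) mod part sat_transfer_saturated[OF iso D]])
  then show "linear_Zarankiewicz M \<phi> x1 x2" "sEH (tuples M x1) (tuples M x2) (defined_relation M \<phi> x1 x2)"
    by blast+
qed

end
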